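(* Let $V$ be a real vector space of finite dimension $n\ge 2$, let $\Gamma$ be a finitely generated group, let $\Lambda=(A,B)$ be a finite directed graph that is path-symmetric, and let $R:A\to\Gamma$ be an injective map. If a representation $\rho:\Gamma\to\mathrm{PGL}(V)$ is $(R,\Lambda)$-weakly positive, then $\rho$ is $(R,\Lambda)$-directed Anosov.
   Context: Directed graphs. A finite directed graph $\Lambda=(A,B)$ consists of a finite set $A$ of vertices and a set $B\subset A\times A$ of directed edges. It is path-symmetric if for all vertices $a,b$ there is a directed path from $a$ to $b$ if and only if there is a directed path from $b$ to $a$. A directed ray in $\Lambda$ is a sequence $(p_i)_{i=1}^\infty$ in $A$ with $(p_i,p_{i+1})\in B$ for all $i>0$. A sequence $(\eta_i)_{i=0}^\infty$ in $\Gamma$ is $(R,\Lambda)$-directed if $\eta_0=\mathrm{id}$ and there is a directed ray $(p_i)_{i=1}^\infty$ in $\Lambda$ with $\eta_i=R(p_1)R(p_2)\cdots R(p_i)$ for all $i>0$. Cartan projection. Fix an inner product on $V$ (up to scaling). For $g\in\mathrm{PGL}(V)$ let $\bar g\in\mathrm{GL}(V)$ be a representative with $|\det\bar g|=1$ and singular values $\mu_1(\bar g)\ge\dots\ge\mu_n(\bar g)$; put $\mu(g)=(\log\mu_1(\bar g),\dots,\log\mu_n(\bar g))$. Let $\Delta=\{\alpha_1,\dots,\alpha_{n-1}\}$ with $\alpha_k(x_1,\dots,x_n)=x_k-x_{k+1}$. Directed Anosov. Equip $\Gamma$ with the word metric $d_S$ of a finite generating set $S$. A sequence is a $(k,k')$-quasi-geodesic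 if $\frac1k|i-j|-k'\le d_S(\eta_i,\eta_j)\le k|i-j|+k'$ for all $i,j$. A representation $\rho:\Gamma\to\mathrm{PGL}(V)$ is $(R,\Lambda)$-directed Anosov if for all $k,k'>0$ there exist $\kappa,\kappa'>0$ such that for all $(R,\Lambda)$-directed $(k,k')$-quasi-geodesics $(\eta_i)_{i=0}^\infty$ in $\Gamma$, one has $\alpha(\mu(\rho(\eta_i)))\ge\kappa i-\kappa'$ for all integers $i\ge0$ and all $\alpha\in\Delta$. Positive tuples of flags. A (complete) flag $F$ in $V$ is a nested sequence $F^{(1)}\subset\dots\subset F^{(n-1)}$ of subspaces with $\dim F^{(k)}=k$; set $F^{(0)}=\{0\}$, $F^{(n)}=V$. Let $\mathcal F(V)$ be the space of flags, with its natural $\mathrm{PGL}(V)$-action. Flags $F,H$ are transverse if $F^{(k)}\cap H^{(n-k)}=\{0\}$ for all $k$. For an ordered basis $\mathcal B$ of $V$, $U_{>0}(\mathcal B)\subset\mathrm{PGL}(V)$ is the set of unipotent elements represented in $\mathcal B$ by an upper triangular matrix with ones on the diagonal all of whose minors are positive, except those forced to be zero by upper triangularity. For $l\ge3$, a tuple $(F_1,\dots,F_l)$ of flags is positive if $F_1,F_l$ are transverse and there are a basis $\mathcal B=(e_1,\dots,e_n)$ with $e_k\in F_1^{(n-k+1)}\cap F_l^{(k)}$ for all $k$ and $u_1,\dots,u_{l-2}\in U_{>0}(\mathcal B)$ with $(F_1,\dots,F_l)=(F_1,u_1\cdot F_1,u_1u_2\cdot F_1,\dots,u_1\cdots u_{l-2}\cdot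 F_1,F_l)$. For a positive triple $(F,H,K)$, put $\mathfrak U(F,H,K)=\{G\in\mathcal F(V):(F,G,H,K)\text{ is positive}\}$. Weak positivity. For $f:A\to\mathrm{PGL}(V)$, a compatible system of forward domains for $(f,\Lambda)$ assigns to each $a\in A$ a positive triple of flags $(F_a,H_a,K_a)$ such that for every $(a_1,a_2)\in B$: (i) $f(a_1)\cdot\mathfrak U(F_{a_2},H_{a_2},K_{a_2})\subset\mathfrak U(F_{a_1},H_{a_1},K_{a_1})$; and (ii) at least one of $(F_{a_1},f(a_1)\cdot F_{a_2},f(a_1)\cdot H_{a_2},H_{a_1})$ and $(F_{a_1},f(a_1)\cdot H_{a_2},f(a_1)\cdot F_{a_2},H_{a_1})$ is positive. The map $f$ is $\Lambda$-admissible if such a system exists. A representation $\rho:\Gamma\to\mathrm{PGL}(V)$ is $(R,\Lambda)$-weakly positive if $\rho\circ R$ is $\Lambda$-admissible. *)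

theory Defs
  imports
    "HOL-Analysis.Linear_Algebra"
    "HOL-Algebra.Algebra"
    "Jordan_Normal_Form.Determinant"
    "Jordan_Normal_Form.DL_Submatrix"
begin

text \<open>
  The vector space \<open>V\<close> with its inner product is a type \<open>'v\<close> of class \<open>euclidean_space\<close>,
  of dimension \<open>DIM('v)\<close>. Lists are 0-based, so the vector \<open>e\<^sub>k\<close> of an ordered basis is
  \<open>es ! (k - 1)\<close>, and likewise for tuples of flags.
\<close>

definition list_prod :: "('g, 'r) monoid_scheme \<Rightarrow> 'g list \<Rightarrow> 'g" where
  "list_prod G xs = foldr (\<otimes>\<^bsub>G\<^esub>) xs \<one>\<^bsub>G\<^esub>"

definition word_length :: "('g, 'r) monoid_scheme \<Rightarrow> 'g set \<Rightarrow> 'g \<Rightarrow> nat" where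
  "word_length G S g =
     (LEAST m. \<exists>ws. length ws = m \<and> set ws \<subseteq> S \<union> m_inv G ` S \<and> list_prod G ws = g)"

definition word_dist :: "('g, 'r) monoid_scheme \<Rightarrow> 'g set \<Rightarrow> 'g \<Rightarrow> 'g \<Rightarrow> nat" where
  "word_dist G S g h = word_length G S (inv\<^bsub>G\<^esub> g \<otimes>\<^bsub>G\<^esub> h)"

definition quasi_geodesic ::
  "('g, 'r) monoid_scheme \<Rightarrow> 'g set \<Rightarrow> real \<Rightarrow> real \<Rightarrow> (nat \<Rightarrow> 'g) \<Rightarrow> bool" where
  "quasi_geodesic G S k k' \<eta> \<longleftrightarrow>
     (\<forall>i j. 1 / k * \<bar>real i - real j\<bar> - k' \<le> real (word_dist G S (\<eta> i) (\<eta> j)) \<and>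
            real (word_dist G S (\<eta> i) (\<eta> j)) \<le> k * \<bar>real i - real j\<bar> + k')"

definition finite_digraph :: "'a set \<Rightarrow> ('a \<times> 'a) set \<Rightarrow> bool" where
  "finite_digraph A B \<longleftrightarrow> finite A \<and> B \<subseteq> A \<times> A"

definition path_symmetric :: "'a set \<Rightarrow> ('a \<times> 'a) set \<Rightarrow> bool" where
  "path_symmetric A B \<longleftrightarrow> (\<forall>a\<in>A. \<forall>b\<in>A. (a, b) \<in> B\<^sup>* \<longleftrightarrow> (b, a) \<in> B\<^sup>*)"

text \<open>Rays are indexed from 1; the value at 0 is irrelevant.\<close>

definition directed_ray :: "'a set \<Rightarrow> ('a \<times> 'a) set \<Rightarrow> (nat \<Rightarrow> 'a) \<Rightarrow> bool" where
  "directed_ray A B p \<longleftrightarrow> (\<forall>i>0. p i \<in> A \<and> (p i, p (i + 1)) \<in> B)"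

definition directed_seq ::
  "('g, 'r) monoid_scheme \<Rightarrow> 'a set \<Rightarrow> ('a \<times> 'a) set \<Rightarrow> ('a \<Rightarrow> 'g) \<Rightarrow> (nat \<Rightarrow> 'g) \<Rightarrow> bool" where
  "directed_seq G A B R \<eta> \<longleftrightarrow>
     \<eta> 0 = \<one>\<^bsub>G\<^esub> \<and>
     (\<exists>p. directed_ray A B p \<and> (\<forall>i>0. \<eta> i = list_prod G (map (\<lambda>j. R (p j)) [1..<i + 1])))"

definition GL :: "('v::euclidean_space \<Rightarrow> 'v) monoid" where
  "GL = \<lparr>carrier = {f. linear f \<and> bij f}, monoid.mult = (\<circ>), one = id\<rparr>"

definition scalars :: "('v::euclidean_space \<Rightarrow> 'v) set" where
  "scalars = {(\<lambda>v. c *\<^sub>R v) |c. c \<noteq> 0}"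

text \<open>An element of \<open>PGL\<close> is a coset, that is, the set of its representatives in \<open>GL\<close>.\<close>

definition PGL :: "('v::euclidean_space \<Rightarrow> 'v) set monoid" where
  "PGL = GL Mod scalars"

definition ordered_basis :: "'v::euclidean_space list \<Rightarrow> bool" where
  "ordered_basis es \<longleftrightarrow>
     length es = DIM('v) \<and> distinct es \<and> independent (set es) \<and> span (set es) = UNIV"

definition matrix_of :: "'v::euclidean_space list \<Rightarrow> ('v \<Rightarrow> 'v) \<Rightarrow> real mat" where
  "matrix_of es f =
     mat DIM('v) DIM('v) (\<lambda>(i, j). representation (set es) (f (es ! j)) (es ! i))"

text \<open>The value does not depend on the chosen ordered basis.\<close>

definition lin_det :: "('v::euclidean_space \<Rightarrow> 'v) \<Rightarrow> real" where
  "lin_det f = det (matrix_of (SOME es. ordered_basis es) f)"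

definition singular_space :: "('v::euclidean_space \<Rightarrow> 'v) \<Rightarrow> real \<Rightarrow> 'v set" where
  "singular_space f s = {v. adjoint f (f v) = s\<^sup>2 *\<^sub>R v}"

text \<open>
  The square roots of the eigenvalues of \<open>adjoint f \<circ> f\<close>, in decreasing order and repeated
  according to the dimension of the eigenspace.
\<close>

definition singular_values :: "('v::euclidean_space \<Rightarrow> 'v) \<Rightarrow> real list" where
  "singular_values f =
     concat (map (\<lambda>s. replicate (dim (singular_space f s)) s)
       (rev (sorted_list_of_set {s. s \<ge> 0 \<and> singular_space f s \<noteq> {0}})))"

text \<open>The representative of determinant \<open>\<plusminus>1\<close> is unique up to sign.\<close>

definition unimodular_rep :: "('v::euclidean_space \<Rightarrow> 'v) set \<Rightarrow> ('v \<Rightarrow> 'v)" where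
  "unimodular_rep g = (SOME f. f \<in> g \<and> \<bar>lin_det f\<bar> = 1)"

definition cartan :: "('v::euclidean_space \<Rightarrow> 'v) set \<Rightarrow> real list" where
  "cartan g = map ln (singular_values (unimodular_rep g))"

definition simple_root :: "nat \<Rightarrow> real list \<Rightarrow> real" where
  "simple_root k x = x ! (k - 1) - x ! k"

definition directed_anosov ::
  "('g, 'r) monoid_scheme \<Rightarrow> 'g set \<Rightarrow> 'a set \<Rightarrow> ('a \<times> 'a) set \<Rightarrow> ('a \<Rightarrow> 'g) \<Rightarrow>
    ('g \<Rightarrow> ('v::euclidean_space \<Rightarrow> 'v) set) \<Rightarrow> bool" where
  "directed_anosov G S A B R \<rho> \<longleftrightarrow>
     (\<forall>k>0. \<forall>k'>0. \<exists>\<kappa>>0. \<exists>\<kappa>'>0. \<forall>\<eta>.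
        directed_seq G A B R \<eta> \<and> quasi_geodesic G S k k' \<eta> \<longrightarrow>
        (\<forall>i. \<forall>m\<in>{1..DIM('v) - 1}. simple_root m (cartan (\<rho> (\<eta> i))) \<ge> \<kappa> * real i - \<kappa>'))"

type_synonym 'v flag = "nat \<Rightarrow> 'v set"

text \<open>
  Besides the proper subspaces, a flag records \<open>F 0 = {0}\<close> and \<open>F k = UNIV\<close> for all
  \<open>k \<ge> DIM('v)\<close>, both forced by the dimension condition; so equality of flags is equality
  of functions.
\<close>

definition is_flag :: "'v::euclidean_space flag \<Rightarrow> bool" where
  "is_flag F \<longleftrightarrow> mono F \<and> (\<forall>k. subspace (F k) \<and> dim (F k) = min k DIM('v))"

text \<open>The result does not depend on the chosen representative.\<close>

definition flag_act :: "('v::euclidean_space \<Rightarrow> 'v) set \<Rightarrow> 'v flag \<Rightarrow> 'v flag" where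
  "flag_act g F = (\<lambda>k. (SOME f. f \<in> g) ` F k)"

definition transverse :: "'v::euclidean_space flag \<Rightarrow> 'v flag \<Rightarrow> bool" where
  "transverse F H \<longleftrightarrow> (\<forall>k\<le>DIM('v). F k \<inter> H (DIM('v) - k) = {0})"

definition minor :: "real mat \<Rightarrow> nat set \<Rightarrow> nat set \<Rightarrow> real" where
  "minor M I J = det (submatrix M I J)"

definition forced_zero :: "nat \<Rightarrow> nat set \<Rightarrow> nat set \<Rightarrow> bool" where
  "forced_zero n I J \<longleftrightarrow> (\<forall>N\<in>carrier_mat n n. upper_triangular N \<longrightarrow> minor N I J = 0)"

definition totally_positive_unipotent :: "nat \<Rightarrow> real mat \<Rightarrow> bool" where
  "totally_positive_unipotent n M \<longleftrightarrow>
     M \<in> carrier_mat n n \<and> upper_triangular M \<and> (\<forall>i<n. M $$ (i, i) = 1) \<and>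
     (\<forall>I J. I \<subseteq> {..<n} \<and> J \<subseteq> {..<n} \<and> card I = card J \<and> \<not> forced_zero n I J \<longrightarrow>
        minor M I J > 0)"

definition U_pos :: "'v::euclidean_space list \<Rightarrow> ('v \<Rightarrow> 'v) set set" where
  "U_pos es =
     {u \<in> carrier PGL. \<exists>f\<in>u. totally_positive_unipotent DIM('v) (matrix_of es f)}"

definition positive_tuple :: "'v::euclidean_space flag list \<Rightarrow> bool" where
  "positive_tuple Fs \<longleftrightarrow>
     length Fs \<ge> 3 \<and> (\<forall>F\<in>set Fs. is_flag F) \<and> transverse (hd Fs) (last Fs) \<and>
     (\<exists>es us. ordered_basis es \<and>
        (\<forall>k\<in>{1..DIM('v)}. es ! (k - 1) \<in> hd Fs (DIM('v) - k + 1) \<inter> last Fs k) \<and>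
        length us = length Fs - 2 \<and> set us \<subseteq> U_pos es \<and>
        (\<forall>i\<le>length us. Fs ! i = flag_act (list_prod PGL (take i us)) (hd Fs)))"

definition flag_interval ::
  "'v::euclidean_space flag \<Rightarrow> 'v flag \<Rightarrow> 'v flag \<Rightarrow> 'v flag set" where
  "flag_interval F H K = {G. is_flag G \<and> positive_tuple [F, G, H, K]}"

definition forward_domains ::
  "'a set \<Rightarrow> ('a \<times> 'a) set \<Rightarrow> ('a \<Rightarrow> ('v::euclidean_space \<Rightarrow> 'v) set) \<Rightarrow>
    ('a \<Rightarrow> 'v flag) \<Rightarrow> ('a \<Rightarrow> 'v flag) \<Rightarrow> ('a \<Rightarrow> 'v flag) \<Rightarrow> bool" where
  "forward_domains A B f F H K \<longleftrightarrow>
     (\<forall>a\<in>A. positive_tuple [F a, H a, K a]) \<and>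
     (\<forall>(a, b)\<in>B.
        flag_act (f a) ` flag_interval (F b) (H b) (K b) \<subseteq> flag_interval (F a) (H a) (K a) \<and>
        (positive_tuple [F a, flag_act (f a) (F b), flag_act (f a) (H b), H a] \<or>
         positive_tuple [F a, flag_act (f a) (H b), flag_act (f a) (F b), H a]))"

definition admissible ::
  "'a set \<Rightarrow> ('a \<times> 'a) set \<Rightarrow> ('a \<Rightarrow> ('v::euclidean_space \<Rightarrow> 'v) set) \<Rightarrow> bool" where
  "admissible A B f \<longleftrightarrow> (\<exists>F H K. forward_domains A B f F H K)"

definition weakly_positive ::
  "'a set \<Rightarrow> ('a \<times> 'a) set \<Rightarrow> ('a \<Rightarrow> 'g) \<Rightarrow> ('g \<Rightarrow> ('v::euclidean_space \<Rightarrow> 'v) set) \<Rightarrow> bool" where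
  "weakly_positive A B R \<rho> \<longleftrightarrow> admissible A B (\<rho> \<circ> R)"

end

theory Submission
  imports "HOL-Analysis.Topology_Euclidean_Space" Defs
begin

text \<open>
  A frame is an ordered basis; it is adapted to two transverse flags \<open>F\<close> and \<open>H\<close> if its last \<open>k\<close>
  vectors span \<open>F k\<close> and its first \<open>k\<close> vectors span \<open>H k\<close>. Such a frame is unique up to rescaling its
  vectors. A vertex \<open>a\<close> of the graph carries a positive triple \<open>(F\<^sub>a, H\<^sub>a, K\<^sub>a)\<close>, and the third flag
  selects the signs of the scalars: there is a frame \<open>g\<^sub>a\<close> adapted to \<open>F\<^sub>a\<close> and \<open>H\<^sub>a\<close> such that the
  lines \<open>G 1\<close>, for \<open>G\<close> in the interval of the triple, are exactly the lines in the open cone spanned by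
  \<open>g\<^sub>a\<close> (lemma \<open>positive_interval_frame\<close>).

  Write \<open>f(a)\<close> for a linear map that represents \<open>\<rho> (R a)\<close>.
  For an edge \<open>(a, b)\<close>, positivity of the quadruple formed by \<open>F\<^sub>a\<close>, \<open>H\<^sub>a\<close> and the images of \<open>F\<^sub>b\<close>
  and \<open>H\<^sub>b\<close> says that the matrix of \<open>f(a)\<close> from \<open>g\<^sub>b\<close> to \<open>g\<^sub>a\<close> is a totally positive matrix, up to
  diagonal factors and, in one of the two cases, up to reversing the order of the columns. Since
  \<open>f(a)\<close> maps the interval at \<open>b\<close> into the interval at \<open>a\<close>, it maps one cone into the other up to a
  global sign, and this forces the signs in the diagonal factors to be constant. Hence for every \<open>m\<close>
  the \<open>m\<close>-minors of the matrix are nonzero and have a common sign (lemma \<open>admissible_edge_matrix\<close>).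
  In other words, the \<open>m\<close>-th exterior power of \<open>f(a)\<close> is a matrix with positive entries, up to sign.

  The graph is finite, so the entries of these finitely many positive matrices lie in an interval
  \<open>[\<alpha>, \<beta>]\<close> with \<open>\<alpha> > 0\<close>. A product of \<open>i\<close> such matrices is, up to a relative error \<open>O(\<theta>\<^sup>i)\<close> with
  \<open>\<theta> < 1\<close>, of rank one (lemma \<open>doeblin_contraction\<close>). The largest two singular values of the
  \<open>m\<close>-th exterior power of a map with singular values \<open>\<sigma>\<^sub>1 \<ge> \<sigma>\<^sub>2 \<ge> \<dots>\<close> have quotient
  \<open>\<sigma>\<^sub>m / \<sigma>\<^bsub>m+1\<^esub>\<close>. For the image of the \<open>i\<close>-th element of a directed sequence this
  quotient is therefore at least a constant times \<open>\<theta>\<^bsup>-i\<^esup>\<close>, and its logarithm, the \<open>m\<close>-th simple root of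
  the Cartan projection, grows at least linearly in \<open>i\<close>, with the same constants for all rays.

  The step from positive quadruples to totally positive matrices rests on two facts about triangular
  matrices: positivity of the minors in the first columns of a lower triangular matrix implies
  positivity of all its minors that do not vanish for trivial reasons (lemma \<open>lower_criterion\<close>), and a
  product of an upper and a lower triangular matrix with this property is totally positive (lemma
  \<open>tp_mprod_upper_lower\<close>, by the Cauchy-Binet formula).
\<close>

section \<open>Minors and the Cauchy-Binet formula\<close>

text \<open>
  The minor of \<open>A\<close> of order \<open>m\<close> with row indices \<open>r 0, \<dots>, r (m - 1)\<close> and column indices
  \<open>c 0, \<dots>, c (m - 1)\<close>. Matrices are plain functions here, so that index sequences can be composed,
  shifted and reversed freely.
\<close>

definition mdet :: "(nat \<Rightarrow> nat \<Rightarrow> real) \<Rightarrow> nat \<Rightarrow> (nat \<Rightarrow> nat) \<Rightarrow> (nat \<Rightarrow> nat) \<Rightarrow> real" where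
  "mdet A m r c = det (mat m m (\<lambda>(i, j). A (r i) (c j)))"

definition mprod :: "nat \<Rightarrow> (nat \<Rightarrow> nat \<Rightarrow> real) \<Rightarrow> (nat \<Rightarrow> nat \<Rightarrow> real) \<Rightarrow> nat \<Rightarrow> nat \<Rightarrow> real" where
  "mprod n A B = (\<lambda>i j. \<Sum>k<n. A i k * B k j)"

definition incr :: "nat \<Rightarrow> nat \<Rightarrow> (nat \<Rightarrow> nat) \<Rightarrow> bool" where
  "incr m n r \<longleftrightarrow> (\<forall>i<m. r i < n) \<and> (\<forall>i j. i < j \<longrightarrow> j < m \<longrightarrow> r i < r j)"

text \<open>
  The index sets of the rows and columns of the \<open>m\<close>-th compound matrix; \<open>pick\<close> enumerates such a set
  increasingly, and every sequence with \<open>incr m n\<close> arises in this way.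
\<close>

definition index_sets :: "nat \<Rightarrow> nat \<Rightarrow> nat set set" where
  "index_sets m n = {K. K \<subseteq> {..<n} \<and> card K = m}"

lemma finite_index_sets: "finite (index_sets m n)"
  unfolding index_sets_def by (rule finite_subset[of _ "Pow {..<n}"]) auto

lemma mdet_leibniz:
  "mdet A m r c = (\<Sum>p | p permutes {0..<m}. signof p * (\<Prod>i = 0..<m. A (r i) (c (p i))))"
proof -
  have "(\<Prod>i = 0..<m. mat m m (\<lambda>(i, j). A (r i) (c j)) $$ (i, p i)) = (\<Prod>i = 0..<m. A (r i) (c (p i)))"
    if "p permutes {0..<m}" for p
    by (rule prod.cong) (use that in \<open>auto simp: permutes_in_image\<close>)
  then show ?thesis
    unfolding mdet_def by (subst det_def'[where n = m]) auto
qed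

lemma mdet_cong:
  assumes "\<And>i j. i < m \<Longrightarrow> j < m \<Longrightarrow> A (r i) (c j) = A' (r' i) (c' j)"
  shows "mdet A m r c = mdet A' m r' c'"
  unfolding mdet_def by (rule arg_cong[where f = det], rule cong_mat) (use assms in auto)

lemma mdet_transpose: "mdet (\<lambda>i j. A j i) m r c = mdet A m c r"
proof -
  have "mat m m (\<lambda>(i, j). A (c j) (r i)) = transpose_mat (mat m m (\<lambda>(i, j). A (c i) (r j)))"
    by (rule eq_matI) auto
  then show ?thesis unfolding mdet_def by (simp add: det_transpose[where n = m])
qed

lemma mdet_permute_rows:
  assumes "p permutes {0..<m}"
  shows "mdet A m (r \<circ> p) c = signof p * mdet A m r c"
proof -
  have "mat m m (\<lambda>(i, j). A ((r \<circ> p) i) (c j)) =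
     mat m m (\<lambda>(i, j). mat m m (\<lambda>(i, j). A (r i) (c j)) $$ (p i, j))"
    by (rule cong_mat) (use assms in \<open>auto simp: permutes_in_image\<close>)
  then show ?thesis
    unfolding mdet_def using det_permute_rows[OF _ assms, of "mat m m (\<lambda>(i, j). A (r i) (c j))"] by simp
qed

lemma mdet_identical_rows:
  assumes "i < m" "j < m" "i \<noteq> j" "\<And>k. k < m \<Longrightarrow> A (r i) (c k) = A (r j) (c k)"
  shows "mdet A m r c = 0"
  unfolding mdet_def
  by (rule det_identical_rows[of _ m i j]) (use assms in \<open>auto intro!: eq_vecI\<close>)

text \<open>
  The determinant is linear in each row, and each row of the product is a linear combination of the
  rows of \<open>B\<close>; expanding all of them gives one term for each choice of a row of \<open>B\<close>.
\<close>

lemma mdet_mprod_functions: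
  "mdet (mprod n A B) m r c =
     (\<Sum>f\<in>{0..<m} \<rightarrow>\<^sub>E {..<n}. (\<Prod>i = 0..<m. A (r i) (f i)) * mdet B m f c)"
proof -
  have "mdet (mprod n A B) m r c = (\<Sum>p | p permutes {0..<m}. signof p *
      (\<Sum>f\<in>{0..<m} \<rightarrow>\<^sub>E {..<n}. \<Prod>i = 0..<m. A (r i) (f i) * B (f i) (c (p i))))"
    unfolding mdet_leibniz mprod_def
    by (intro sum.cong refl arg_cong2[where f = "(*)"] prod_sum_PiE) auto
  also have "\<dots> = (\<Sum>f\<in>{0..<m} \<rightarrow>\<^sub>E {..<n}. \<Sum>p | p permutes {0..<m}. signof p *
       (\<Prod>i = 0..<m. A (r i) (f i) * B (f i) (c (p i))))"
    unfolding sum_distrib_left by (rule sum.swap)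
  also have "\<dots> = (\<Sum>f\<in>{0..<m} \<rightarrow>\<^sub>E {..<n}. (\<Prod>i = 0..<m. A (r i) (f i)) * mdet B m f c)"
    unfolding mdet_leibniz prod.distrib sum_distrib_left by (simp add: ac_simps)
  finally show ?thesis .
qed

lemma incr_pick: "K \<in> index_sets m n \<Longrightarrow> incr m n (pick K)"
  unfolding incr_def index_sets_def using pick_in_set_le pick_mono_le by blast

lemma pick_image:
  assumes "finite K" shows "pick K ` {0..<card K} = K"
proof -
  have "inj_on (pick K) {0..<card K}"
    by (rule inj_onI) (metis atLeastLessThan_iff nat_neq_iff pick_mono_le)
  then have "card (pick K ` {0..<card K}) = card K" by (simp add: card_image)
  moreover have "pick K ` {0..<card K} \<subseteq> K" using pick_in_set_le by auto
  ultimately show ?thesis using assms by (simp add: card_subset_eq)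
qed

text \<open>
  In the expansion over all choices \<open>f\<close> of rows of \<open>B\<close>, a choice that is not injective contributes a
  determinant with two equal rows. An injective choice is an index set \<open>K\<close> together with a permutation
  of its increasing enumeration, and the sum over the permutations is the minor of \<open>A\<close>.
\<close>

theorem cauchy_binet:
  "mdet (mprod n A B) m r c = (\<Sum>K\<in>index_sets m n. mdet A m r (pick K) * mdet B m (pick K) c)"
proof -
  let ?F = "{0..<m} \<rightarrow>\<^sub>E {..<n}"
  let ?g = "\<lambda>f. (\<Prod>i = 0..<m. A (r i) (f i)) * mdet B m f c"
  let ?I = "{f \<in> ?F. inj_on f {0..<m}}"
  have finF: "finite ?F" by (rule finite_PiE) auto
  have "sum ?g ?F = sum ?g ?I"
  proof (rule sum.mono_neutral_right[OF finF])
    show "\<forall>f\<in>?F - ?I. ?g f = 0"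
    proof
      fix f assume "f \<in> ?F - ?I"
      then obtain i j where "i < m" "j < m" "i \<noteq> j" "f i = f j" by (auto simp: inj_on_def)
      then have "mdet B m f c = 0" by (intro mdet_identical_rows[of i m j]) auto
      then show "?g f = 0" by simp
    qed
  qed auto
  also have "\<dots> = (\<Sum>K\<in>index_sets m n. sum ?g {f \<in> ?I. f ` {0..<m} = K})"
  proof (rule sum.group[symmetric])
    show "(\<lambda>f. f ` {0..<m}) ` ?I \<subseteq> index_sets m n"
      by (auto simp: index_sets_def card_image PiE_def)
  qed (use finF finite_index_sets in auto)
  also have "\<dots> = (\<Sum>K\<in>index_sets m n. mdet A m r (pick K) * mdet B m (pick K) c)"
  proof (rule sum.cong[OF refl])
    fix K assume K: "K \<in> index_sets m n"
    have fK: "finite K" and cK: "card K = m" and Kn: "K \<subseteq> {..<n}"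
      using K unfolding index_sets_def by (auto intro: finite_subset)
    have pick_less: "pick K i < n" "pick K i \<in> K" if "i < m" for i
      using pick_in_set_le[of i K] that cK Kn by auto
    have pick_inj: "pick K i = pick K j \<longleftrightarrow> i = j" if "i < m" "j < m" for i j
      using pick_mono_le[of i K j] pick_mono_le[of j K i] that cK by (metis nat_neq_iff)
    define rk where "rk = (\<lambda>a. card {b \<in> K. b < a})"
    have rk: "pick K (rk a) = a" "rk a < m" if "a \<in> K" for a
    proof -
      show "pick K (rk a) = a" unfolding rk_def by (rule pick_card_in_set[OF that])
      have "{b \<in> K. b < a} \<subset> K" using that by auto
      then show "rk a < m" unfolding rk_def using psubset_card_mono[OF fK] cK by auto
    qed
    have rk_pick: "rk (pick K i) = i" if "i < m" for i
      unfolding rk_def using card_pick_le that cK by simp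
    have "sum ?g {f \<in> ?I. f ` {0..<m} = K} =
       (\<Sum>p | p permutes {0..<m}. (\<Prod>i = 0..<m. A (r i) (pick K (p i))) * (signof p * mdet B m (pick K) c))"
    proof (rule sum.reindex_bij_witness[where
          j = "\<lambda>f i. if i < m then rk (f i) else i" and
          i = "\<lambda>p. restrict (\<lambda>i. pick K (p i)) {0..<m}"])
      fix f assume f: "f \<in> {f \<in> ?I. f ` {0..<m} = K}"
      let ?p = "\<lambda>i. if i < m then rk (f i) else i"
      have fin: "f i \<in> K" if "i < m" for i using f that by auto
      show eq: "restrict (\<lambda>i. pick K (?p i)) {0..<m} = f"
      proof
        fix i show "restrict (\<lambda>i. pick K (?p i)) {0..<m} i = f i"
          using f rk(1)[OF fin] by (cases "i < m") (auto simp: PiE_def extensional_def)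
      qed
      have "inj_on ?p {0..<m}"
      proof (rule inj_onI)
        fix i j assume "i \<in> {0..<m}" "j \<in> {0..<m}" "?p i = ?p j"
        then have "rk (f i) = rk (f j)" "i < m" "j < m" by auto
        then have "f i = f j" by (metis rk(1) fin)
        with \<open>i \<in> _\<close> \<open>j \<in> _\<close> show "i = j" using f by (auto simp: inj_on_def)
      qed
      moreover have "?p ` {0..<m} \<subseteq> {0..<m}" using rk(2)[OF fin] by auto
      ultimately have "bij_betw ?p {0..<m} {0..<m}"
        unfolding bij_betw_def using endo_inj_surj[of "{0..<m}" ?p] by blast
      then have p: "?p permutes {0..<m}"
        by (rule bij_imp_permutes) auto
      then show "?p \<in> {p. p permutes {0..<m}}" by simp
      have "mdet B m f c = mdet B m (pick K \<circ> ?p) c"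
        by (rule mdet_cong) (use rk(1)[OF fin] in auto)
      then have "mdet B m f c = signof ?p * mdet B m (pick K) c"
        using mdet_permute_rows[OF p, of B "pick K" c] by simp
      moreover have "(\<Prod>i = 0..<m. A (r i) (pick K (?p i))) = (\<Prod>i = 0..<m. A (r i) (f i))"
        by (rule prod.cong) (use rk(1)[OF fin] in auto)
      ultimately show "(\<Prod>i = 0..<m. A (r i) (pick K (?p i))) * (signof ?p * mdet B m (pick K) c) = ?g f"
        by simp
    next
      fix p assume "p \<in> {p. p permutes {0..<m}}"
      then have p: "p permutes {0..<m}" by simp
      have pm: "p i < m" if "i < m" for i using permutes_in_image[OF p] that by auto
      let ?f = "restrict (\<lambda>i. pick K (p i)) {0..<m}"
      show "(\<lambda>i. if i < m then rk (?f i) else i) = p"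
      proof
        fix i show "(if i < m then rk (?f i) else i) = p i"
          using rk_pick[OF pm] permutes_not_in[OF p, of i] by auto
      qed
      have "?f ` {0..<m} = pick K ` p ` {0..<m}" by auto
      also have "\<dots> = K" using permutes_image[OF p] pick_image[OF fK] cK by simp
      finally have im: "?f ` {0..<m} = K" .
      have "inj_on ?f {0..<m}"
        by (rule inj_onI) (use pick_inj[OF pm pm] permutes_inj[OF p] in \<open>auto simp: inj_def\<close>)
      then show "?f \<in> {f \<in> ?I. f ` {0..<m} = K}"
        using im pick_less(1)[OF pm] by auto
    qed
    also have "\<dots> = mdet A m r (pick K) * mdet B m (pick K) c"
      unfolding mdet_leibniz[of A] sum_distrib_right by (rule sum.cong) (auto simp: ac_simps)
    finally show "sum ?g {f \<in> ?I. f ` {0..<m} = K} = mdet A m r (pick K) * mdet B m (pick K) c" .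
  qed
  finally show ?thesis unfolding mdet_mprod_functions .
qed

section \<open>Minors of triangular matrices\<close>

lemma incr_less: "incr m n r \<Longrightarrow> i < m \<Longrightarrow> r i < n"
  unfolding incr_def by blast

lemma incr_strict: "incr m n r \<Longrightarrow> i < j \<Longrightarrow> j < m \<Longrightarrow> r i < r j"
  unfolding incr_def by blast

lemma incr_mono: "incr m n r \<Longrightarrow> i \<le> j \<Longrightarrow> j < m \<Longrightarrow> r i \<le> r j"
  using incr_strict[of m n r i j] by (cases "i = j") auto

lemma incr_ge: "incr m n r \<Longrightarrow> i < m \<Longrightarrow> i \<le> r i"
proof (induction i)
  case (Suc i)
  then show ?case using incr_strict[of m n r i "Suc i"] by auto
qed simp

lemma incr_le_last:
  assumes "incr m n r" "i < m" shows "r i + m \<le> n + i"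
proof -
  have "r (m - 1 - k) + k < n" if "k < m" for k
    using that
  proof (induction k)
    case 0 then show ?case using incr_less[OF assms(1)] by simp
  next
    case (Suc k)
    have "r (m - 1 - Suc k) < r (m - 1 - k)" by (rule incr_strict[OF assms(1)]) (use Suc in auto)
    then show ?case using Suc by simp
  qed
  from this[of "m - 1 - i"] show ?thesis using assms(2) by simp
qed

lemma incr_le: "incr m n r \<Longrightarrow> m \<le> n"
  using incr_le_last[of m n r 0] by (cases "m = 0") auto

lemma incr_initial: "m \<le> n \<Longrightarrow> incr m n (\<lambda>i. i)"
  unfolding incr_def by auto

lemma incr_final: "m \<le> n \<Longrightarrow> incr m n (\<lambda>i. n - m + i)"
  unfolding incr_def by auto

lemma incr_consecutive: "i + m \<le> n \<Longrightarrow> incr m n (\<lambda>s. i + s)"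
  unfolding incr_def by auto

lemma incr_pred:
  assumes r: "incr m (Suc n) r" and pos: "0 < m \<Longrightarrow> 0 < r 0"
  shows "incr m n (\<lambda>i. r i - 1)"
proof -
  have b: "0 < r i" "r i < Suc n" if "i < m" for i
    using incr_mono[OF r, of 0 i] pos incr_less[OF r, of i] that by auto
  have "r i - 1 < n" if "i < m" for i using b[OF that] by linarith
  moreover have "r i - 1 < r j - 1" if "i < j" "j < m" for i j
    using b[of i] incr_strict[OF r that] that by linarith
  ultimately show ?thesis unfolding incr_def by blast
qed

lemma incr_Suc_pred:
  assumes r: "incr (Suc m) (Suc n) r" shows "incr m n (\<lambda>i. r (Suc i) - 1)"
proof (rule incr_pred)
  show "incr m (Suc n) (\<lambda>i. r (Suc i))" using r by (simp add: incr_def)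
  show "0 < r (Suc 0)" if "0 < m" using incr_strict[OF r, of 0 1] that by simp
qed

lemma incr_eq_pick:
  assumes "incr m n r" shows "r ` {..<m} \<in> index_sets m n" "\<And>i. i < m \<Longrightarrow> pick (r ` {..<m}) i = r i"
proof -
  have inj: "inj_on r {..<m}"
    by (rule inj_onI) (metis assms incr_strict lessThan_iff nat_neq_iff)
  show "r ` {..<m} \<in> index_sets m n"
    unfolding index_sets_def using inj incr_less[OF assms] by (auto simp: card_image)
  fix i assume i: "i < m"
  have "{a \<in> r ` {..<m}. a < r i} = r ` {..<i}"
  proof (intro equalityI subsetI)
    fix a assume "a \<in> {a \<in> r ` {..<m}. a < r i}"
    then obtain j where j: "a = r j" "j < m" "r j < r i" by auto
    then have "j < i" using incr_mono[OF assms, of i j] by force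
    then show "a \<in> r ` {..<i}" using j by auto
  qed (use i incr_strict[OF assms] in auto)
  moreover have "card (r ` {..<i}) = i"
    using inj_on_subset[OF inj, of "{..<i}"] i by (simp add: card_image)
  ultimately show "pick (r ` {..<m}) i = r i"
    using pick_card_in_set[of "r i" "r ` {..<m}"] i by auto
qed

lemma mdet_row_zero:
  assumes "i < m" "\<And>j. j < m \<Longrightarrow> A (r i) (c j) = 0" shows "mdet A m r c = 0"
proof -
  have "(\<Prod>i = 0..<m. A (r i) (c (p i))) = 0" if "p permutes {0..<m}" for p
  proof -
    have "p i < m" using permutes_in_image[OF that, of i] assms(1) by simp
    then have "A (r i) (c (p i)) = 0" by (rule assms(2))
    then show ?thesis using assms(1) by (intro prod_zero bexI[of _ i]) auto
  qed
  then show ?thesis unfolding mdet_leibniz by (intro sum.neutral) auto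
qed

lemma mdet_col_zero:
  assumes "j < m" "\<And>i. i < m \<Longrightarrow> A (r i) (c j) = 0" shows "mdet A m r c = 0"
  using mdet_row_zero[of j m "\<lambda>i j. A j i" c r] assms by (simp add: mdet_transpose[of A])

lemma mdet_scale:
  "mdet (\<lambda>i j. a i * A i j * b j) m r c = (\<Prod>i<m. a (r i)) * mdet A m r c * (\<Prod>j<m. b (c j))"
proof -
  have "(\<Prod>i = 0..<m. a (r i) * A (r i) (c (p i)) * b (c (p i))) =
     (\<Prod>i<m. a (r i)) * (\<Prod>i = 0..<m. A (r i) (c (p i))) * (\<Prod>j<m. b (c j))"
    if "p permutes {0..<m}" for p
  proof -
    have "(\<Prod>i = 0..<m. b (c (p i))) = (\<Prod>i = 0..<m. b (c i))"
      using prod.permute[OF that, of "\<lambda>i. b (c i)"] by (simp add: comp_def)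
    then show ?thesis by (simp add: prod.distrib lessThan_atLeast0)
  qed
  then show ?thesis
    unfolding mdet_leibniz sum_distrib_left sum_distrib_right by (intro sum.cong) auto
qed

lemma mdet_lower_triangular:
  assumes "\<And>i j. i < j \<Longrightarrow> j < m \<Longrightarrow> A (r i) (c j) = 0"
  shows "mdet A m r c = (\<Prod>i<m. A (r i) (c i))"
proof -
  have "mdet A m r c = prod_list (diag_mat (mat m m (\<lambda>(i, j). A (r i) (c j))))"
    unfolding mdet_def by (rule det_lower_triangular[of m]) (use assms in auto)
  also have "\<dots> = (\<Prod>i<m. A (r i) (c i))"
    unfolding prod_list_diag_prod by (auto simp: lessThan_atLeast0 intro!: prod.cong)
  finally show ?thesis .
qed

lemma mdet_first_col:
  assumes "\<And>i. 0 < i \<Longrightarrow> i < Suc m \<Longrightarrow> A (r i) (c 0) = 0"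
  shows "mdet A (Suc m) r c = A (r 0) (c 0) * mdet A m (\<lambda>i. r (Suc i)) (\<lambda>i. c (Suc i))"
proof -
  let ?M = "mat (Suc m) (Suc m) (\<lambda>(i, j). A (r i) (c j))"
  have "det ?M = (\<Sum>i<Suc m. ?M $$ (i, 0) * cofactor ?M i 0)"
    by (rule laplace_expansion_column) auto
  also have "\<dots> = (\<Sum>i\<in>{0}. ?M $$ (i, 0) * cofactor ?M i 0)"
    by (rule sum.mono_neutral_right) (use assms in auto)
  also have "mat_delete ?M 0 0 = mat m m (\<lambda>(i, j). A (r (Suc i)) (c (Suc j)))"
    by (rule eq_matI) (auto simp: mat_delete_def)
  then have "cofactor ?M 0 0 = mdet A m (\<lambda>i. r (Suc i)) (\<lambda>i. c (Suc i))"
    by (simp add: cofactor_def mdet_def)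
  then have "(\<Sum>i\<in>{0}. ?M $$ (i, 0) * cofactor ?M i 0) =
     A (r 0) (c 0) * mdet A m (\<lambda>i. r (Suc i)) (\<lambda>i. c (Suc i))" by simp
  finally show ?thesis unfolding mdet_def .
qed

lemma mdet_0 [simp]: "mdet A 0 r c = 1"
  by (simp add: mdet_def)

lemma mdet_1: "mdet A (Suc 0) r c = A (r 0) (c 0)"
  using mdet_first_col[of 0 A r c] by simp

definition lower_tri :: "nat \<Rightarrow> (nat \<Rightarrow> nat \<Rightarrow> real) \<Rightarrow> bool" where
  "lower_tri n L \<longleftrightarrow> (\<forall>i<n. \<forall>j<n. i < j \<longrightarrow> L i j = 0)"

definition upper_tri :: "nat \<Rightarrow> (nat \<Rightarrow> nat \<Rightarrow> real) \<Rightarrow> bool" where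
  "upper_tri n U \<longleftrightarrow> (\<forall>i<n. \<forall>j<n. j < i \<longrightarrow> U i j = 0)"

lemma lower_tri_transpose: "lower_tri n (\<lambda>i j. A j i) \<longleftrightarrow> upper_tri n A"
  unfolding lower_tri_def upper_tri_def by auto

text \<open>
  If \<open>r i < c i\<close>, then the rows up to \<open>i\<close> vanish in all columns from \<open>i\<close> on. A permutation cannot map
  \<open>i + 1\<close> rows into the \<open>i\<close> remaining columns, so every term of the Leibniz formula has a zero factor.
\<close>

lemma mdet_lower_tri_zero:
  assumes L: "lower_tri n L" and r: "incr m n r" and c: "incr m n c" and i: "i < m" and lt: "r i < c i"
  shows "mdet L m r c = 0"
proof -
  have "(\<Prod>k = 0..<m. L (r k) (c (p k))) = 0" if p: "p permutes {0..<m}" for p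
  proof -
    have "\<exists>k\<le>i. i \<le> p k"
    proof (rule ccontr)
      assume "\<not> ?thesis"
      then have "p ` {..i} \<subseteq> {..<i}" by auto
      moreover have "card (p ` {..i}) = Suc i"
        using permutes_inj[OF p] by (subst card_image) (auto intro: inj_on_subset)
      ultimately show False using card_mono[of "{..<i}" "p ` {..i}"] by simp
    qed
    then obtain k where k: "k \<le> i" "i \<le> p k" by blast
    have pk: "p k < m" using permutes_in_image[OF p, of k] k i by auto
    have "r k \<le> r i" "c i \<le> c (p k)"
      using incr_mono[OF r k(1) i] incr_mono[OF c k(2) pk] by auto
    then have "L (r k) (c (p k)) = 0"
      using L lt incr_less[OF r, of k] incr_less[OF c pk] k i unfolding lower_tri_def by auto
    then show ?thesis using k i by (intro prod_zero bexI[of _ k]) auto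
  qed
  then show ?thesis unfolding mdet_leibniz by (intro sum.neutral) auto
qed

lemma mdet_upper_tri_zero:
  assumes "upper_tri n U" "incr m n r" "incr m n c" "i < m" "c i < r i"
  shows "mdet U m r c = 0"
  using mdet_lower_tri_zero[of n "\<lambda>i j. U j i" m c r i] assms by (simp add: lower_tri_transpose[of n U] mdet_transpose[of U])

lemma mdet_upper_tri_initial:
  assumes "upper_tri n U" "k \<le> n" shows "mdet U k (\<lambda>i. i) (\<lambda>i. i) = (\<Prod>i<k. U i i)"
  using mdet_lower_triangular[of k "\<lambda>i j. U j i" "\<lambda>i. i" "\<lambda>i. i"] assms
  by (auto simp: mdet_transpose[of U] upper_tri_def)

lemma cauchy_binet_nonneg:
  assumes "\<And>q. incr m n q \<Longrightarrow> 0 \<le> mdet A m r q" "\<And>q. incr m n q \<Longrightarrow> 0 \<le> mdet B m q c"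
  shows "0 \<le> mdet (mprod n A B) m r c"
  unfolding cauchy_binet by (intro sum_nonneg mult_nonneg_nonneg assms incr_pick)

lemma mdet_pick_cong:
  assumes "incr m n q"
  shows "mdet A m r (pick (q ` {..<m})) = mdet A m r q" "mdet A m (pick (q ` {..<m})) c = mdet A m q c"
  by (auto intro!: mdet_cong simp: incr_eq_pick(2)[OF assms])

lemma cauchy_binet_pos:
  assumes "\<And>q. incr m n q \<Longrightarrow> 0 \<le> mdet A m r q" "\<And>q. incr m n q \<Longrightarrow> 0 \<le> mdet B m q c"
    and "incr m n q" "0 < mdet A m r q" "0 < mdet B m q c"
  shows "0 < mdet (mprod n A B) m r c"
  unfolding cauchy_binet
proof (rule sum_pos2[OF finite_index_sets incr_eq_pick(1)[OF assms(3)]])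
  show "0 < mdet A m r (pick (q ` {..<m})) * mdet B m (pick (q ` {..<m})) c"
    using assms by (simp add: mdet_pick_cong[OF assms(3)])
qed (intro mult_nonneg_nonneg assms incr_pick)

lemma cauchy_binet_single:
  assumes q: "incr m n q"
    and only: "\<And>p. incr m n p \<Longrightarrow> (\<exists>i<m. p i \<noteq> q i) \<Longrightarrow> mdet A m r p * mdet B m p c = 0"
  shows "mdet (mprod n A B) m r c = mdet A m r q * mdet B m q c"
proof -
  have "mdet (mprod n A B) m r c =
     (\<Sum>K\<in>{q ` {..<m}}. mdet A m r (pick K) * mdet B m (pick K) c)"
    unfolding cauchy_binet
  proof (rule sum.mono_neutral_right[OF finite_index_sets])
    show "{q ` {..<m}} \<subseteq> index_sets m n" using incr_eq_pick(1)[OF q] by simp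
    show "\<forall>K\<in>index_sets m n - {q ` {..<m}}. mdet A m r (pick K) * mdet B m (pick K) c = 0"
    proof
      fix K assume K: "K \<in> index_sets m n - {q ` {..<m}}"
      then have "pick K ` {0..<m} = K"
        using pick_image[of K] finite_subset[of K "{..<n}"] by (auto simp: index_sets_def)
      then have "\<exists>i<m. pick K i \<noteq> q i"
        using K by (metis DiffE image_cong lessThan_atLeast0 lessThan_iff singletonI)
      then show "mdet A m r (pick K) * mdet B m (pick K) c = 0"
        using only incr_pick K by blast
    qed
  qed
  then show ?thesis by (simp add: mdet_pick_cong[OF q])
qed

lemma mdet_mprod_square:
  "mdet (mprod m A B) m r c = mdet A m r (\<lambda>i. i) * mdet B m (\<lambda>i. i) c"
proof (rule cauchy_binet_single[OF incr_initial])
  fix p assume p: "incr m m p" and "\<exists>i<m. p i \<noteq> i"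
  then obtain i where "i < m" "p i \<noteq> i" by blast
  then have False using incr_ge[OF p] incr_le_last[OF p, of i] by force
  then show "mdet A m r p * mdet B m p c = 0" ..
qed simp

lemma mdet_mprod_upper_tri_initial:
  assumes "upper_tri n N" "k \<le> n"
  shows "mdet (mprod n M N) k r (\<lambda>i. i) = mdet M k r (\<lambda>i. i) * mdet N k (\<lambda>i. i) (\<lambda>i. i)"
proof (rule cauchy_binet_single[OF incr_initial])
  fix p assume p: "incr k n p" and "\<exists>i<k. p i \<noteq> i"
  then obtain i where "i < k" "p i \<noteq> i" by blast
  then have "mdet N k p (\<lambda>i. i) = 0"
    using incr_ge[OF p] by (intro mdet_upper_tri_zero[OF assms(1) p incr_initial[OF assms(2)]]) force+
  then show "mdet M k r p * mdet N k p (\<lambda>i. i) = 0" by simp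
qed (use assms in simp)

lemma mdet_mprod_lower_tri_initial:
  assumes "lower_tri n L" "k \<le> n"
  shows "mdet (mprod n L M) k (\<lambda>i. i) c = mdet L k (\<lambda>i. i) (\<lambda>i. i) * mdet M k (\<lambda>i. i) c"
proof (rule cauchy_binet_single[OF incr_initial])
  fix p assume p: "incr k n p" and "\<exists>i<k. p i \<noteq> i"
  then obtain i where "i < k" "p i \<noteq> i" by blast
  then have "mdet L k (\<lambda>i. i) p = 0"
    using incr_ge[OF p] by (intro mdet_lower_tri_zero[OF assms(1) incr_initial[OF assms(2)] p]) force+
  then show "mdet L k (\<lambda>i. i) p * mdet M k p c = 0" by simp
qed (use assms in simp)

lemma mdet_mprod_upper_tri_final:
  assumes "upper_tri n U" "k \<le> n"
  shows "mdet (mprod n U M) k (\<lambda>i. n - k + i) c =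
    mdet U k (\<lambda>i. n - k + i) (\<lambda>i. n - k + i) * mdet M k (\<lambda>i. n - k + i) c"
proof (rule cauchy_binet_single[OF incr_final])
  fix p assume p: "incr k n p" and "\<exists>i<k. p i \<noteq> n - k + i"
  then obtain i where i: "i < k" "p i \<noteq> n - k + i" by blast
  then have "p i < n - k + i" using incr_le_last[OF p i(1)] by simp
  then have "mdet U k (\<lambda>i. n - k + i) p = 0"
    by (intro mdet_upper_tri_zero[OF assms(1) incr_final[OF assms(2)] p i(1)])
  then show "mdet U k (\<lambda>i. n - k + i) p * mdet M k p c = 0" by simp
qed (use assms in simp)

section \<open>A criterion for total positivity of triangular matrices\<close>

definition ones_below :: "nat \<Rightarrow> nat \<Rightarrow> real" where
  "ones_below i j = (if j \<le> i then 1 else 0)"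

lemma ones_below_interlacing:
  assumes "\<And>i. i < m \<Longrightarrow> c i \<le> r i" "\<And>i j. i < j \<Longrightarrow> j < m \<Longrightarrow> r i < c j"
  shows "mdet ones_below m r c = 1"
proof -
  have "mdet ones_below m r c = (\<Prod>i<m. ones_below (r i) (c i))"
    by (rule mdet_lower_triangular) (use assms in \<open>auto simp: ones_below_def not_le\<close>)
  then show ?thesis using assms by (simp add: ones_below_def)
qed

text \<open>
  The rows of the submatrix are \<open>1 \<dots> 1 0 \<dots> 0\<close>, with prefixes of nondecreasing length. Either the
  submatrix has a row that is too short, or two equal columns, or it is lower triangular with ones on
  the diagonal; the last case is that of interlacing index sequences.
\<close>

lemma ones_below_nonneg:
  assumes r: "incr m n r" and c: "incr m n c"
  shows "0 \<le> mdet ones_below m r c"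
proof (cases "\<exists>i<m. r i < c i")
  case True
  then obtain i where "i < m" "r i < c i" by blast
  then have "mdet ones_below m r c = 0"
    by (intro mdet_lower_tri_zero[OF _ r c, of _ i]) (auto simp: lower_tri_def ones_below_def)
  then show ?thesis by simp
next
  case le: False
  show ?thesis
  proof (cases "\<exists>i. Suc i < m \<and> c (Suc i) \<le> r i")
    case True
    define i where "i = (LEAST i. Suc i < m \<and> c (Suc i) \<le> r i)"
    have i: "Suc i < m" "c (Suc i) \<le> r i"
      using LeastI_ex[OF True] unfolding i_def by auto
    have min: "r t < c (Suc t)" if "t < i" for t
      using not_less_Least[OF that[unfolded i_def]] that i by auto
    have "ones_below (r t) (c i) = ones_below (r t) (c (Suc i))" if "t < m" for t
    proof (cases "t < i")
      case True
      then have "r t < c i" "c i \<le> c (Suc i)"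
        using min[OF True] incr_mono[OF c, of "Suc t" i] incr_mono[OF c, of i "Suc i"] i by auto
      then show ?thesis by (auto simp: ones_below_def)
    next
      case False
      then have "r i \<le> r t" "c i \<le> c (Suc i)"
        using incr_mono[OF r, of i t] incr_mono[OF c, of i "Suc i"] that i by auto
      then show ?thesis using i by (auto simp: ones_below_def)
    qed
    then have "mdet (\<lambda>i j. ones_below j i) m c r = 0"
      by (intro mdet_identical_rows[of i m "Suc i"]) (use i in auto)
    then show ?thesis by (simp add: mdet_transpose[of ones_below])
  next
    case False
    have "r i < c j" if "i < j" "j < m" for i j
    proof -
      have "r i < c (Suc i)" using False that by (meson le_less_trans not_le Suc_leI less_le_trans)
      then show ?thesis using incr_mono[OF c, of "Suc i" j] that by auto
    qed
    then have "mdet ones_below m r c = 1"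
      using le by (intro ones_below_interlacing) (meson not_le)+
    then show ?thesis by simp
  qed
qed

lemma telescope:
  fixes f :: "nat \<Rightarrow> real"
  assumes "i < k"
  shows "f i = (\<Sum>s<k. ones_below i s * (case s of 0 \<Rightarrow> f 0 | Suc t \<Rightarrow> f (Suc t) - f t))"
proof -
  let ?d = "\<lambda>s. case s of 0 \<Rightarrow> f 0 | Suc t \<Rightarrow> f (Suc t) - f t"
  have "(\<Sum>s<k. ones_below i s * ?d s) = (\<Sum>s\<in>{..i}. ones_below i s * ?d s)"
    by (rule sum.mono_neutral_right) (use assms in \<open>auto simp: ones_below_def\<close>)
  also have "\<dots> = sum ?d {..i}" by (rule sum.cong) (auto simp: ones_below_def)
  also have "\<dots> = f i" by (induction i) auto
  finally show ?thesis by simp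
qed

text \<open>
  This is Neville elimination. Scale the rows so that the first column consists of ones, and let \<open>D\<close>
  consist of the first row and of the differences of consecutive rows. Then the first column of
  \<open>D\<close> is a unit vector, the remaining block \<open>d\<close> again satisfies the hypotheses, and the scaled matrix
  is \<open>ones_below\<close> times \<open>D\<close>. The Cauchy-Binet formula expresses the minors of \<open>L\<close> by minors of the two
  factors, which are nonnegative; if \<open>c \<le> r\<close>, then some summand is positive.
  
  Only consecutive rows occur in the hypothesis because consecutive row differences of the scaled
  matrix involve consecutive rows only, so that this family of minors is preserved by the induction.
\<close>

lemma lower_criterion:
  assumes "lower_tri n L"
    and "\<And>k i. 0 < k \<Longrightarrow> i + k \<le> n \<Longrightarrow> 0 < mdet L k (\<lambda>s. i + s) (\<lambda>s. s)"
    and "incr m n r" "incr m n c"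
  shows "0 \<le> mdet L m r c \<and> ((\<forall>i<m. c i \<le> r i) \<longrightarrow> 0 < mdet L m r c)"
  using assms
proof (induction n arbitrary: L m r c)
  case 0
  then have "m = 0" using incr_le by blast
  then show ?case by simp
next
  case (Suc n)
  define a where "a = (\<lambda>i. L i 0)"
  have apos: "0 < a i" if "i < Suc n" for i
    using Suc.prems(2)[of 1 i] that by (simp add: mdet_1 a_def)
  define N where "N = (\<lambda>i j. L i j / a i)"
  define d where "d = (\<lambda>i j. N (Suc i) (Suc j) - N i (Suc j))"
  \<comment> \<open>The difference matrix: a one in the upper left corner, zeros beside it, and \<open>d\<close>.\<close>
  define D where "D = (\<lambda>i j. case i of 0 \<Rightarrow> N 0 j | Suc t \<Rightarrow> N (Suc t) j - N t j)"
  have N0: "N i 0 = 1" if "i < Suc n" for i using apos[OF that] by (simp add: N_def a_def)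
  have D00: "D 0 0 = 1" using N0 by (simp add: D_def)
  have D0: "D 0 (Suc j) = 0" if "j < n" for j
    using Suc.prems(1) that by (simp add: D_def N_def lower_tri_def)
  have DS0: "D (Suc i) 0 = 0" if "i < n" for i using N0 that by (simp add: D_def)
  have DSS: "D (Suc i) (Suc j) = d i j" for i j by (simp add: D_def d_def)
  have lower_d: "lower_tri n d" using Suc.prems(1) by (auto simp: lower_tri_def d_def N_def)
  have consec: "0 < mdet d k (\<lambda>s. i + s) (\<lambda>s. s)" if k: "0 < k" and ik: "i + k \<le> n" for k i
  proof -
    define Y where "Y = (\<lambda>s j. case s of 0 \<Rightarrow> N i j | Suc t \<Rightarrow> N (i + Suc t) j - N (i + t) j)"
    have "mdet L (Suc k) (\<lambda>s. i + s) (\<lambda>s. s) =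
        mdet (\<lambda>i j. a i * N i j * 1) (Suc k) (\<lambda>s. i + s) (\<lambda>s. s)"
    proof (rule mdet_cong)
      fix s j assume "s < Suc k"
      then show "L (i + s) j = a (i + s) * N (i + s) j * 1"
        using apos[of "i + s"] ik by (simp add: N_def)
    qed
    also have "\<dots> = (\<Prod>s<Suc k. a (i + s)) * mdet N (Suc k) (\<lambda>s. i + s) (\<lambda>s. s)"
      by (subst mdet_scale) simp
    also have "mdet N (Suc k) (\<lambda>s. i + s) (\<lambda>s. s) =
        mdet (mprod (Suc k) ones_below Y) (Suc k) (\<lambda>s. s) (\<lambda>s. s)"
    proof (rule mdet_cong)
      fix s j assume s: "s < Suc k"
      show "N (i + s) j = mprod (Suc k) ones_below Y s j"
        using telescope[OF s, of "\<lambda>s. N (i + s) j"] by (simp add: mprod_def Y_def cong: nat.case_cong)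
    qed
    also have "\<dots> = mdet Y (Suc k) (\<lambda>s. s) (\<lambda>s. s)"
      by (subst mdet_mprod_square, subst ones_below_interlacing) auto
    also have "\<dots> = Y 0 0 * mdet Y k Suc Suc"
      by (rule mdet_first_col) (use N0 ik in \<open>auto simp: Y_def split: nat.split\<close>)
    also have "mdet Y k Suc Suc = mdet d k (\<lambda>s. i + s) (\<lambda>s. s)"
      by (rule mdet_cong) (auto simp: Y_def d_def)
    finally have "mdet L (Suc k) (\<lambda>s. i + s) (\<lambda>s. s) =
       (\<Prod>s<Suc k. a (i + s)) * (Y 0 0 * mdet d k (\<lambda>s. i + s) (\<lambda>s. s))" .
    moreover have "Y 0 0 = 1" using N0 ik by (simp add: Y_def)
    moreover have "0 < mdet L (Suc k) (\<lambda>s. i + s) (\<lambda>s. s)"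
      using Suc.prems(2)[of "Suc k" i] ik by simp
    moreover have "0 < (\<Prod>s<Suc k. a (i + s))" by (rule prod_pos) (use apos ik in auto)
    ultimately show ?thesis using zero_less_mult_pos by fastforce
  qed
  have IH: "0 \<le> mdet d m p c \<and> ((\<forall>i<m. c i \<le> p i) \<longrightarrow> 0 < mdet d m p c)"
    if "incr m n p" "incr m n c" for m p c
    by (rule Suc.IH[OF lower_d _ that]) (rule consec)
  have Dmin: "0 \<le> mdet D m p c \<and>
      ((\<forall>i<m. c i \<le> p i) \<longrightarrow> (0 < m \<longrightarrow> p 0 = 0 \<longleftrightarrow> c 0 = 0) \<longrightarrow> 0 < mdet D m p c)"
    if p: "incr m (Suc n) p" and c: "incr m (Suc n) c" for m p c
  proof (cases m)
    case 0 then show ?thesis by simp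
  next
    case (Suc k)
    have pS: "0 < p (Suc i)" "p (Suc i) < Suc n" if "i < k" for i
      using incr_strict[OF p, of 0 "Suc i"] incr_less[OF p, of "Suc i"] that Suc by auto
    have cS: "0 < c (Suc i)" "c (Suc i) < Suc n" if "i < k" for i
      using incr_strict[OF c, of 0 "Suc i"] incr_less[OF c, of "Suc i"] that Suc by auto
    consider "p 0 = 0" "c 0 = 0" | "p 0 = 0" "0 < c 0" | "0 < p 0" "c 0 = 0" | "0 < p 0" "0 < c 0"
      by auto
    then show ?thesis
    proof cases
      case 1
      have "mdet D m p c = D (p 0) (c 0) * mdet D k (\<lambda>i. p (Suc i)) (\<lambda>i. c (Suc i))"
        unfolding Suc
      proof (rule mdet_first_col)
        fix i assume "0 < i" "i < Suc k"
        then obtain t where "i = Suc t" "t < k" by (cases i) auto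
        then show "D (p i) (c 0) = 0" using pS[of t] DS0[of "p i - 1"] 1 by simp
      qed
      also have "\<dots> = mdet d k (\<lambda>i. p (Suc i) - 1) (\<lambda>i. c (Suc i) - 1)"
      proof -
        have "mdet D k (\<lambda>i. p (Suc i)) (\<lambda>i. c (Suc i)) = mdet d k (\<lambda>i. p (Suc i) - 1) (\<lambda>i. c (Suc i) - 1)"
        proof (rule mdet_cong)
          fix i j assume "i < k" "j < k"
          then show "D (p (Suc i)) (c (Suc j)) = d (p (Suc i) - 1) (c (Suc j) - 1)"
            using pS[of i] cS[of j] DSS[of "p (Suc i) - 1" "c (Suc j) - 1"] by simp
        qed
        then show ?thesis using 1 D00 by simp
      qed
      finally have eq: "mdet D m p c = mdet d k (\<lambda>i. p (Suc i) - 1) (\<lambda>i. c (Suc i) - 1)" .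
      have ip: "incr k n (\<lambda>i. p (Suc i) - 1)" "incr k n (\<lambda>i. c (Suc i) - 1)"
        using incr_Suc_pred p c Suc by auto
      show ?thesis using IH[OF ip] unfolding eq using Suc by (auto intro!: diff_le_mono)
    next
      case 2
      have "mdet D m p c = 0"
      proof (rule mdet_row_zero[of 0])
        fix j assume "j < m"
        then have "0 < c j" "c j < Suc n" using 2 incr_mono[OF c, of 0 j] incr_less[OF c] by auto
        then show "D (p 0) (c j) = 0" using D0[of "c j - 1"] 2 by simp
      qed (use Suc in simp)
      then show ?thesis using 2 Suc by auto
    next
      case 3
      have "mdet D m p c = 0"
      proof (rule mdet_col_zero[of 0])
        fix j assume "j < m"
        then have "0 < p j" "p j < Suc n" using 3 incr_mono[OF p, of 0 j] incr_less[OF p] by auto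
        then show "D (p j) (c 0) = 0" using DS0[of "p j - 1"] 3 by simp
      qed (use Suc in simp)
      then show ?thesis using 3 Suc by auto
    next
      case 4
      have p4: "0 < p j" "p j < Suc n" "0 < c j" "c j < Suc n" if "j < m" for j
        using 4 that incr_mono[OF p, of 0 j] incr_mono[OF c, of 0 j] incr_less[OF p] incr_less[OF c]
        by auto
      have eq: "mdet D m p c = mdet d m (\<lambda>i. p i - 1) (\<lambda>i. c i - 1)"
      proof (rule mdet_cong)
        fix i j assume "i < m" "j < m"
        then show "D (p i) (c j) = d (p i - 1) (c j - 1)"
          using p4[of i] p4[of j] DSS[of "p i - 1" "c j - 1"] by simp
      qed
      have ip: "incr m n (\<lambda>i. p i - 1)" "incr m n (\<lambda>i. c i - 1)"
        using incr_pred[OF p] incr_pred[OF c] 4 by auto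
      show ?thesis using IH[OF ip] unfolding eq by (auto intro!: diff_le_mono)
    qed
  qed
  define E where "E = (\<lambda>i j. a i * ones_below i j * 1)"
  have Emin: "mdet E m r p = (\<Prod>i<m. a (r i)) * mdet ones_below m r p" for p
    unfolding E_def by (subst mdet_scale) simp
  have aprod: "0 < (\<Prod>i<m. a (r i))"
    by (rule prod_pos) (use apos incr_less[OF Suc.prems(3)] in auto)
  have LE: "mdet L m r c = mdet (mprod (Suc n) E D) m r c"
  proof (rule mdet_cong)
    fix i j assume "i < m"
    then have ri: "r i < Suc n" using incr_less[OF Suc.prems(3)] by blast
    have "L (r i) (c j) = a (r i) * N (r i) (c j)" using apos[OF ri] by (simp add: N_def)
    also have "N (r i) (c j) = (\<Sum>k<Suc n. ones_below (r i) k * D k (c j))"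
      using telescope[OF ri, of "\<lambda>s. N s (c j)"] by (simp add: D_def)
    finally show "L (r i) (c j) = mprod (Suc n) E D (r i) (c j)"
      by (simp add: mprod_def E_def sum_distrib_left mult.assoc del: sum.lessThan_Suc)
  qed
  have Enn: "0 \<le> mdet E m r q" if "incr m (Suc n) q" for q
    unfolding Emin using aprod ones_below_nonneg[OF Suc.prems(3) that] by simp
  have Dnn: "0 \<le> mdet D m q c" if "incr m (Suc n) q" for q
    using Dmin[OF that Suc.prems(4)] by simp
  have "0 \<le> mdet L m r c" unfolding LE by (rule cauchy_binet_nonneg[OF Enn Dnn])
  moreover have "0 < mdet L m r c" if le: "\<forall>i<m. c i \<le> r i"
  proof -
    note r = Suc.prems(3) and c = Suc.prems(4)
    \<comment> \<open>The first column of \<open>D\<close> is a unit vector, so the summand must use row 0 if column 0 occurs.\<close>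
    define q where "q = (if 0 < m \<and> c 0 = 0 then r(0 := 0) else r)"
    have q: "incr m (Suc n) q"
    proof -
      have "0 < r j" if "0 < j" "j < m" for j using incr_ge[OF r that(2)] that(1) by simp
      then show ?thesis using incr_less[OF r] incr_strict[OF r] by (auto simp: incr_def q_def)
    qed
    have "mdet ones_below m r q = 1"
      by (rule ones_below_interlacing) (use incr_strict[OF r] in \<open>auto simp: q_def\<close>)
    then have "0 < mdet E m r q" unfolding Emin using aprod by simp
    moreover have "0 < mdet D m q c"
      using Dmin[OF q c] le by (auto simp: q_def split: if_splits)
    ultimately show ?thesis unfolding LE
      by (intro cauchy_binet_pos[OF Enn Dnn q])
  qed
  ultimately show ?case by blast
qed

section \<open>Triangular factorizations of totally positive matrices\<close>

text \<open>
  Column \<open>j\<close> of the product has to vanish above the diagonal. This is a linear system for the entries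
  of column \<open>j\<close> of \<open>N\<close> above its diagonal, and its matrix is the invertible leading \<open>j \<times> j\<close> block of \<open>M\<close>.
\<close>

lemma lu_columns:
  assumes "\<And>k. k \<le> n \<Longrightarrow> mdet M k (\<lambda>i. i) (\<lambda>i. i) \<noteq> 0"
  shows "\<exists>N. upper_tri n N \<and> (\<forall>i<n. N i i = 1) \<and> lower_tri n (mprod n M N)"
proof -
  have "\<exists>x. \<forall>i<j. (\<Sum>s<j. M i s * x s) = - M i j" if j: "j < n" for j
  proof -
    let ?M = "mat j j (\<lambda>(i, j). M i j)"
    let ?b = "vec j (\<lambda>i. - M i j)"
    have "det ?M \<noteq> 0" using assms[of j] j by (simp add: mdet_def)
    then have "?M \<in> Units (ring_mat TYPE(real) j b)" for b
      by (intro det_non_zero_imp_unit) auto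
    then obtain B where B: "B \<in> carrier_mat j j" "?M * B = 1\<^sub>m j"
      unfolding Units_def ring_mat_def by auto
    have "?M *\<^sub>v (B *\<^sub>v ?b) = ?b"
      using B by (subst assoc_mult_mat_vec[symmetric, of _ j j _ j]) auto
    then have "(?M *\<^sub>v (B *\<^sub>v ?b)) $ i = - M i j" if "i < j" for i using that by simp
    moreover have "(?M *\<^sub>v (B *\<^sub>v ?b)) $ i = (\<Sum>s<j. M i s * (B *\<^sub>v ?b) $ s)" if "i < j" for i
      using that B by (auto simp: scalar_prod_def lessThan_atLeast0)
    ultimately show ?thesis by (intro exI[of _ "\<lambda>s. (B *\<^sub>v ?b) $ s"]) auto
  qed
  then obtain x where x: "\<And>i j. j < n \<Longrightarrow> i < j \<Longrightarrow> (\<Sum>s<j. M i s * x j s) = - M i j"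
    by metis
  define N where "N = (\<lambda>i j. if i = j then 1 else if i < j then x j i else 0)"
  have "mprod n M N i j = 0" if "j < n" "i < j" for i j
  proof -
    have "mprod n M N i j = (\<Sum>s\<in>{..j}. M i s * N s j)"
      unfolding mprod_def by (rule sum.mono_neutral_right) (use that in \<open>auto simp: N_def\<close>)
    also have "\<dots> = (\<Sum>s<j. M i s * N s j) + M i j"
      unfolding lessThan_Suc_atMost[symmetric] by (simp add: N_def)
    also have "(\<Sum>s<j. M i s * N s j) = (\<Sum>s<j. M i s * x j s)"
      by (rule sum.cong) (auto simp: N_def)
    finally show ?thesis using x[OF that] by simp
  qed
  then have "lower_tri n (mprod n M N)" unfolding lower_tri_def by auto
  moreover have "upper_tri n N" "\<forall>i<n. N i i = 1" by (auto simp: N_def upper_tri_def)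
  ultimately show ?thesis by blast
qed

definition rev_perm :: "nat \<Rightarrow> nat \<Rightarrow> nat" where
  "rev_perm m i = (if i < m then m - 1 - i else i)"

lemma rev_perm_permutes: "rev_perm m permutes {0..<m}"
  by (rule bij_imp_permutes)
    (auto simp: rev_perm_def intro!: bij_betw_byWitness[where f' = "rev_perm m"])

definition rev_sign :: "nat \<Rightarrow> real" where
  "rev_sign m = signof (rev_perm m)"

lemma rev_sign_square: "rev_sign m * rev_sign m = 1"
  unfolding rev_sign_def sign_def by simp

lemma rev_sign_0: "rev_sign 0 = 1"
proof -
  have "rev_perm 0 = id" by (auto simp: rev_perm_def)
  then show ?thesis by (simp add: rev_sign_def sign_id)
qed

lemma mdet_rev_rows: "mdet A m (\<lambda>i. r (m - 1 - i)) c = rev_sign m * mdet A m r c"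
proof -
  have "mdet A m (\<lambda>i. r (m - 1 - i)) c = mdet A m (r \<circ> rev_perm m) c"
    by (rule mdet_cong) (auto simp: rev_perm_def)
  then show ?thesis using mdet_permute_rows[OF rev_perm_permutes] by (simp add: rev_sign_def)
qed

lemma mdet_rev_cols: "mdet A m r (\<lambda>i. c (m - 1 - i)) = rev_sign m * mdet A m r c"
  using mdet_rev_rows[of "\<lambda>i j. A j i" m c r] by (simp add: mdet_transpose[of A])

definition reflect :: "nat \<Rightarrow> (nat \<Rightarrow> nat \<Rightarrow> real) \<Rightarrow> nat \<Rightarrow> nat \<Rightarrow> real" where
  "reflect n A = (\<lambda>i j. A (n - 1 - i) (n - 1 - j))"

text \<open>
  The index sequence for \<open>reflect n A\<close> that corresponds to \<open>r\<close> for \<open>A\<close>. Reflecting the matrix also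
  reverses the order of the indices, and reversing twice restores an increasing sequence.
\<close>

definition opp :: "nat \<Rightarrow> nat \<Rightarrow> (nat \<Rightarrow> nat) \<Rightarrow> nat \<Rightarrow> nat" where
  "opp n m r = (\<lambda>i. n - 1 - r (m - 1 - i))"

lemma incr_opp: "incr m n r \<Longrightarrow> incr m n (opp n m r)"
proof -
  assume r: "incr m n r"
  have "opp n m r i < opp n m r j" if "i < j" "j < m" for i j
  proof -
    have "r (m - 1 - j) < r (m - 1 - i)" by (rule incr_strict[OF r]) (use that in auto)
    moreover have "r (m - 1 - i) < n" by (rule incr_less[OF r]) (use that in auto)
    ultimately show ?thesis unfolding opp_def by linarith
  qed
  moreover have "opp n m r i < n" if "i < m" for i
    using incr_less[OF r, of "m - 1 - i"] that by (auto simp: opp_def)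
  ultimately show ?thesis unfolding incr_def by blast
qed

text \<open>
  Reversing the rows and reversing the columns contribute the same sign, so the signs cancel. This
  exchanges upper with lower triangular matrices and initial with final columns, and transfers the
  results for lower triangular matrices to upper triangular ones.
\<close>

lemma mdet_reflect: "mdet (reflect n A) m r c = mdet A m (opp n m r) (opp n m c)"
proof -
  have "mdet A m (opp n m r) (opp n m c) =
     mdet A m (\<lambda>i. (\<lambda>i. n - 1 - r i) (m - 1 - i)) (\<lambda>i. (\<lambda>i. n - 1 - c i) (m - 1 - i))"
    by (simp add: opp_def)
  also have "\<dots> = (rev_sign m * rev_sign m) * mdet A m (\<lambda>i. n - 1 - r i) (\<lambda>i. n - 1 - c i)"
    unfolding mdet_rev_rows[of A m "\<lambda>i. n - 1 - r i"] mdet_rev_cols[of A m _ "\<lambda>i. n - 1 - c i"]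
    by simp
  also have "\<dots> = mdet (reflect n A) m r c"
    unfolding rev_sign_square by (auto simp: reflect_def intro: mdet_cong)
  finally show ?thesis by simp
qed

lemma opp_opp:
  assumes "incr m n r" "i < m" shows "opp n m (opp n m r) i = r i"
  using incr_less[OF assms] assms(2) by (simp add: opp_def)

lemma opp_initial: "m \<le> n \<Longrightarrow> i < m \<Longrightarrow> opp n m (\<lambda>i. i) i = n - m + i"
  by (auto simp: opp_def)

lemma upper_tri_reflect: "lower_tri n A \<Longrightarrow> upper_tri n (reflect n A)"
  by (auto simp: lower_tri_def upper_tri_def reflect_def)

lemma lower_tri_reflect: "upper_tri n A \<Longrightarrow> lower_tri n (reflect n A)"
  by (auto simp: lower_tri_def upper_tri_def reflect_def)

lemma reflect_mprod: "reflect n (mprod n A B) = mprod n (reflect n A) (reflect n B)"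
proof (intro ext)
  fix i j
  show "reflect n (mprod n A B) i j = mprod n (reflect n A) (reflect n B) i j"
    unfolding reflect_def mprod_def
    by (rule sum.reindex_bij_witness[where i = "\<lambda>k. n - 1 - k" and j = "\<lambda>k. n - 1 - k"]) auto
qed

text \<open>
  Positivity is required exactly for the minors that do not vanish on all upper triangular matrices.
\<close>

definition tp_upper :: "nat \<Rightarrow> (nat \<Rightarrow> nat \<Rightarrow> real) \<Rightarrow> bool" where
  "tp_upper n U \<longleftrightarrow> upper_tri n U \<and>
     (\<forall>m r c. incr m n r \<longrightarrow> incr m n c \<longrightarrow> (\<forall>i<m. r i \<le> c i) \<longrightarrow> 0 < mdet U m r c)"

definition tp_lower :: "nat \<Rightarrow> (nat \<Rightarrow> nat \<Rightarrow> real) \<Rightarrow> bool" where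
  "tp_lower n L \<longleftrightarrow> lower_tri n L \<and>
     (\<forall>m r c. incr m n r \<longrightarrow> incr m n c \<longrightarrow> (\<forall>i<m. c i \<le> r i) \<longrightarrow> 0 < mdet L m r c)"

definition tp :: "nat \<Rightarrow> (nat \<Rightarrow> nat \<Rightarrow> real) \<Rightarrow> bool" where
  "tp n A \<longleftrightarrow> (\<forall>m r c. incr m n r \<longrightarrow> incr m n c \<longrightarrow> 0 < mdet A m r c)"

lemma tp_lower_transpose: "tp_lower n (\<lambda>i j. A j i) \<longleftrightarrow> tp_upper n A"
  unfolding tp_lower_def tp_upper_def lower_tri_transpose[of n A] mdet_transpose[of A] by blast

lemma tp_upper_transpose: "tp_upper n (\<lambda>i j. A j i) \<longleftrightarrow> tp_lower n A"
  using tp_lower_transpose[of n "\<lambda>i j. A j i"] by simp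

lemma tp_upper_nonneg:
  assumes "tp_upper n U" "incr m n r" "incr m n c" shows "0 \<le> mdet U m r c"
proof (cases "\<forall>i<m. r i \<le> c i")
  case True
  then show ?thesis using assms unfolding tp_upper_def by (meson less_imp_le)
next
  case False
  then show ?thesis using mdet_upper_tri_zero[of n U m r c] assms unfolding tp_upper_def
    by (metis not_le order_refl)
qed

lemma tp_lower_nonneg:
  assumes "tp_lower n L" "incr m n r" "incr m n c" shows "0 \<le> mdet L m r c"
  using tp_upper_nonneg[of n "\<lambda>i j. L j i" m c r] assms
  by (simp add: tp_upper_transpose mdet_transpose[of L])

lemma tp_lower_pos:
  "tp_lower n L \<Longrightarrow> incr m n r \<Longrightarrow> incr m n c \<Longrightarrow> (\<And>i. i < m \<Longrightarrow> c i \<le> r i) \<Longrightarrow> 0 < mdet L m r c"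
  unfolding tp_lower_def by blast

lemma tp_upper_pos:
  "tp_upper n U \<Longrightarrow> incr m n r \<Longrightarrow> incr m n c \<Longrightarrow> (\<And>i. i < m \<Longrightarrow> r i \<le> c i) \<Longrightarrow> 0 < mdet U m r c"
  unfolding tp_upper_def by blast

lemma tp_lowerI:
  assumes "lower_tri n L" "\<And>k r. incr k n r \<Longrightarrow> 0 < mdet L k r (\<lambda>s. s)"
  shows "tp_lower n L"
  unfolding tp_lower_def
  using lower_criterion[OF assms(1) assms(2)[OF incr_consecutive]] assms(1) by blast

text \<open>
  The reflected matrix is lower triangular, and its minors in the first columns are the minors of \<open>U\<close>
  in the last columns.
\<close>

lemma tp_upperI:
  assumes U: "upper_tri n U" and pos: "\<And>k r. incr k n r \<Longrightarrow> 0 < mdet U k r (\<lambda>s. n - k + s)"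
  shows "tp_upper n U"
proof -
  have "tp_lower n (reflect n U)"
  proof (rule tp_lowerI[OF lower_tri_reflect[OF U]])
    fix k r assume r: "incr k n r"
    have "mdet (reflect n U) k r (\<lambda>s. s) = mdet U k (opp n k r) (\<lambda>s. n - k + s)"
      unfolding mdet_reflect by (rule mdet_cong) (simp add: opp_initial incr_le[OF r])
    then show "0 < mdet (reflect n U) k r (\<lambda>s. s)" using pos[OF incr_opp[OF r]] by simp
  qed
  then have pos: "0 < mdet (reflect n U) m r c" if "incr m n r" "incr m n c" "\<forall>i<m. c i \<le> r i" for m r c
    using that unfolding tp_lower_def by blast
  have "0 < mdet U m r c" if r: "incr m n r" and c: "incr m n c" and le: "\<forall>i<m. r i \<le> c i" for m r c
  proof -
    have "mdet U m r c = mdet U m (opp n m (opp n m r)) (opp n m (opp n m c))"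
      by (rule mdet_cong) (simp add: opp_opp[OF r] opp_opp[OF c])
    also have "\<dots> = mdet (reflect n U) m (opp n m r) (opp n m c)" by (simp add: mdet_reflect)
    also have "\<dots> > 0"
      by (rule pos) (use le incr_opp[OF r] incr_opp[OF c] in \<open>auto simp: opp_def intro!: diff_le_mono2\<close>)
    finally show ?thesis .
  qed
  then show ?thesis unfolding tp_upper_def using U by blast
qed

lemma tp_lowerI':
  assumes "lower_tri n L" "\<And>k c. incr k n c \<Longrightarrow> 0 < mdet L k (\<lambda>s. n - k + s) c"
  shows "tp_lower n L"
  using tp_upperI[of n "\<lambda>i j. L j i"] assms
  by (simp add: tp_upper_transpose mdet_transpose[of L] upper_tri_def lower_tri_def)

text \<open>
  All terms of the Cauchy-Binet formula are nonnegative, and the term of the last \<open>m\<close> indices is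
  positive: these dominate all row indices of \<open>U\<close> and all column indices of \<open>L\<close>.
\<close>

lemma tp_mprod_upper_lower:
  assumes "tp_upper n U" "tp_lower n L" shows "tp n (mprod n U L)"
  unfolding tp_def
proof (intro allI impI)
  fix m r c assume r: "incr m n r" and c: "incr m n c"
  have m: "m \<le> n" by (rule incr_le[OF r])
  show "0 < mdet (mprod n U L) m r c"
  proof (rule cauchy_binet_pos[OF _ _ incr_final[OF m]])
    show "0 < mdet U m r (\<lambda>i. n - m + i)"
      by (rule tp_upper_pos[OF assms(1) r incr_final[OF m]]) (use incr_le_last[OF r] m in fastforce)
    show "0 < mdet L m (\<lambda>i. n - m + i) c"
      by (rule tp_lower_pos[OF assms(2) incr_final[OF m] c]) (use incr_le_last[OF c] m in fastforce)
  qed (use tp_upper_nonneg[OF assms(1) r] tp_lower_nonneg[OF assms(2) _ c] in auto)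
qed

lemma tp_mprod_lower_upper:
  assumes "tp_lower n L" "tp_upper n U" shows "tp n (mprod n L U)"
  unfolding tp_def
proof (intro allI impI)
  fix m r c assume r: "incr m n r" and c: "incr m n c"
  have m: "m \<le> n" by (rule incr_le[OF r])
  show "0 < mdet (mprod n L U) m r c"
  proof (rule cauchy_binet_pos[OF _ _ incr_initial[OF m]])
    show "0 < mdet L m r (\<lambda>i. i)"
      by (rule tp_lower_pos[OF assms(1) r incr_initial[OF m]]) (use incr_ge[OF r] in auto)
    show "0 < mdet U m (\<lambda>i. i) c"
      by (rule tp_upper_pos[OF assms(2) incr_initial[OF m] c]) (use incr_ge[OF c] in auto)
  qed (use tp_lower_nonneg[OF assms(1) r] tp_upper_nonneg[OF assms(2) _ c] in auto)
qed

lemma prod_ratio_pos: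
  fixes d :: "nat \<Rightarrow> real"
  assumes "\<And>k. k \<le> n \<Longrightarrow> 0 < (\<Prod>i<k. d i)" "i < n" shows "0 < d i"
  using assms(1)[of i] assms(1)[of "Suc i"] assms(2) by (simp add: zero_less_mult_iff)

text \<open>
  Reflection reduces the claim to \<open>lu_columns\<close>. Multiplication by a lower triangular matrix on the
  right changes the minors in the last columns by a common positive factor only, so that they stay
  positive and \<open>tp_upperI\<close> applies to the product.
\<close>

lemma upper_factor:
  assumes pos: "\<And>k r. incr k n r \<Longrightarrow> 0 < mdet M k r (\<lambda>s. n - k + s)"
  shows "\<exists>N. lower_tri n N \<and> (\<forall>i<n. 0 < N i i) \<and> tp_upper n (mprod n M N) \<and> (\<forall>i<n. mprod n M N i i = 1)"
proof -
  have pos': "0 < mdet (reflect n M) k r (\<lambda>s. s)" if r: "incr k n r" for k r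
  proof -
    have "mdet (reflect n M) k r (\<lambda>s. s) = mdet M k (opp n k r) (\<lambda>s. n - k + s)"
      unfolding mdet_reflect by (rule mdet_cong) (simp add: opp_initial incr_le[OF r])
    then show ?thesis using pos[OF incr_opp[OF r]] by simp
  qed
  obtain N where N: "upper_tri n N" "\<forall>i<n. N i i = 1" "lower_tri n (mprod n (reflect n M) N)"
    using lu_columns[of n "reflect n M"] pos'[OF incr_initial] by force
  let ?L = "mprod n (reflect n M) N"
  have L: "mdet ?L k r (\<lambda>s. s) = mdet (reflect n M) k r (\<lambda>s. s)" if "k \<le> n" for k r
    using mdet_mprod_upper_tri_initial[OF N(1) that] mdet_upper_tri_initial[OF N(1) that] N(2) that by simp
  have "0 < (\<Prod>i<k. ?L i i)" if "k \<le> n" for k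
  proof -
    have "mdet ?L k (\<lambda>s. s) (\<lambda>s. s) = (\<Prod>i<k. ?L i i)"
      by (rule mdet_lower_triangular) (use N(3) that in \<open>auto simp: lower_tri_def\<close>)
    then show ?thesis using L[OF that] pos'[OF incr_initial[OF that]] by simp
  qed
  then have Ld: "0 < ?L i i" if "i < n" for i
    using prod_ratio_pos[of n "\<lambda>i. ?L i i"] that by blast
  define U where "U = reflect n ?L"
  have U: "U i j = mprod n M (reflect n N) i j" if "i < n" "j < n" for i j
    unfolding U_def reflect_mprod unfolding mprod_def
    by (rule sum.cong) (use that in \<open>auto simp: reflect_def\<close>)
  define d where "d = (\<lambda>j. 1 / U j j)"
  have d: "0 < d j" "d j * U j j = 1" if "j < n" for j
    using Ld[of "n - 1 - j"] that by (auto simp: d_def U_def reflect_def)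
  define K where "K = (\<lambda>i j. reflect n N i j * d j)"
  have MK: "mprod n M K i j = 1 * U i j * d j" if "i < n" "j < n" for i j
    unfolding U[OF that] mprod_def K_def by (simp add: sum_distrib_right mult.assoc)
  have uptU: "upper_tri n U" unfolding U_def by (rule upper_tri_reflect[OF N(3)])
  have "tp_upper n (mprod n M K)"
  proof (rule tp_upperI)
    show "upper_tri n (mprod n M K)" using uptU MK by (auto simp: upper_tri_def)
    fix k r assume r: "incr k n r"
    have k: "k \<le> n" by (rule incr_le[OF r])
    have "mdet (mprod n M K) k r (\<lambda>s. n - k + s) = mdet (\<lambda>i j. 1 * U i j * d j) k r (\<lambda>s. n - k + s)"
      by (rule mdet_cong, rule MK) (use incr_less[OF r] k in auto)
    also have "\<dots> = mdet U k r (\<lambda>s. n - k + s) * (\<Prod>s<k. d (n - k + s))"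
      by (subst mdet_scale) simp
    also have "mdet U k r (\<lambda>s. n - k + s) = mdet ?L k (opp n k r) (\<lambda>s. s)"
      unfolding U_def mdet_reflect
      by (rule mdet_cong) (use k in \<open>auto simp: opp_def\<close>)
    also have "\<dots> = mdet (reflect n M) k (opp n k r) (\<lambda>s. s)" by (rule L[OF k])
    finally show "0 < mdet (mprod n M K) k r (\<lambda>s. n - k + s)"
      using pos'[OF incr_opp[OF r]] d(1) k by (auto intro!: mult_pos_pos prod_pos)
  qed
  moreover have "lower_tri n K" using lower_tri_reflect[OF N(1)] by (auto simp: K_def lower_tri_def)
  moreover have "0 < K i i" if "i < n" for i
    using N(2) d(1)[OF that] that by (simp add: K_def reflect_def)
  moreover have "mprod n M K i i = 1" if "i < n" for i
    using MK[OF that that] d(2)[OF that] by (simp add: mult.commute)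
  ultimately show ?thesis by blast
qed

text \<open>
  Reversing the first \<open>k\<close> columns changes a minor by \<open>rev_sign k\<close>. These signs are chosen such that
  their product over \<open>j < k\<close> is the same sign (lemma \<open>prod_flip_sign\<close>), and hence corrects it for all
  \<open>k\<close> simultaneously.
\<close>

definition flip_sign :: "nat \<Rightarrow> real" where
  "flip_sign j = rev_sign j * rev_sign (Suc j)"

lemma flip_sign_square: "flip_sign j * flip_sign j = 1"
  unfolding flip_sign_def using rev_sign_square[of j] rev_sign_square[of "Suc j"]
  by (metis (no_types, lifting) mult.commute mult.left_commute mult_1)

lemma prod_flip_sign: "(\<Prod>j<k. flip_sign j) = rev_sign k"
proof (induction k)
  case (Suc k)
  then have "(\<Prod>j<Suc k. flip_sign j) = rev_sign k * rev_sign k * rev_sign (Suc k)"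
    by (simp add: flip_sign_def)
  then show ?case by (simp add: rev_sign_square)
qed (simp add: rev_sign_0)

text \<open>
  The columns in reverse order, with signs: the minors of \<open>flip n A\<close> in the first columns equal the
  minors of \<open>A\<close> in the last columns. It turns the flag spanned by the last columns of \<open>A\<close> into one
  that is spanned by first columns.
\<close>

definition flip :: "nat \<Rightarrow> (nat \<Rightarrow> nat \<Rightarrow> real) \<Rightarrow> nat \<Rightarrow> nat \<Rightarrow> real" where
  "flip n A = (\<lambda>i j. A i (n - 1 - j) * flip_sign j)"

lemma mdet_flip:
  assumes "k \<le> n" shows "mdet (flip n A) k r (\<lambda>s. s) = mdet A k r (\<lambda>s. n - k + s)"
proof -
  have "mdet (flip n A) k r (\<lambda>s. s) = mdet (\<lambda>i j. 1 * A i (n - 1 - j) * flip_sign j) k r (\<lambda>s. s)"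
    by (simp add: flip_def)
  also have "\<dots> = mdet (\<lambda>i j. A i (n - 1 - j)) k r (\<lambda>s. s) * rev_sign k"
    by (subst mdet_scale) (simp add: prod_flip_sign)
  also have "mdet (\<lambda>i j. A i (n - 1 - j)) k r (\<lambda>s. s) = mdet A k r (\<lambda>s. (\<lambda>s. n - k + s) (k - 1 - s))"
    by (rule mdet_cong) (use assms in auto)
  also have "\<dots> = rev_sign k * mdet A k r (\<lambda>s. n - k + s)"
    by (rule mdet_rev_cols)
  finally show ?thesis using rev_sign_square[of k] by (simp add: ac_simps)
qed

lemma lower_factor:
  assumes "tp_upper n U"
  shows "\<exists>N. upper_tri n N \<and> (\<forall>i<n. N i i = 1) \<and> tp_lower n (mprod n (flip n U) N)"
proof -
  have pos: "0 < mdet (flip n U) k r (\<lambda>s. s)" if r: "incr k n r" for k r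
    unfolding mdet_flip[OF incr_le[OF r]]
    by (rule tp_upper_pos[OF assms r incr_final[OF incr_le[OF r]]])
      (use incr_le_last[OF r] incr_le[OF r] in fastforce)
  obtain N where N: "upper_tri n N" "\<forall>i<n. N i i = 1" "lower_tri n (mprod n (flip n U) N)"
    using lu_columns[of n "flip n U"] pos[OF incr_initial] by force
  have "mdet (mprod n (flip n U) N) k r (\<lambda>s. s) = mdet (flip n U) k r (\<lambda>s. s)" if "k \<le> n" for k r
    using mdet_mprod_upper_tri_initial[OF N(1) that] mdet_upper_tri_initial[OF N(1) that] N(2) that by simp
  then have "tp_lower n (mprod n (flip n U) N)"
    by (intro tp_lowerI[OF N(3)]) (use pos incr_le in auto)
  then show ?thesis using N by blast
qed

section \<open>Frames and flags\<close>

definition frame :: "(nat \<Rightarrow> 'v::euclidean_space) \<Rightarrow> bool" where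
  "frame g \<longleftrightarrow> inj_on g {..<DIM('v)} \<and> independent (g ` {..<DIM('v)})"

definition comb :: "(nat \<Rightarrow> 'v::euclidean_space) \<Rightarrow> (nat \<Rightarrow> nat \<Rightarrow> real) \<Rightarrow> nat \<Rightarrow> 'v" where
  "comb g M j = (\<Sum>i<DIM('v). M i j *\<^sub>R g i)"

definition coord :: "(nat \<Rightarrow> 'v::euclidean_space) \<Rightarrow> 'v \<Rightarrow> nat \<Rightarrow> real" where
  "coord g v = (SOME x. v = (\<Sum>i<DIM('v). x i *\<^sub>R g i))"

lemma frame_zero:
  fixes g :: "nat \<Rightarrow> 'v::euclidean_space"
  assumes g: "frame g" and s: "(\<Sum>i<DIM('v). x i *\<^sub>R g i) = 0" and i: "i < DIM('v)"
  shows "x i = 0"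
proof -
  let ?I = "{..<DIM('v)}"
  have inj: "inj_on g ?I" and ind: "independent (g ` ?I)" using g unfolding frame_def by auto
  have "(\<Sum>v\<in>g ` ?I. x (the_inv_into ?I g v) *\<^sub>R v) = (\<Sum>i\<in>?I. x (the_inv_into ?I g (g i)) *\<^sub>R g i)"
    by (simp add: sum.reindex[OF inj])
  also have "\<dots> = (\<Sum>i\<in>?I. x i *\<^sub>R g i)"
    by (rule sum.cong) (auto simp: the_inv_into_f_f[OF inj])
  finally have "(\<Sum>v\<in>g ` ?I. x (the_inv_into ?I g v) *\<^sub>R v) = 0" using s by simp
  from independentD[OF ind _ subset_refl this, of "g i"] i
  show ?thesis by (simp add: the_inv_into_f_f[OF inj])
qed

lemma frame_unique:
  fixes g :: "nat \<Rightarrow> 'v::euclidean_space"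
  assumes "frame g" "(\<Sum>i<DIM('v). x i *\<^sub>R g i) = (\<Sum>i<DIM('v). y i *\<^sub>R g i)" "i < DIM('v)"
  shows "x i = y i"
  using frame_zero[OF assms(1), of "\<lambda>i. x i - y i" i] assms(2,3)
  by (simp add: scaleR_left_diff_distrib sum_subtractf)

lemma frameI:
  fixes g :: "nat \<Rightarrow> 'v::euclidean_space"
  assumes "\<And>x i. (\<Sum>i<DIM('v). x i *\<^sub>R g i) = 0 \<Longrightarrow> i < DIM('v) \<Longrightarrow> x i = 0"
  shows "frame g"
proof -
  let ?I = "{..<DIM('v)}"
  have inj: "inj_on g ?I"
  proof (rule inj_onI, rule ccontr)
    fix i j assume ij: "i \<in> ?I" "j \<in> ?I" "g i = g j" "i \<noteq> j"
    have "(\<Sum>k<DIM('v). ((if k = i then 1 else 0) - (if k = j then 1 else 0)) *\<^sub>R g k) = g i - g j"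
      using ij(1,2)
      by (simp add: scaleR_left_diff_distrib sum_subtractf if_distrib[where f = "\<lambda>x. x *\<^sub>R _"]
          cong: if_cong)
    then show False using assms[of "\<lambda>k. (if k = i then 1 else 0) - (if k = j then 1 else 0)" i] ij by simp
  qed
  have "independent (g ` ?I)"
  proof
    assume "dependent (g ` ?I)"
    then obtain u v where u: "v \<in> g ` ?I" "u v \<noteq> 0" "(\<Sum>v\<in>g ` ?I. u v *\<^sub>R v) = 0"
      by (auto simp: dependent_finite)
    have "(\<Sum>i<DIM('v). u (g i) *\<^sub>R g i) = 0" using u(3) by (simp add: sum.reindex[OF inj])
    then show False using assms[of "\<lambda>i. u (g i)"] u by auto
  qed
  then show ?thesis using inj unfolding frame_def by blast
qed

lemma frame_span:
  fixes g :: "nat \<Rightarrow> 'v::euclidean_space"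
  assumes "frame g" shows "span (g ` {..<DIM('v)}) = UNIV"
proof -
  have "card (g ` {..<DIM('v)}) = DIM('v)" using assms by (simp add: frame_def card_image)
  then have "UNIV \<subseteq> span (g ` {..<DIM('v)})"
    using assms by (intro card_ge_dim_independent) (auto simp: frame_def)
  then show ?thesis by blast
qed

lemma frame_expand:
  fixes g :: "nat \<Rightarrow> 'v::euclidean_space"
  assumes "frame g" shows "v = (\<Sum>i<DIM('v). coord g v i *\<^sub>R g i)"
proof -
  let ?I = "{..<DIM('v)}"
  have inj: "inj_on g ?I" using assms unfolding frame_def by auto
  have "v \<in> span (g ` ?I)" using frame_span[OF assms] by simp
  then obtain u where "v = (\<Sum>w\<in>g ` ?I. u w *\<^sub>R w)" by (auto simp: span_finite)
  then have "v = (\<Sum>i<DIM('v). u (g i) *\<^sub>R g i)" by (simp add: sum.reindex[OF inj])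
  then show ?thesis unfolding coord_def by (rule someI[of "\<lambda>x. v = (\<Sum>i<DIM('v). x i *\<^sub>R g i)"])
qed

lemma coord_eqI:
  fixes g :: "nat \<Rightarrow> 'v::euclidean_space"
  assumes "frame g" "v = (\<Sum>i<DIM('v). x i *\<^sub>R g i)" "i < DIM('v)"
  shows "coord g v i = x i"
  by (rule frame_unique[OF assms(1) _ assms(3)]) (use frame_expand[OF assms(1), of v] assms(2) in simp)

lemma coord_comb:
  fixes g :: "nat \<Rightarrow> 'v::euclidean_space"
  assumes "frame g" "i < DIM('v)" shows "coord g (comb g M j) i = M i j"
  by (rule coord_eqI[OF assms(1) _ assms(2)]) (simp add: comb_def)

lemma comb_coord:
  fixes g :: "nat \<Rightarrow> 'v::euclidean_space"
  assumes "frame g" shows "comb g (\<lambda>i j. coord g (p j) i) = p"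
  by (rule ext) (simp add: comb_def frame_expand[OF assms, symmetric])

lemma coord_frame:
  fixes g :: "nat \<Rightarrow> 'v::euclidean_space"
  assumes "frame g" "i < DIM('v)" "j < DIM('v)" shows "coord g (g j) i = (if i = j then 1 else 0)"
  by (rule coord_eqI[OF assms(1) _ assms(2)])
    (use assms(3) in \<open>simp add: if_distrib[where f = "\<lambda>x. x *\<^sub>R _"] cong: if_cong\<close>)

lemma coord_linear:
  fixes g :: "nat \<Rightarrow> 'v::euclidean_space"
  assumes "frame g" "i < DIM('v)" shows "linear (\<lambda>v. coord g v i)"
proof (rule linearI)
  fix a b c
  show "coord g (a + b) i = coord g a i + coord g b i"
    by (rule coord_eqI[OF assms(1) _ assms(2)])
      (subst frame_expand[OF assms(1), of a], subst frame_expand[OF assms(1), of b],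
        simp add: scaleR_left_distrib sum.distrib)
  show "coord g (c *\<^sub>R a) i = c *\<^sub>R coord g a i"
    by (rule coord_eqI[OF assms(1) _ assms(2)])
      (subst frame_expand[OF assms(1), of a], simp add: scaleR_sum_right)
qed

lemma comb_comb:
  fixes g :: "nat \<Rightarrow> 'v::euclidean_space"
  shows "comb (comb g M) N = comb g (mprod DIM('v) M N)"
proof
  fix j
  have "comb (comb g M) N j = (\<Sum>k<DIM('v). \<Sum>i<DIM('v). (N k j * M i k) *\<^sub>R g i)"
    unfolding comb_def by (simp add: scaleR_sum_right)
  also have "\<dots> = (\<Sum>i<DIM('v). \<Sum>k<DIM('v). (N k j * M i k) *\<^sub>R g i)" by (rule sum.swap)
  also have "\<dots> = comb g (mprod DIM('v) M N) j"
    unfolding comb_def mprod_def by (simp add: scaleR_sum_left mult.commute)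
  finally show "comb (comb g M) N j = comb g (mprod DIM('v) M N) j" .
qed

lemma linear_comb:
  fixes f :: "'v::euclidean_space \<Rightarrow> 'v"
  shows "linear f \<Longrightarrow> f (comb g M j) = comb (f \<circ> g) M j"
  unfolding comb_def by (simp add: linear_sum linear_cmul)

lemma comb_cong: "(\<And>i. i < DIM('v) \<Longrightarrow> M i j = N i j) \<Longrightarrow> (g :: nat \<Rightarrow> 'v::euclidean_space) = h \<Longrightarrow> comb g M j = comb h N j"
  unfolding comb_def by simp

text \<open>
  A linear relation between the new vectors is a vector in the kernel of the matrix \<open>M\<close>.
\<close>

lemma frame_comb:
  fixes g :: "nat \<Rightarrow> 'v::euclidean_space"
  assumes g: "frame g" and det: "mdet M DIM('v) (\<lambda>i. i) (\<lambda>i. i) \<noteq> 0"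
  shows "frame (comb g M)"
proof (rule frameI)
  fix x i assume s: "(\<Sum>j<DIM('v). x j *\<^sub>R comb g M j) = 0" and i: "i < DIM('v)"
  let ?n = "DIM('v)"
  let ?M = "mat ?n ?n (\<lambda>(i, j). M i j)"
  have "comb (comb g M) (\<lambda>j _. x j) 0 = 0" using s by (simp add: comb_def)
  then have "(\<Sum>i<?n. (\<Sum>j<?n. M i j * x j) *\<^sub>R g i) = 0"
    unfolding comb_comb by (simp add: comb_def mprod_def)
  then have z: "(\<Sum>j<?n. M i j * x j) = 0" if "i < ?n" for i
    using frame_zero[OF g, of "\<lambda>i. \<Sum>j<?n. M i j * x j" i] that by blast
  have "?M *\<^sub>v vec ?n x = 0\<^sub>v ?n"
    by (rule eq_vecI) (use z in \<open>auto simp: scalar_prod_def lessThan_atLeast0\<close>)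
  moreover have "det ?M \<noteq> 0" using det by (simp add: mdet_def)
  ultimately have "vec ?n x = 0\<^sub>v ?n"
    using det_0_iff_vec_prod_zero_field[of ?M ?n] by (metis mat_carrier vec_carrier)
  then show "x i = 0" using i by (metis index_vec index_zero_vec(1))
qed

lemma frame_linear_image:
  fixes g :: "nat \<Rightarrow> 'v::euclidean_space" and f :: "'v \<Rightarrow> 'v"
  assumes "frame g" "linear f" "inj f" shows "frame (f \<circ> g)"
proof (rule frameI)
  fix x i assume s: "(\<Sum>i<DIM('v). x i *\<^sub>R (f \<circ> g) i) = 0" and i: "i < DIM('v)"
  have "f (\<Sum>i<DIM('v). x i *\<^sub>R g i) = 0"
    using s by (simp add: linear_sum[OF assms(2)] linear_cmul[OF assms(2)])
  then have "(\<Sum>i<DIM('v). x i *\<^sub>R g i) = 0"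
    using assms(2,3) linear_injective_0 by blast
  then show "x i = 0" using frame_zero[OF assms(1)] i by blast
qed

text \<open>
  The coordinates are linear functionals, and \<open>g\<close> is dual to them.
\<close>

lemma span_coord:
  fixes g :: "nat \<Rightarrow> 'v::euclidean_space"
  assumes g: "frame g" and S: "S \<subseteq> {..<DIM('v)}"
  shows "v \<in> span (g ` S) \<longleftrightarrow> (\<forall>i<DIM('v). i \<notin> S \<longrightarrow> coord g v i = 0)"
proof
  assume "v \<in> span (g ` S)"
  then show "\<forall>i<DIM('v). i \<notin> S \<longrightarrow> coord g v i = 0"
  proof (induction rule: span_induct_alt)
    case base
    then show ?case using linear_0[OF coord_linear[OF g]] by simp
  next
    case (step c x y)
    then obtain j where j: "j \<in> S" "x = g j" by blast
    show ?case
    proof (intro allI impI)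
      fix i assume i: "i < DIM('v)" "i \<notin> S"
      then show "coord g (c *\<^sub>R x + y) i = 0"
        using linear_add[OF coord_linear[OF g i(1)]] linear_cmul[OF coord_linear[OF g i(1)]]
          coord_frame[OF g i(1), of j] S j step i by (auto split: if_splits)
    qed
  qed
next
  assume z: "\<forall>i<DIM('v). i \<notin> S \<longrightarrow> coord g v i = 0"
  have "(\<Sum>i<DIM('v). coord g v i *\<^sub>R g i) \<in> span (g ` S)"
  proof (rule span_sum)
    fix i assume "i \<in> {..<DIM('v)}"
    then show "coord g v i *\<^sub>R g i \<in> span (g ` S)"
      using z by (cases "i \<in> S") (auto intro: span_scale span_base simp: span_zero)
  qed
  then show "v \<in> span (g ` S)" using frame_expand[OF g, of v] by simp
qed

definition final_flag :: "(nat \<Rightarrow> 'v::euclidean_space) \<Rightarrow> 'v flag" where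
  "final_flag g k = span (g ` {DIM('v) - k..<DIM('v)})"

definition initial_flag :: "(nat \<Rightarrow> 'v::euclidean_space) \<Rightarrow> 'v flag" where
  "initial_flag g k = span (g ` {..<min k DIM('v)})"

lemma dim_frame_span:
  fixes g :: "nat \<Rightarrow> 'v::euclidean_space"
  assumes "frame g" "S \<subseteq> {..<DIM('v)}" shows "dim (span (g ` S)) = card S"
proof -
  have "independent (g ` S)" "inj_on g S"
    using assms independent_mono[of "g ` {..<DIM('v)}" "g ` S"] unfolding frame_def
    by (auto intro: inj_on_subset)
  then show ?thesis by (simp add: dim_eq_card_independent card_image)
qed

lemma is_flag_final_flag:
  fixes g :: "nat \<Rightarrow> 'v::euclidean_space"
  assumes "frame g" shows "is_flag (final_flag g)"
  unfolding is_flag_def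
proof (intro conjI allI)
  show "mono (final_flag g)" unfolding final_flag_def by (intro monoI span_mono image_mono) auto
  fix k
  show "subspace (final_flag g k)" unfolding final_flag_def by (rule subspace_span)
  have "{DIM('v) - k..<DIM('v)} \<subseteq> {..<DIM('v)}" by auto
  then show "dim (final_flag g k) = min k DIM('v)"
    unfolding final_flag_def by (subst dim_frame_span[OF assms]) auto
qed

lemma is_flag_initial_flag:
  fixes g :: "nat \<Rightarrow> 'v::euclidean_space"
  assumes "frame g" shows "is_flag (initial_flag g)"
  unfolding is_flag_def
proof (intro conjI allI)
  show "mono (initial_flag g)" unfolding initial_flag_def by (intro monoI span_mono image_mono) auto
  fix k
  show "subspace (initial_flag g k)" unfolding initial_flag_def by (rule subspace_span)
  have "{..<min k DIM('v)} \<subseteq> {..<DIM('v)}" by auto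
  then show "dim (initial_flag g k) = min k DIM('v)"
    unfolding initial_flag_def by (subst dim_frame_span[OF assms]) auto
qed

lemma flag_eqI:
  fixes F :: "'v::euclidean_space flag"
  assumes F: "is_flag F" and G: "is_flag G" and sub: "\<And>k. G k \<subseteq> F k"
  shows "F = G"
proof
  fix k
  show "F k = G k"
    using subspace_dim_equal[of "G k" "F k"] F G sub unfolding is_flag_def by force
qed

lemma flag_eq_final_flag:
  fixes F :: "'v::euclidean_space flag"
  assumes F: "is_flag F" and g: "frame g" and mem: "\<And>i. i < DIM('v) \<Longrightarrow> g i \<in> F (DIM('v) - i)"
  shows "F = final_flag g"
proof (rule flag_eqI[OF F is_flag_final_flag[OF g]])
  fix k
  have "g i \<in> F k" if "DIM('v) - k \<le> i" "i < DIM('v)" for i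
  proof -
    have "F (DIM('v) - i) \<subseteq> F k"
      by (rule monoD[of F]) (use F that in \<open>auto simp: is_flag_def\<close>)
    then show ?thesis using mem[OF that(2)] by blast
  qed
  then show "final_flag g k \<subseteq> F k"
    unfolding final_flag_def using F by (intro span_minimal) (auto simp: is_flag_def)
qed

lemma flag_eq_initial_flag:
  fixes F :: "'v::euclidean_space flag"
  assumes F: "is_flag F" and g: "frame g" and mem: "\<And>i. i < DIM('v) \<Longrightarrow> g i \<in> F (Suc i)"
  shows "F = initial_flag g"
proof (rule flag_eqI[OF F is_flag_initial_flag[OF g]])
  fix k
  have "g i \<in> F k" if "i < k" "i < DIM('v)" for i
  proof -
    have "F (Suc i) \<subseteq> F k"
      by (rule monoD[of F]) (use F that in \<open>auto simp: is_flag_def\<close>)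
    then show ?thesis using mem[OF that(2)] by blast
  qed
  then show "initial_flag g k \<subseteq> F k"
    unfolding initial_flag_def using F by (intro span_minimal) (auto simp: is_flag_def)
qed

lemma final_flag_coord:
  fixes g :: "nat \<Rightarrow> 'v::euclidean_space"
  assumes "frame g"
  shows "v \<in> final_flag g k \<longleftrightarrow> (\<forall>i<DIM('v). i < DIM('v) - k \<longrightarrow> coord g v i = 0)"
  unfolding final_flag_def by (subst span_coord[OF assms]) (auto simp: not_le)

lemma initial_flag_coord:
  fixes g :: "nat \<Rightarrow> 'v::euclidean_space"
  assumes "frame g"
  shows "v \<in> initial_flag g k \<longleftrightarrow> (\<forall>i<DIM('v). k \<le> i \<longrightarrow> coord g v i = 0)"
  unfolding initial_flag_def by (subst span_coord[OF assms]) (auto simp: not_less)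

lemma frame_in_final_flag: "i < DIM('v) \<Longrightarrow> DIM('v) - k \<le> i \<Longrightarrow> (g :: nat \<Rightarrow> 'v::euclidean_space) i \<in> final_flag g k"
  unfolding final_flag_def by (rule span_base) auto

lemma frame_in_initial_flag: "i < DIM('v) \<Longrightarrow> i < k \<Longrightarrow> (g :: nat \<Rightarrow> 'v::euclidean_space) i \<in> initial_flag g k"
  unfolding initial_flag_def by (rule span_base) auto

lemma final_flag_comb:
  fixes g :: "nat \<Rightarrow> 'v::euclidean_space"
  assumes g: "frame g" and p: "frame (comb g N)" and N: "lower_tri DIM('v) N"
  shows "final_flag (comb g N) = final_flag g"
proof (rule flag_eq_final_flag[OF is_flag_final_flag[OF g] p, symmetric])
  fix j assume "j < DIM('v)"
  then show "comb g N j \<in> final_flag g (DIM('v) - j)"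
    using N unfolding final_flag_coord[OF g] by (auto simp: coord_comb[OF g] lower_tri_def)
qed

lemma initial_flag_comb:
  fixes g :: "nat \<Rightarrow> 'v::euclidean_space"
  assumes g: "frame g" and p: "frame (comb g N)" and N: "upper_tri DIM('v) N"
  shows "initial_flag (comb g N) = initial_flag g"
proof (rule flag_eq_initial_flag[OF is_flag_initial_flag[OF g] p, symmetric])
  fix j assume "j < DIM('v)"
  then show "comb g N j \<in> initial_flag g (Suc j)"
    using N unfolding initial_flag_coord[OF g] by (auto simp: coord_comb[OF g] upper_tri_def)
qed

text \<open>
  Together with \<open>final_flag_comb\<close>: two frames have the same final flag if and only if the matrix
  between them is lower triangular.
\<close>

lemma final_flag_eqD:
  fixes g :: "nat \<Rightarrow> 'v::euclidean_space"
  assumes g: "frame g" and eq: "final_flag p = final_flag g"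
  shows "lower_tri DIM('v) (\<lambda>i j. coord g (p j) i)"
proof -
  have "coord g (p j) i = 0" if "i < j" "j < DIM('v)" for i j
  proof -
    have "p j \<in> final_flag g (DIM('v) - j)" unfolding eq[symmetric] by (rule frame_in_final_flag) (use that in auto)
    then show ?thesis using that unfolding final_flag_coord[OF g] by auto
  qed
  then show ?thesis unfolding lower_tri_def by blast
qed

lemma initial_flag_eqD:
  fixes g :: "nat \<Rightarrow> 'v::euclidean_space"
  assumes g: "frame g" and eq: "initial_flag p = initial_flag g"
  shows "upper_tri DIM('v) (\<lambda>i j. coord g (p j) i)"
proof -
  have "coord g (p j) i = 0" if "j < i" "i < DIM('v)" for i j
  proof -
    have "p j \<in> initial_flag g (Suc j)" unfolding eq[symmetric] by (rule frame_in_initial_flag) (use that in auto)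
    then show ?thesis using that unfolding initial_flag_coord[OF g] by auto
  qed
  then show ?thesis unfolding upper_tri_def by blast
qed

text \<open>
  The matrix between the two frames is both lower and upper triangular.
\<close>

lemma adapted_frames:
  fixes g :: "nat \<Rightarrow> 'v::euclidean_space"
  assumes g: "frame g" and p: "frame p" and eq: "final_flag p = final_flag g" "initial_flag p = initial_flag g"
  obtains d where "\<And>j. j < DIM('v) \<Longrightarrow> p j = d j *\<^sub>R g j" "\<And>j. j < DIM('v) \<Longrightarrow> d j \<noteq> 0"
proof
  fix j assume j: "j < DIM('v)"
  have z: "coord g (p j) i = 0" if "i < DIM('v)" "i \<noteq> j" for i
    using final_flag_eqD[OF g eq(1)] initial_flag_eqD[OF g eq(2)] that j unfolding lower_tri_def upper_tri_def
    by (cases "i < j") auto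
  have "p j = (\<Sum>i<DIM('v). coord g (p j) i *\<^sub>R g i)" by (rule frame_expand[OF g])
  also have "\<dots> = (\<Sum>i\<in>{j}. coord g (p j) i *\<^sub>R g i)"
    by (rule sum.mono_neutral_right) (use z j in auto)
  finally show pj: "p j = coord g (p j) j *\<^sub>R g j" by simp
  show "coord g (p j) j \<noteq> 0"
  proof
    assume "coord g (p j) j = 0"
    then have "p j = 0" using pj by simp
    then show False using coord_frame[OF p j j] linear_0[OF coord_linear[OF p j]] by simp
  qed
qed

lemma final_flag_eq_initial_flag_flip:
  fixes g :: "nat \<Rightarrow> 'v::euclidean_space"
  assumes "frame (comb g A)" "frame (comb g (flip DIM('v) A))"
  shows "final_flag (comb g A) = initial_flag (comb g (flip DIM('v) A))"
proof (rule flag_eq_initial_flag[OF is_flag_final_flag[OF assms(1)] assms(2)])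
  fix i assume i: "i < DIM('v)"
  have "comb g (flip DIM('v) A) i = flip_sign i *\<^sub>R comb g A (DIM('v) - 1 - i)"
    unfolding comb_def flip_def by (simp add: scaleR_sum_right mult.commute)
  moreover have "comb g A (DIM('v) - 1 - i) \<in> final_flag (comb g A) (Suc i)"
    by (rule frame_in_final_flag) (use i in auto)
  ultimately show "comb g (flip DIM('v) A) i \<in> final_flag (comb g A) (Suc i)"
    unfolding final_flag_def by (simp add: span_scale)
qed

lemma final_flag_image:
  fixes f :: "'v::euclidean_space \<Rightarrow> 'v"
  shows "linear f \<Longrightarrow> final_flag (f \<circ> g) = (\<lambda>k. f ` final_flag g k)"
  unfolding final_flag_def image_comp[symmetric] by (simp add: linear_span_image)

lemma initial_flag_image:
  fixes f :: "'v::euclidean_space \<Rightarrow> 'v"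
  shows "linear f \<Longrightarrow> initial_flag (f \<circ> g) = (\<lambda>k. f ` initial_flag g k)"
  unfolding initial_flag_def image_comp[symmetric] by (simp add: linear_span_image)

section \<open>The projective linear group and unipotent elements\<close>

text \<open>
  The coset of \<open>f\<close>, that is, the element of the projective linear group represented by \<open>f\<close>.
\<close>

definition pgl_class :: "('v::euclidean_space \<Rightarrow> 'v) \<Rightarrow> ('v \<Rightarrow> 'v) set" where
  "pgl_class f = {(\<lambda>v. c *\<^sub>R f v) |c. c \<noteq> 0}"

lemma pgl_class_self: "f \<in> pgl_class f"
  unfolding pgl_class_def by (auto intro!: exI[of _ 1])

lemma carrier_PGL: "carrier PGL = pgl_class ` {f :: 'v::euclidean_space \<Rightarrow> 'v. linear f \<and> bij f}"
proof -
  have "scalars #>\<^bsub>GL\<^esub> f = pgl_class f" for f :: "'v \<Rightarrow> 'v"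
    by (fastforce simp: r_coset_def scalars_def pgl_class_def GL_def o_def)
  then show ?thesis
    by (auto simp: PGL_def FactGroup_def RCOSETS_def GL_def image_def)
qed

lemma mult_PGL:
  assumes "linear f" shows "pgl_class f \<otimes>\<^bsub>PGL\<^esub> pgl_class h = pgl_class (f \<circ> h)"
proof -
  have fc: "f (c *\<^sub>R v) = c *\<^sub>R f v" for c v using linear_cmul[OF assms] .
  have "pgl_class f \<otimes>\<^bsub>PGL\<^esub> pgl_class h = (\<Union>x\<in>pgl_class f. \<Union>y\<in>pgl_class h. {x \<circ> y})"
    by (simp add: PGL_def FactGroup_def set_mult_def GL_def)
  also have "\<dots> = pgl_class (f \<circ> h)"
  proof (intro equalityI subsetI)
    fix z assume "z \<in> (\<Union>x\<in>pgl_class f. \<Union>y\<in>pgl_class h. {x \<circ> y})"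
    then obtain c d where cd: "c \<noteq> 0" "d \<noteq> 0" "z = (\<lambda>v. c *\<^sub>R f v) \<circ> (\<lambda>v. d *\<^sub>R h v)"
      by (auto simp: pgl_class_def)
    then have "z = (\<lambda>v. (c * d) *\<^sub>R (f \<circ> h) v)" by (auto simp: fc)
    then show "z \<in> pgl_class (f \<circ> h)" using cd unfolding pgl_class_def by fastforce
  next
    fix z assume "z \<in> pgl_class (f \<circ> h)"
    then obtain c where c: "c \<noteq> 0" "z = (\<lambda>v. c *\<^sub>R (f \<circ> h) v)" by (auto simp: pgl_class_def)
    then have "z = (\<lambda>v. c *\<^sub>R f v) \<circ> h" "(\<lambda>v. c *\<^sub>R f v) \<in> pgl_class f" by (auto simp: pgl_class_def)
    then show "z \<in> (\<Union>x\<in>pgl_class f. \<Union>y\<in>pgl_class h. {x \<circ> y})" using pgl_class_self by blast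
  qed
  finally show ?thesis .
qed

lemma one_PGL: "\<one>\<^bsub>PGL\<^esub> = pgl_class id"
  by (auto simp: PGL_def FactGroup_def scalars_def pgl_class_def)

lemma list_prod_PGL_singleton:
  assumes "linear f" shows "list_prod PGL [pgl_class f] = pgl_class f"
  by (simp add: list_prod_def one_PGL mult_PGL[OF assms])

lemma list_prod_PGL_pair:
  assumes "linear f" "linear h" shows "list_prod PGL [pgl_class f, pgl_class h] = pgl_class (f \<circ> h)"
  by (simp add: list_prod_def one_PGL mult_PGL assms)

lemma flag_act_pgl_class:
  assumes f: "linear f" and F: "is_flag F"
  shows "flag_act (pgl_class f) F = (\<lambda>k. f ` F k)"
proof
  fix k
  have "(SOME h. h \<in> pgl_class f) \<in> pgl_class f" using pgl_class_self by (rule someI[of "\<lambda>h. h \<in> pgl_class f"])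
  then obtain c where c: "c \<noteq> 0" "(SOME h. h \<in> pgl_class f) = (\<lambda>v. c *\<^sub>R f v)" by (auto simp: pgl_class_def)
  have s: "subspace (F k)" using F by (auto simp: is_flag_def)
  have "(\<lambda>v. c *\<^sub>R f v) ` F k = f ` F k"
  proof (intro equalityI subsetI)
    fix x assume "x \<in> (\<lambda>v. c *\<^sub>R f v) ` F k"
    then obtain v where v: "v \<in> F k" "x = c *\<^sub>R f v" by blast
    then have "x = f (c *\<^sub>R v)" by (simp add: linear_cmul[OF f])
    then show "x \<in> f ` F k" using v subspace_scale[OF s] by blast
  next
    fix x assume "x \<in> f ` F k"
    then obtain v where v: "v \<in> F k" "x = f v" by blast
    then have "x = c *\<^sub>R f ((1 / c) *\<^sub>R v)" using c by (simp add: linear_cmul[OF f])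
    then show "x \<in> (\<lambda>v. c *\<^sub>R f v) ` F k" using v subspace_scale[OF s] by blast
  qed
  then show "flag_act (pgl_class f) F k = f ` F k" unfolding flag_act_def c(2) .
qed

lemma ordered_basis_frame:
  fixes es :: "'v::euclidean_space list"
  assumes "ordered_basis es" shows "frame ((!) es)"
proof -
  have "(!) es ` {..<DIM('v)} = set es"
    using assms unfolding ordered_basis_def by (auto simp: set_conv_nth)
  moreover have "inj_on ((!) es) {..<DIM('v)}"
    using assms unfolding ordered_basis_def by (auto simp: inj_on_nth)
  ultimately show ?thesis using assms unfolding ordered_basis_def frame_def by simp
qed

lemma frame_ordered_basis:
  fixes g :: "nat \<Rightarrow> 'v::euclidean_space"
  assumes "frame g" shows "ordered_basis (map g [0..<DIM('v)])"
  using assms frame_span[OF assms] unfolding ordered_basis_def frame_def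
  by (simp add: distinct_map lessThan_atLeast0)

lemma matrix_of_coord:
  fixes es :: "'v::euclidean_space list"
  assumes es: "ordered_basis es" and i: "i < DIM('v)" and j: "j < DIM('v)"
  shows "matrix_of es f $$ (i, j) = coord ((!) es) (f (es ! j)) i"
proof -
  have fr: "frame ((!) es)" by (rule ordered_basis_frame[OF es])
  have im: "(!) es ` {..<DIM('v)} = set es" and inj: "inj_on ((!) es) {..<DIM('v)}"
    using es unfolding ordered_basis_def by (auto simp: set_conv_nth inj_on_nth)
  let ?v = "f (es ! j)"
  have "(\<Sum>b\<in>set es. representation (set es) ?v b *\<^sub>R b) = ?v"
    using es by (intro sum_representation_eq) (auto simp: ordered_basis_def)
  then have "?v = (\<Sum>i<DIM('v). representation (set es) ?v (es ! i) *\<^sub>R es ! i)"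
    unfolding im[symmetric] by (simp add: sum.reindex[OF inj])
  then have "coord ((!) es) ?v i = representation (set es) ?v (es ! i)"
    by (rule coord_eqI[OF fr _ i])
  then show ?thesis using i j by (simp add: matrix_of_def)
qed

lemma minor_mdet:
  assumes M: "M \<in> carrier_mat n n" and IJ: "I \<subseteq> {..<n}" "J \<subseteq> {..<n}" "card I = card J"
  shows "minor M I J = mdet (\<lambda>i j. M $$ (i, j)) (card I) (pick I) (pick J)"
proof -
  have "{i. i < dim_row M \<and> i \<in> I} = I" "{i. i < dim_col M \<and> i \<in> J} = J" using M IJ by auto
  then show ?thesis using IJ unfolding minor_def submatrix_def mdet_def by simp
qed

text \<open>
  If \<open>pick I \<le> pick J\<close> fails, then the minor vanishes as for every triangular matrix. If it holds, then
  the matrix with ones at the positions \<open>(pick I i, pick J i)\<close> and zeros elsewhere is upper triangular,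
  and its minor is the determinant of an identity matrix.
\<close>

lemma not_forced_zero_iff:
  assumes IJ: "I \<subseteq> {..<n}" "J \<subseteq> {..<n}" "card I = card J"
  shows "\<not> forced_zero n I J \<longleftrightarrow> (\<forall>i<card I. pick I i \<le> pick J i)"
proof
  have incr: "incr (card I) n (pick I)" "incr (card I) n (pick J)"
    using IJ by (auto intro!: incr_pick simp: index_sets_def)
  assume nf: "\<not> forced_zero n I J"
  show "\<forall>i<card I. pick I i \<le> pick J i"
  proof (rule ccontr)
    assume "\<not> ?thesis"
    then obtain i where i: "i < card I" "pick J i < pick I i" by (meson not_le)
    have "minor N I J = 0" if N: "N \<in> carrier_mat n n" "upper_triangular N" for N
      unfolding minor_mdet[OF N(1) IJ]
      by (rule mdet_upper_tri_zero[OF _ incr i]) (use N in \<open>auto simp: upper_tri_def upper_triangular_def\<close>)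
    then show False using nf unfolding forced_zero_def by blast
  qed
next
  have incr: "incr (card I) n (pick I)" "incr (card I) n (pick J)"
    using IJ by (auto intro!: incr_pick simp: index_sets_def)
  assume le: "\<forall>i<card I. pick I i \<le> pick J i"
  let ?A = "\<lambda>a b. if \<exists>i<card I. a = pick I i \<and> b = pick J i then 1 else 0 :: real"
  let ?N = "mat n n (\<lambda>(a, b). ?A a b)"
  have "upper_triangular ?N"
    unfolding upper_triangular_def
  proof (intro allI impI)
    fix a b assume ab: "a < dim_row ?N" "b < a"
    then have "\<not> (\<exists>i<card I. a = pick I i \<and> b = pick J i)" using le by (metis not_le)
    then show "?N $$ (a, b) = 0" using ab by simp
  qed
  then have N: "?N \<in> carrier_mat n n" "upper_triangular ?N" by auto
  have eq: "pick I i = pick I j \<longleftrightarrow> i = j" "pick J i = pick J j \<longleftrightarrow> i = j"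
    if "i < card I" "j < card I" for i j
    using incr_strict[OF incr(1), of i j] incr_strict[OF incr(1), of j i]
      incr_strict[OF incr(2), of i j] incr_strict[OF incr(2), of j i] that
    by (metis nat_neq_iff)+
  have "minor ?N I J = mdet ?A (card I) (pick I) (pick J)"
    unfolding minor_mdet[OF N(1) IJ]
    by (rule mdet_cong) (use incr_less[OF incr(1)] incr_less[OF incr(2)] in auto)
  also have "\<dots> = (\<Prod>i<card I. ?A (pick I i) (pick J i))"
    by (rule mdet_lower_triangular) (use eq in auto)
  also have "\<dots> = 1" by (rule prod.neutral) auto
  finally show "\<not> forced_zero n I J" using N unfolding forced_zero_def by force
qed

lemma totally_positive_unipotent_iff:
  assumes M: "M \<in> carrier_mat n n"
  shows "totally_positive_unipotent n M \<longleftrightarrow>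
    tp_upper n (\<lambda>i j. M $$ (i, j)) \<and> (\<forall>i<n. M $$ (i, i) = 1)" (is "_ \<longleftrightarrow> tp_upper n ?A \<and> _")
proof
  assume L: "totally_positive_unipotent n M"
  have "0 < mdet ?A m r c" if r: "incr m n r" and c: "incr m n c" and le: "\<forall>i<m. r i \<le> c i" for m r c
  proof -
    let ?I = "r ` {..<m}" let ?J = "c ` {..<m}"
    have IJ: "?I \<subseteq> {..<n}" "?J \<subseteq> {..<n}" "card ?I = m" "card ?J = m"
      using incr_eq_pick(1)[OF r] incr_eq_pick(1)[OF c] by (auto simp: index_sets_def)
    then have "\<not> forced_zero n ?I ?J"
      using le incr_eq_pick(2)[OF r] incr_eq_pick(2)[OF c] by (subst not_forced_zero_iff) auto
    then have "0 < minor M ?I ?J" using L IJ unfolding totally_positive_unipotent_def by simp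
    then have "0 < mdet ?A m (pick ?I) (pick ?J)" using minor_mdet[OF M IJ(1,2)] IJ by simp
    then show ?thesis by (simp add: mdet_pick_cong[OF r] mdet_pick_cong[OF c])
  qed
  moreover have "upper_tri n ?A"
    using L M unfolding totally_positive_unipotent_def upper_tri_def upper_triangular_def by auto
  ultimately show "tp_upper n ?A \<and> (\<forall>i<n. M $$ (i, i) = 1)"
    using L unfolding totally_positive_unipotent_def tp_upper_def by blast
next
  assume R: "tp_upper n ?A \<and> (\<forall>i<n. M $$ (i, i) = 1)"
  have "0 < minor M I J"
    if IJ: "I \<subseteq> {..<n}" "J \<subseteq> {..<n}" "card I = card J" and nf: "\<not> forced_zero n I J" for I J
  proof -
    have "incr (card I) n (pick I)" "incr (card I) n (pick J)"
      using IJ by (auto intro!: incr_pick simp: index_sets_def)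
    then show ?thesis
      using R nf unfolding minor_mdet[OF M IJ] not_forced_zero_iff[OF IJ] tp_upper_def by blast
  qed
  moreover have "upper_triangular M"
    using R M unfolding tp_upper_def upper_tri_def upper_triangular_def by auto
  ultimately show "totally_positive_unipotent n M"
    using R M unfolding totally_positive_unipotent_def by blast
qed

definition tp_unipotent :: "nat \<Rightarrow> (nat \<Rightarrow> nat \<Rightarrow> real) \<Rightarrow> bool" where
  "tp_unipotent n U \<longleftrightarrow> tp_upper n U \<and> (\<forall>i<n. U i i = 1)"

lemma mdet_tp_upper_nonzero: "tp_upper n U \<Longrightarrow> mdet U n (\<lambda>i. i) (\<lambda>i. i) \<noteq> 0"
proof -
  assume U: "tp_upper n U"
  have "0 < mdet U n (\<lambda>i. i) (\<lambda>i. i)"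
    by (rule tp_upper_pos[OF U incr_initial incr_initial]) auto
  then show ?thesis by simp
qed

lemma frame_tp_upper:
  "frame g \<Longrightarrow> tp_upper DIM('v) U \<Longrightarrow> frame (comb (g :: nat \<Rightarrow> 'v::euclidean_space) U)"
  using frame_comb mdet_tp_upper_nonzero by blast

lemma U_posD:
  fixes es :: "'v::euclidean_space list"
  assumes es: "ordered_basis es" and u: "u \<in> U_pos es"
  obtains f U where "u = pgl_class f" "linear f" "bij f" "tp_unipotent DIM('v) U"
    "\<forall>j<DIM('v). f (es ! j) = comb ((!) es) U j"
proof -
  obtain h f where h: "u = pgl_class h" "linear h" "bij h" and f: "f \<in> u"
    and tp: "totally_positive_unipotent DIM('v) (matrix_of es f)"
    using u unfolding U_pos_def carrier_PGL by blast
  obtain c where c: "c \<noteq> 0" "f = (\<lambda>v. c *\<^sub>R h v)" using f h by (auto simp: pgl_class_def)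
  have lin: "linear f" unfolding c(2) by (rule linear_compose_scale_right[OF h(2)])
  have pf: "pgl_class f = u"
  proof (intro equalityI subsetI)
    fix z assume "z \<in> pgl_class f"
    then obtain d where "d \<noteq> 0" "z = (\<lambda>v. (d * c) *\<^sub>R h v)" by (auto simp: pgl_class_def c)
    then show "z \<in> u" unfolding h(1) pgl_class_def using c(1) by fastforce
  next
    fix z assume "z \<in> u"
    then obtain d where d: "d \<noteq> 0" "z = (\<lambda>v. d *\<^sub>R h v)" by (auto simp: pgl_class_def h)
    then have "z = (\<lambda>v. (d / c) *\<^sub>R f v)" using c by auto
    then show "z \<in> pgl_class f" unfolding pgl_class_def using c(1) d(1) by (auto intro!: exI[of _ "d / c"])
  qed
  have bij: "bij f"
  proof -
    have "inj f" using h(3) c unfolding bij_def inj_def by auto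
    then show ?thesis using linear_injective_imp_surjective[OF lin] by (auto simp: bij_def)
  qed
  let ?U = "\<lambda>i j. matrix_of es f $$ (i, j)"
  have "tp_unipotent DIM('v) ?U"
    using tp totally_positive_unipotent_iff[of "matrix_of es f" "DIM('v)"]
    by (auto simp: tp_unipotent_def matrix_of_def)
  moreover have "f (es ! j) = comb ((!) es) ?U j" if "j < DIM('v)" for j
  proof -
    have "f (es ! j) = (\<Sum>i<DIM('v). coord ((!) es) (f (es ! j)) i *\<^sub>R es ! i)"
      by (rule frame_expand[OF ordered_basis_frame[OF es]])
    also have "\<dots> = comb ((!) es) ?U j"
      unfolding comb_def by (rule sum.cong) (use matrix_of_coord[OF es _ that] in auto)
    finally show ?thesis .
  qed
  ultimately show ?thesis using that pf lin bij by metis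
qed

lemma U_posI:
  fixes es :: "'v::euclidean_space list"
  assumes es: "ordered_basis es" and U: "tp_unipotent DIM('v) U"
  obtains f where "linear f" "pgl_class f \<in> U_pos es"
    "\<forall>j<DIM('v). f (es ! j) = comb ((!) es) U j"
proof -
  let ?e = "(!) es"
  have e: "frame ?e" by (rule ordered_basis_frame[OF es])
  define f where "f v = (\<Sum>j<DIM('v). coord ?e v j *\<^sub>R comb ?e U j)" for v
  have lin: "linear f"
  proof (rule linearI)
    fix a b c
    show "f (a + b) = f a + f b"
      unfolding f_def sum.distrib[symmetric]
      by (rule sum.cong) (simp_all add: linear_add[OF coord_linear[OF e]] scaleR_left_distrib)
    show "f (c *\<^sub>R a) = c *\<^sub>R f a"
      unfolding f_def scaleR_sum_right
      by (rule sum.cong) (simp_all add: linear_cmul[OF coord_linear[OF e]])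
  qed
  have fe: "f (es ! j) = comb ?e U j" if "j < DIM('v)" for j
  proof -
    have "f (es ! j) = (\<Sum>i<DIM('v). (if i = j then 1 else 0) *\<^sub>R comb ?e U i)"
      unfolding f_def by (rule sum.cong) (use coord_frame[OF e _ that] in auto)
    then show ?thesis using that
      by (simp add: if_distrib[where f = "\<lambda>x. x *\<^sub>R _"] cong: if_cong)
  qed
  have fr: "frame (comb ?e U)" using frame_tp_upper[OF e] U unfolding tp_unipotent_def by blast
  have "inj f"
  proof (subst linear_injective_0[OF lin], intro allI impI)
    fix v assume "f v = 0"
    then have "coord ?e v j = 0" if "j < DIM('v)" for j
      unfolding f_def using frame_zero[OF fr] that by blast
    then show "v = 0" using frame_expand[OF e, of v] by simp
  qed
  then have bij: "bij f" using linear_injective_imp_surjective[OF lin] by (auto simp: bij_def)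
  have M: "matrix_of es f \<in> carrier_mat DIM('v) DIM('v)" by (simp add: matrix_of_def)
  have entries: "matrix_of es f $$ (i, j) = U i j" if "i < DIM('v)" "j < DIM('v)" for i j
    using matrix_of_coord[OF es that] fe[OF that(2)] coord_comb[OF e that(1)] by simp
  have "tp_upper DIM('v) (\<lambda>i j. matrix_of es f $$ (i, j))"
  proof -
    have "mdet (\<lambda>i j. matrix_of es f $$ (i, j)) m r c = mdet U m r c"
      if "incr m DIM('v) r" "incr m DIM('v) c" for m r c
      by (rule mdet_cong) (use entries incr_less that in blast)
    then show ?thesis using U entries unfolding tp_unipotent_def tp_upper_def upper_tri_def by auto
  qed
  then have "totally_positive_unipotent DIM('v) (matrix_of es f)"
    unfolding totally_positive_unipotent_iff[OF M] using U entries by (auto simp: tp_unipotent_def)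
  then have "pgl_class f \<in> U_pos es"
    unfolding U_pos_def carrier_PGL using lin bij pgl_class_self by blast
  then show ?thesis using that lin fe by blast
qed

section \<open>Positive tuples of flags in terms of matrices\<close>

lemma mdet_upper_triangular:
  assumes "\<And>i j. j < i \<Longrightarrow> i < m \<Longrightarrow> A (r i) (c j) = 0"
  shows "mdet A m r c = (\<Prod>i<m. A (r i) (c i))"
  using mdet_lower_triangular[of m "\<lambda>i j. A j i" c r] assms by (simp add: mdet_transpose[of A])

lemma final_flag_cong: "(\<And>i. i < DIM('v) \<Longrightarrow> p i = q i) \<Longrightarrow> final_flag p = final_flag (q :: nat \<Rightarrow> 'v::euclidean_space)"
  unfolding final_flag_def by (intro ext arg_cong[where f = span] image_cong) auto

lemma initial_flag_cong: "(\<And>i. i < DIM('v) \<Longrightarrow> p i = q i) \<Longrightarrow> initial_flag p = initial_flag (q :: nat \<Rightarrow> 'v::euclidean_space)"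
  unfolding initial_flag_def by (intro ext arg_cong[where f = span] image_cong) auto

lemma comb_cong_frame:
  "(\<And>i. i < DIM('v) \<Longrightarrow> g i = h i) \<Longrightarrow> comb g M = comb (h :: nat \<Rightarrow> 'v::euclidean_space) M"
  unfolding comb_def by (intro ext sum.cong) auto

lemma frame_cong:
  "(\<And>i. i < DIM('v) \<Longrightarrow> g i = h i) \<Longrightarrow> frame g \<longleftrightarrow> frame (h :: nat \<Rightarrow> 'v::euclidean_space)"
proof -
  assume eq: "\<And>i. i < DIM('v) \<Longrightarrow> g i = h i"
  then have "g ` {..<DIM('v)} = h ` {..<DIM('v)}" by (intro image_cong) auto
  moreover have "inj_on g {..<DIM('v)} \<longleftrightarrow> inj_on h {..<DIM('v)}" using eq by (intro inj_on_cong) auto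
  ultimately show ?thesis unfolding frame_def by simp
qed

lemma adapted_basis_flags:
  fixes es :: "'v::euclidean_space list"
  assumes es: "ordered_basis es" and F: "is_flag F" and K: "is_flag K"
    and mem: "\<forall>k\<in>{1..DIM('v)}. es ! (k - 1) \<in> F (DIM('v) - k + 1) \<inter> K k"
  shows "F = final_flag ((!) es)" "K = initial_flag ((!) es)"
proof -
  have m: "es ! i \<in> F (DIM('v) - i)" "es ! i \<in> K (Suc i)" if "i < DIM('v)" for i
    using mem[rule_format, of "Suc i"] that by (auto simp: Suc_diff_Suc)
  show "F = final_flag ((!) es)" by (rule flag_eq_final_flag[OF F ordered_basis_frame[OF es] m(1)])
  show "K = initial_flag ((!) es)" by (rule flag_eq_initial_flag[OF K ordered_basis_frame[OF es] m(2)])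
qed

lemma flag_act_final_flag:
  fixes e :: "nat \<Rightarrow> 'v::euclidean_space"
  assumes "linear f" "frame e" "\<And>j. j < DIM('v) \<Longrightarrow> f (e j) = p j"
  shows "flag_act (pgl_class f) (final_flag e) = final_flag p"
  unfolding flag_act_pgl_class[OF assms(1) is_flag_final_flag[OF assms(2)]] final_flag_image[OF assms(1), symmetric]
  by (rule final_flag_cong) (use assms(3) in simp)

lemma positive_triple_final_flag:
  fixes F H K :: "'v::euclidean_space flag"
  assumes "positive_tuple [F, H, K]"
  obtains e U where "frame e" "tp_unipotent DIM('v) U" "F = final_flag e" "K = initial_flag e" "H = final_flag (comb e U)"
proof -
  obtain es us where es: "ordered_basis es" and len: "length us = 1"
    and flags: "is_flag F" "is_flag K" and us: "set us \<subseteq> U_pos es"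
    and mem: "\<forall>k\<in>{1..DIM('v)}. es ! (k - 1) \<in> F (DIM('v) - k + 1) \<inter> K k"
    and nth: "\<forall>i\<le>length us. [F, H, K] ! i = flag_act (list_prod PGL (take i us)) F"
    using assms unfolding positive_tuple_def by auto
  obtain u where u: "us = [u]" using len by (auto simp: length_Suc_conv)
  let ?e = "(!) es"
  note fl = adapted_basis_flags[OF es flags mem]
  have e: "frame ?e" by (rule ordered_basis_frame[OF es])
  have "u \<in> U_pos es" using us u by simp
  then obtain f U where f: "u = pgl_class f" "linear f" "bij f" "tp_unipotent DIM('v) U"
      "\<forall>j<DIM('v). f (es ! j) = comb ?e U j"
    by (metis U_posD[OF es])
  have "H = flag_act (list_prod PGL [u]) F" using nth[rule_format, of 1] u by simp
  also have "\<dots> = flag_act (pgl_class f) (final_flag ?e)" unfolding f(1) list_prod_PGL_singleton[OF f(2)] fl(1)[symmetric] ..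
  also have "\<dots> = final_flag (comb ?e U)" by (rule flag_act_final_flag[OF f(2) e f(5)[rule_format]])
  finally show ?thesis using that e f(4) fl by blast
qed

lemma comp_frame_comb:
  fixes e :: "nat \<Rightarrow> 'v::euclidean_space"
  assumes f: "linear f" "\<And>j. j < DIM('v) \<Longrightarrow> f (e j) = comb e U j"
    and h: "\<And>j. j < DIM('v) \<Longrightarrow> h (e j) = comb e W j" and j: "j < DIM('v)"
  shows "(f \<circ> h) (e j) = comb e (mprod DIM('v) U W) j"
proof -
  have "(f \<circ> h) (e j) = comb (f \<circ> e) W j" using h[OF j] linear_comb[OF f(1)] by simp
  also have "comb (f \<circ> e) W = comb (comb e U) W" by (rule comb_cong_frame) (use f(2) in simp)
  finally show ?thesis unfolding comb_comb .
qed

text \<open>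
  In coordinates given by the adapted basis, the last flag is the standard flag and the first one is
  the opposite flag; the action of a unipotent element on the latter is read off from the last columns
  of its matrix.
\<close>

lemma positive_quadruple_iff:
  fixes F G H K :: "'v::euclidean_space flag"
  shows "positive_tuple [F, G, H, K] \<longleftrightarrow>
    (\<exists>e U W. frame e \<and> tp_unipotent DIM('v) U \<and> tp_unipotent DIM('v) W \<and> F = final_flag e \<and> K = initial_flag e \<and>
       G = final_flag (comb e U) \<and> H = final_flag (comb e (mprod DIM('v) U W)))" (is "?L \<longleftrightarrow> ?R")
proof
  assume ?L
  then have flags: "is_flag F" "is_flag K" by (auto simp: positive_tuple_def)
  obtain es us where es: "ordered_basis es" and us: "set us \<subseteq> U_pos es"
    and len': "length us = length [F, G, H, K] - 2"
    and mem': "\<forall>k\<in>{1..DIM('v)}. es ! (k - 1) \<in> hd [F, G, H, K] (DIM('v) - k + 1) \<inter> last [F, G, H, K] k"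
    and nth': "\<forall>i\<le>length us. [F, G, H, K] ! i = flag_act (list_prod PGL (take i us)) (hd [F, G, H, K])"
    using \<open>?L\<close> unfolding positive_tuple_def by blast
  have len: "length us = 2" using len' by simp
  have mem: "\<forall>k\<in>{1..DIM('v)}. es ! (k - 1) \<in> F (DIM('v) - k + 1) \<inter> K k" using mem' by simp
  have nth: "\<forall>i\<le>length us. [F, G, H, K] ! i = flag_act (list_prod PGL (take i us)) F"
    using nth' by simp
  obtain u w where u: "us = [u, w]" using len by (auto simp: length_Suc_conv numeral_2_eq_2)
  let ?e = "(!) es"
  note fl = adapted_basis_flags[OF es flags mem]
  have e: "frame ?e" by (rule ordered_basis_frame[OF es])
  have "u \<in> U_pos es" using us u by simp
  then obtain f U where f: "u = pgl_class f" "linear f" "bij f" "tp_unipotent DIM('v) U"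
      "\<forall>j<DIM('v). f (es ! j) = comb ?e U j"
    by (metis U_posD[OF es])
  have "w \<in> U_pos es" using us u by simp
  then obtain h W where h: "w = pgl_class h" "linear h" "bij h" "tp_unipotent DIM('v) W"
      "\<forall>j<DIM('v). h (es ! j) = comb ?e W j"
    by (metis U_posD[OF es])
  have "G = flag_act (list_prod PGL [u]) F" using nth[rule_format, of 1] u by simp
  also have "\<dots> = flag_act (pgl_class f) (final_flag ?e)" unfolding f(1) list_prod_PGL_singleton[OF f(2)] fl(1)[symmetric] ..
  also have "\<dots> = final_flag (comb ?e U)" by (rule flag_act_final_flag[OF f(2) e f(5)[rule_format]])
  finally have G: "G = final_flag (comb ?e U)" .
  have "H = flag_act (list_prod PGL [u, w]) F" using nth[rule_format, of 2] u by simp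
  also have "\<dots> = flag_act (pgl_class (f \<circ> h)) (final_flag ?e)" unfolding f(1) h(1) list_prod_PGL_pair[OF f(2) h(2)] fl(1)[symmetric] ..
  also have "\<dots> = final_flag (comb ?e (mprod DIM('v) U W))"
    by (rule flag_act_final_flag[OF linear_compose[OF h(2) f(2)] e]) (rule comp_frame_comb[OF f(2) f(5)[rule_format] h(5)[rule_format]])
  finally show ?R using e f(4) h(4) fl G by blast
next
  assume ?R
  then obtain e0 U W where e0: "frame e0" and U: "tp_unipotent DIM('v) U" and W: "tp_unipotent DIM('v) W"
    and fl0: "F = final_flag e0" "K = initial_flag e0" "G = final_flag (comb e0 U)"
      "H = final_flag (comb e0 (mprod DIM('v) U W))" by blast
  define es where "es = map e0 [0..<DIM('v)]"
  have es: "ordered_basis es" unfolding es_def by (rule frame_ordered_basis[OF e0])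
  let ?e = "(!) es"
  have e: "frame ?e" by (rule ordered_basis_frame[OF es])
  have eq: "e0 i = ?e i" if "i < DIM('v)" for i using that by (simp add: es_def)
  have fl: "F = final_flag ?e" "K = initial_flag ?e" "G = final_flag (comb ?e U)" "H = final_flag (comb ?e (mprod DIM('v) U W))"
    unfolding fl0 by (simp_all add: final_flag_cong[OF eq] initial_flag_cong[OF eq] comb_cong_frame[OF eq])
  obtain f where f: "linear f" "pgl_class f \<in> U_pos es" "\<forall>j<DIM('v). f (es ! j) = comb ?e U j"
    by (metis U_posI[OF es U])
  obtain h where h: "linear h" "pgl_class h \<in> U_pos es" "\<forall>j<DIM('v). h (es ! j) = comb ?e W j"
    by (metis U_posI[OF es W])
  have fU: "frame (comb ?e U)" using frame_tp_upper[OF e] U by (simp add: tp_unipotent_def)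
  have fUW: "frame (comb ?e (mprod DIM('v) U W))"
    unfolding comb_comb[symmetric] using frame_tp_upper[OF fU] W by (simp add: tp_unipotent_def)
  have "final_flag ?e k \<inter> initial_flag ?e (DIM('v) - k) = {0}" if "k \<le> DIM('v)" for k
  proof
    show "{0} \<subseteq> final_flag ?e k \<inter> initial_flag ?e (DIM('v) - k)"
      unfolding final_flag_def initial_flag_def by (simp add: span_zero)
    show "final_flag ?e k \<inter> initial_flag ?e (DIM('v) - k) \<subseteq> {0}"
    proof
      fix v assume "v \<in> final_flag ?e k \<inter> initial_flag ?e (DIM('v) - k)"
      then have "coord ?e v i = 0" if "i < DIM('v)" for i
        using that unfolding Int_iff final_flag_coord[OF e] initial_flag_coord[OF e] by (cases "i < DIM('v) - k") auto
      then show "v \<in> {0}" using frame_expand[OF e, of v] by simp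
    qed
  qed
  then have tr: "transverse F K" unfolding transverse_def fl by blast
  have mem: "\<forall>k\<in>{1..DIM('v)}. es ! (k - 1) \<in> F (DIM('v) - k + 1) \<inter> K k"
    unfolding fl by (auto intro!: frame_in_final_flag frame_in_initial_flag)
  have nth: "[F, G, H, K] ! i = flag_act (list_prod PGL (take i [pgl_class f, pgl_class h])) F" if "i \<le> 2" for i
  proof -
    have 0: "F = flag_act (list_prod PGL []) F"
      using flag_act_final_flag[OF linear_id e, of ?e] by (simp add: list_prod_def one_PGL fl)
    have 1: "G = flag_act (list_prod PGL [pgl_class f]) F"
      using flag_act_final_flag[OF f(1) e f(3)[rule_format]] by (simp add: list_prod_PGL_singleton[OF f(1)] fl)
    have 2: "H = flag_act (list_prod PGL [pgl_class f, pgl_class h]) F"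
      unfolding list_prod_PGL_pair[OF f(1) h(1)] fl
      by (rule flag_act_final_flag[OF linear_compose[OF h(1) f(1)] e, symmetric])
        (rule comp_frame_comb[OF f(1) f(3)[rule_format] h(3)[rule_format]])
    have "i = 0 \<or> i = 1 \<or> i = 2" using that by presburger
    then consider "i = 0" | "i = 1" | "i = 2" by blast
    then show ?thesis using 0 1 2 by cases (simp_all add: numeral_2_eq_2)
  qed
  have flags: "is_flag F" "is_flag G" "is_flag H" "is_flag K"
    unfolding fl using is_flag_final_flag is_flag_initial_flag e fU fUW by auto
  show ?L
    unfolding positive_tuple_def
  proof (intro conjI exI[of _ es] exI[of _ "[pgl_class f, pgl_class h]"] allI impI)
    show "\<forall>k\<in>{1..DIM('v)}. es ! (k - 1) \<in> hd [F, G, H, K] (DIM('v) - k + 1) \<inter> last [F, G, H, K] k"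
      using mem by simp
    fix i assume "i \<le> length [pgl_class f, pgl_class h]"
    then have "i \<le> 2" by simp
    then show "[F, G, H, K] ! i = flag_act (list_prod PGL (take i [pgl_class f, pgl_class h])) (hd [F, G, H, K])"
      unfolding list.sel(1) by (rule nth)
  qed (use flags tr es f(2) h(2) in auto)
qed

lemma frame_tp_lower:
  "frame g \<Longrightarrow> tp_lower DIM('v) L \<Longrightarrow> frame (comb (g :: nat \<Rightarrow> 'v::euclidean_space) L)"
  using frame_comb[of g L] tp_lower_pos[OF _ incr_initial[OF order_refl] incr_initial[OF order_refl], of "DIM('v)" L]
  by (metis less_irrefl order_refl)

lemma frame_flip:
  fixes g :: "nat \<Rightarrow> 'v::euclidean_space"
  assumes g: "frame g" and U: "tp_upper DIM('v) U" shows "frame (comb g (flip DIM('v) U))"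
proof (rule frame_comb[OF g])
  have "mdet (flip DIM('v) U) DIM('v) (\<lambda>i. i) (\<lambda>i. i) = mdet U DIM('v) (\<lambda>i. i) (\<lambda>i. i)"
    by (subst mdet_flip) (auto intro: mdet_cong)
  then show "mdet (flip DIM('v) U) DIM('v) (\<lambda>i. i) (\<lambda>i. i) \<noteq> 0" using mdet_tp_upper_nonzero[OF U] by simp
qed

text \<open>
  Flipping \<open>U\<close> turns its flag into one spanned by first columns, and column operations that do not
  change this flag clear the entries above the diagonal. The resulting frame is adapted both to
  \<open>final_flag g\<close> and to the flag of \<open>U\<close>.
\<close>

lemma lower_factor_flags:
  fixes g :: "nat \<Rightarrow> 'v::euclidean_space"
  assumes g: "frame g" and U: "tp_upper DIM('v) U"
  obtains L where "tp_lower DIM('v) L" "frame (comb g L)" "final_flag (comb g L) = final_flag g"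
    "initial_flag (comb g L) = final_flag (comb g U)"
proof -
  obtain N where N: "upper_tri DIM('v) N" "tp_lower DIM('v) (mprod DIM('v) (flip DIM('v) U) N)"
    using lower_factor[OF U] by blast
  let ?L = "mprod DIM('v) (flip DIM('v) U) N"
  have fL: "frame (comb g ?L)" by (rule frame_tp_lower[OF g N(2)])
  have fU: "frame (comb g U)" by (rule frame_tp_upper[OF g U])
  have ff: "frame (comb g (flip DIM('v) U))" by (rule frame_flip[OF g U])
  have "initial_flag (comb g ?L) = initial_flag (comb g (flip DIM('v) U))"
    unfolding comb_comb[symmetric]
    by (rule initial_flag_comb[OF ff _ N(1)]) (use fL in \<open>simp add: comb_comb\<close>)
  also have "\<dots> = final_flag (comb g U)" by (rule final_flag_eq_initial_flag_flip[OF fU ff, symmetric])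
  finally have "initial_flag (comb g ?L) = final_flag (comb g U)" .
  moreover have "final_flag (comb g ?L) = final_flag g"
    by (rule final_flag_comb[OF g fL]) (use N(2) in \<open>simp add: tp_lower_def\<close>)
  ultimately show ?thesis using that N(2) fL by blast
qed

text \<open>
  If the two middle flags are given by \<open>U\<close> and \<open>U W\<close>, replace \<open>W\<close> by the lower triangular \<open>L\<close> of
  \<open>lower_factor_flags\<close>. Then both flags are read off from the one matrix \<open>U L\<close>, and this product is
  totally positive.
\<close>

lemma positive_quadruple_tp:
  fixes F G H K :: "'v::euclidean_space flag"
  assumes "positive_tuple [F, G, H, K]"
  obtains e A where "frame e" "F = final_flag e" "K = initial_flag e" "tp DIM('v) A" "frame (comb e A)"
    "G = final_flag (comb e A)" "H = initial_flag (comb e A)"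
proof -
  obtain e U W where e: "frame e" and U: "tp_upper DIM('v) U" and W: "tp_upper DIM('v) W"
    and fl: "F = final_flag e" "K = initial_flag e" "G = final_flag (comb e U)" "H = final_flag (comb (comb e U) W)"
    using assms unfolding positive_quadruple_iff tp_unipotent_def comb_comb by blast
  have p: "frame (comb e U)" by (rule frame_tp_upper[OF e U])
  obtain L where L: "tp_lower DIM('v) L" "frame (comb (comb e U) L)"
    "final_flag (comb (comb e U) L) = final_flag (comb e U)" "initial_flag (comb (comb e U) L) = final_flag (comb (comb e U) W)"
    by (metis lower_factor_flags[OF p W])
  have "tp DIM('v) (mprod DIM('v) U L)" by (rule tp_mprod_upper_lower[OF U L(1)])
  then show ?thesis using that[of e "mprod DIM('v) U L"] e fl L unfolding comb_comb by simp
qed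

section \<open>Intervals of flags and cones of lines\<close>

lemma comb_eqD:
  fixes e :: "nat \<Rightarrow> 'v::euclidean_space"
  assumes "frame e" "comb e A j = comb e B k" "i < DIM('v)" shows "A i j = B i k"
  using assms(2) coord_comb[OF assms(1,3)] by metis

text \<open>
  The last rows of \<open>A = U L\<close> involve only the last rows of \<open>L\<close>, so the corresponding minors of \<open>A\<close>
  and of \<open>L\<close> differ by a positive factor, a minor of \<open>U\<close>.
\<close>

lemma tp_lower_of_upper_quotient:
  assumes A: "tp n A" and U: "tp_upper n U" and L: "lower_tri n L"
    and eq: "\<And>i j. i < n \<Longrightarrow> j < n \<Longrightarrow> A i j = mprod n U L i j"
  shows "tp_lower n L"
proof (rule tp_lowerI'[OF L])
  fix k c assume c: "incr k n c"
  have k: "k \<le> n" by (rule incr_le[OF c])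
  have "mdet A k (\<lambda>s. n - k + s) c = mdet (mprod n U L) k (\<lambda>s. n - k + s) c"
    by (rule mdet_cong, rule eq) (use incr_less[OF c] k in auto)
  also have "\<dots> = mdet U k (\<lambda>s. n - k + s) (\<lambda>s. n - k + s) * mdet L k (\<lambda>s. n - k + s) c"
    by (rule mdet_mprod_upper_tri_final[OF _ k]) (use U in \<open>simp add: tp_upper_def\<close>)
  finally have eq: "mdet A k (\<lambda>s. n - k + s) c =
    mdet U k (\<lambda>s. n - k + s) (\<lambda>s. n - k + s) * mdet L k (\<lambda>s. n - k + s) c" .
  have "0 < mdet A k (\<lambda>s. n - k + s) c"
    using A incr_final[OF k] c unfolding tp_def by blast
  moreover have "0 < mdet U k (\<lambda>s. n - k + s) (\<lambda>s. n - k + s)"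
    by (rule tp_upper_pos[OF U incr_final[OF k] incr_final[OF k]]) simp
  ultimately show "0 < mdet L k (\<lambda>s. n - k + s) c"
    unfolding eq by (simp add: zero_less_mult_iff)
qed

lemma upper_factor_flags:
  fixes g :: "nat \<Rightarrow> 'v::euclidean_space"
  assumes g: "frame g" and M: "\<And>k r. incr k DIM('v) r \<Longrightarrow> 0 < mdet M k r (\<lambda>s. DIM('v) - k + s)"
  obtains U where "tp_unipotent DIM('v) U" "frame (comb g M)" "frame (comb g U)" "final_flag (comb g U) = final_flag (comb g M)"
proof -
  obtain N where N: "lower_tri DIM('v) N" "tp_upper DIM('v) (mprod DIM('v) M N)"
    "\<forall>i<DIM('v). mprod DIM('v) M N i i = 1"
    using upper_factor[of "DIM('v)" M, OF M] by blast
  let ?U = "mprod DIM('v) M N"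
  have fU: "frame (comb g ?U)" by (rule frame_tp_upper[OF g N(2)])
  have "0 < mdet M DIM('v) (\<lambda>i. i) (\<lambda>s. DIM('v) - DIM('v) + s)"
    by (rule M[OF incr_initial]) simp
  then have fM: "frame (comb g M)" by (intro frame_comb[OF g]) simp
  have "final_flag (comb g ?U) = final_flag (comb g M)"
    unfolding comb_comb[symmetric]
    by (rule final_flag_comb[OF fM _ N(1)]) (use fU in \<open>simp add: comb_comb\<close>)
  then show ?thesis using that fU fM N by (auto simp: tp_unipotent_def)
qed

text \<open>
  The converse of \<open>lower_factor_flags\<close>: undo the flip and apply \<open>upper_factor\<close>.
\<close>

lemma lower_frame_to_upper:
  fixes g :: "nat \<Rightarrow> 'v::euclidean_space"
  assumes g: "frame g" and L: "tp_lower DIM('v) L"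
  obtains V where "tp_unipotent DIM('v) V" "final_flag (comb g V) = initial_flag (comb g L)"
proof -
  let ?n = "DIM('v)"
  \<comment> \<open>The preimage of \<open>L\<close> under \<open>flip\<close>.\<close>
  define W where "W = (\<lambda>i j. L i (?n - 1 - j) * flip_sign (?n - 1 - j))"
  have fW: "flip ?n W i j = L i j" if "j < ?n" for i j
    using that flip_sign_square[of j] by (simp add: flip_def W_def mult.assoc)
  have "0 < mdet W k r (\<lambda>s. ?n - k + s)" if r: "incr k ?n r" for k r
  proof -
    have k: "k \<le> ?n" by (rule incr_le[OF r])
    have "mdet W k r (\<lambda>s. ?n - k + s) = mdet (flip ?n W) k r (\<lambda>s. s)"
      by (rule mdet_flip[OF k, symmetric])
    also have "\<dots> = mdet L k r (\<lambda>s. s)" by (rule mdet_cong, rule fW) (use k in auto)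
    also have "\<dots> > 0" by (rule tp_lower_pos[OF L r incr_initial[OF k]]) (rule incr_ge[OF r])
    finally show ?thesis .
  qed
  then obtain V where V: "tp_unipotent ?n V" "frame (comb g W)" "final_flag (comb g V) = final_flag (comb g W)"
    by (metis upper_factor_flags[OF g])
  have eq: "comb g (flip ?n W) j = comb g L j" if "j < ?n" for j
    by (rule comb_cong) (use fW that in auto)
  have "frame (comb g (flip ?n W))"
    using frame_tp_lower[OF g L] frame_cong[of "comb g (flip ?n W)" "comb g L"] eq by blast
  then have "final_flag (comb g W) = initial_flag (comb g (flip ?n W))"
    by (rule final_flag_eq_initial_flag_flip[OF V(2)])
  also have "\<dots> = initial_flag (comb g L)" by (rule initial_flag_cong) (rule eq)
  finally show ?thesis using that V by simp
qed

text \<open>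
  Conjugating \<open>U\<close> by a positive diagonal matrix keeps it totally positive and gives its last column
  any prescribed positive direction; call the result \<open>T\<close>. The flag \<open>G\<close> spanned by the last columns
  of \<open>L T\<close> contains the required line. The product \<open>L T\<close> is totally positive, hence \<open>L T = W Q\<close> with
  \<open>W\<close> upper unipotent and \<open>Q\<close> lower triangular, both totally positive. Here \<open>W\<close> moves the first flag to
  \<open>G\<close>, and \<open>Q\<close>, rewritten as an upper unipotent \<open>V\<close>, moves \<open>G\<close> on to \<open>initial_flag g\<close>.
\<close>

lemma interval_reaches_cone:
  fixes e :: "nat \<Rightarrow> 'v::euclidean_space"
  assumes e: "frame e" and L: "tp_lower DIM('v) L" and U: "tp_unipotent DIM('v) U"
    and x: "\<forall>i<DIM('v). 0 < x i"
  defines "g \<equiv> comb e L"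
  shows "\<exists>G\<in>flag_interval (final_flag e) (initial_flag g) (initial_flag e). (\<Sum>i<DIM('v). x i *\<^sub>R g i) \<in> G 1"
proof -
  let ?n = "DIM('v)"
  have g: "frame g" unfolding g_def by (rule frame_tp_lower[OF e L])
  have Upos: "0 < U i (?n - 1)" if "i < ?n" for i
  proof -
    have "0 < mdet U (Suc 0) (\<lambda>_. i) (\<lambda>_. ?n - 1)"
      by (rule tp_upper_pos[of ?n]) (use U that in \<open>auto simp: tp_unipotent_def incr_def\<close>)
    then show ?thesis by (simp add: mdet_1)
  qed
  define d where "d = (\<lambda>i. x i / U i (?n - 1))"
  have d: "0 < d i" if "i < ?n" for i using x Upos[OF that] that by (simp add: d_def)
  define T where "T = (\<lambda>i j. d i * U i j * (1 / d j))"
  have T: "tp_upper ?n T"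
  proof -
    have "0 < mdet T m r c" if r: "incr m ?n r" and c: "incr m ?n c" and le: "\<forall>i<m. r i \<le> c i" for m r c
    proof -
      have "0 < mdet U m r c" using U r c le by (auto simp: tp_unipotent_def tp_upper_def)
      then show ?thesis
        unfolding T_def mdet_scale using d incr_less[OF r] incr_less[OF c]
        by (auto intro!: mult_pos_pos prod_pos)
    qed
    moreover have "upper_tri ?n T" using U by (auto simp: tp_unipotent_def tp_upper_def upper_tri_def T_def)
    ultimately show ?thesis unfolding tp_upper_def by blast
  qed
  let ?a = "comb g T"
  have a: "frame ?a" by (rule frame_tp_upper[OF g T])
  have n1: "?n - 1 < ?n" by simp
  have last: "?a (?n - 1) = (1 / d (?n - 1)) *\<^sub>R (\<Sum>i<?n. x i *\<^sub>R g i)"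
    unfolding comb_def scaleR_sum_right
    by (rule sum.cong) (use Upos in \<open>force simp: T_def d_def\<close>)+
  have "?a (?n - 1) \<in> final_flag ?a 1" by (rule frame_in_final_flag) auto
  then have "d (?n - 1) *\<^sub>R ?a (?n - 1) \<in> final_flag ?a 1" unfolding final_flag_def by (rule span_scale)
  moreover have "d (?n - 1) *\<^sub>R ?a (?n - 1) = (\<Sum>i<?n. x i *\<^sub>R g i)"
    unfolding last using d[OF n1] by simp
  ultimately have mem: "(\<Sum>i<?n. x i *\<^sub>R g i) \<in> final_flag ?a 1" by (simp only:)
  let ?A = "mprod ?n L T"
  have aA: "?a = comb e ?A" unfolding g_def comb_comb ..
  have A: "tp ?n ?A" by (rule tp_mprod_lower_upper[OF L T])
  have "0 < mdet ?A k r (\<lambda>s. ?n - k + s)" if r: "incr k ?n r" for k r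
    using A r incr_final[OF incr_le[OF r]] unfolding tp_def by blast
  then obtain W where W: "tp_unipotent ?n W" "frame (comb e W)" "final_flag (comb e W) = final_flag ?a"
    unfolding aA by (metis upper_factor_flags[OF e])
  let ?p = "comb e W"
  define Q where "Q = (\<lambda>i j. coord ?p (?a j) i)"
  have aQ: "?a = comb ?p Q" unfolding Q_def by (rule comb_coord[OF W(2), symmetric])
  have Q: "lower_tri ?n Q" unfolding Q_def by (rule final_flag_eqD[OF W(2) W(3)[symmetric]])
  have "tp_lower ?n Q"
  proof (rule tp_lower_of_upper_quotient[OF A _ Q])
    show "tp_upper ?n W" using W(1) by (simp add: tp_unipotent_def)
    show "?A i j = mprod ?n W Q i j" if "i < ?n" for i j
      by (rule comb_eqD[OF e _ that]) (use aA aQ in \<open>simp add: comb_comb\<close>)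
  qed
  then obtain V where V: "tp_unipotent ?n V" "final_flag (comb ?p V) = initial_flag (comb ?p Q)"
    by (metis lower_frame_to_upper[OF W(2)])
  have "initial_flag g = initial_flag ?a"
    by (rule initial_flag_comb[OF g a, symmetric]) (use T in \<open>simp add: tp_upper_def\<close>)
  then have "initial_flag g = final_flag (comb e (mprod ?n W V))"
    using V(2) aQ by (simp add: comb_comb)
  then have "positive_tuple [final_flag e, final_flag ?a, initial_flag g, initial_flag e]"
    unfolding positive_quadruple_iff using e W V(1) by metis
  then have "final_flag ?a \<in> flag_interval (final_flag e) (initial_flag g) (initial_flag e)"
    unfolding flag_interval_def using is_flag_final_flag[OF a] by simp
  then show ?thesis using mem by blast
qed

text \<open>
  Let \<open>e'\<close> be a basis that witnesses the positivity of the quadruple, \<open>A\<close> the totally positive matrix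
  of \<open>positive_quadruple_tp\<close> with respect to it, and \<open>N\<close> the matrix of the same frame with respect to
  \<open>g\<close>. The line of \<open>G\<close> is spanned by the last column of \<open>N\<close>. The bases \<open>e'\<close> and \<open>e\<close> differ by a
  diagonal matrix \<open>c\<close>, so \<open>c A = L N\<close> with \<open>L\<close> lower and \<open>N\<close> upper triangular, and quotients of
  minors of \<open>A\<close> in the first rows show that the entry of row \<open>k\<close> in the last column of \<open>N\<close> has the sign
  of \<open>c k\<close>. These signs agree, because the first columns of \<open>A\<close> and of \<open>L\<close> are positive and span the
  same line, that of \<open>initial_flag g\<close>.
\<close>

lemma interval_inside_cone:
  fixes e :: "nat \<Rightarrow> 'v::euclidean_space"
  assumes e: "frame e" and L: "tp_lower DIM('v) L"
  defines "g \<equiv> comb e L"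
  assumes G: "G \<in> flag_interval (final_flag e) (initial_flag g) (initial_flag e)" and v: "v \<in> G 1" "v \<noteq> 0"
  shows "(\<forall>i<DIM('v). 0 < coord g v i) \<or> (\<forall>i<DIM('v). coord g v i < 0)"
proof -
  let ?n = "DIM('v)"
  have n: "0 < ?n" by simp
  have g: "frame g" unfolding g_def by (rule frame_tp_lower[OF e L])
  obtain e' A where e': "frame e'" "final_flag e = final_flag e'" "initial_flag e = initial_flag e'" and A: "tp ?n A"
    and a: "frame (comb e' A)" "G = final_flag (comb e' A)" "initial_flag g = initial_flag (comb e' A)"
    using G unfolding flag_interval_def mem_Collect_eq by (metis positive_quadruple_tp)
  let ?a = "comb e' A"
  obtain c where c: "\<And>j. j < ?n \<Longrightarrow> e' j = c j *\<^sub>R e j" "\<And>j. j < ?n \<Longrightarrow> c j \<noteq> 0"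
    by (rule adapted_frames[OF e e'(1)]) (use e' in auto)
  define N where "N = (\<lambda>i j. coord g (?a j) i)"
  have aN: "?a = comb g N" unfolding N_def by (rule comb_coord[OF g, symmetric])
  have N: "upper_tri ?n N" unfolding N_def by (rule initial_flag_eqD[OF g a(3)[symmetric]])
  have cA: "c i * A i j = mprod ?n L N i j" if "i < ?n" for i j
  proof (rule comb_eqD[OF e _ that])
    have "comb e (\<lambda>i j. c i * A i j) j = comb e' A j"
      unfolding comb_def by (rule sum.cong) (use c(1) in auto)
    then show "comb e (\<lambda>i j. c i * A i j) j = comb e (mprod ?n L N) j"
      unfolding aN by (simp add: g_def comb_comb)
  qed
  have minors: "(\<Prod>i<k. c i) * mdet A k (\<lambda>i. i) q = mdet L k (\<lambda>i. i) (\<lambda>i. i) * mdet N k (\<lambda>i. i) q"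
    if k: "k \<le> ?n" for k q
  proof -
    have "(\<Prod>i<k. c i) * mdet A k (\<lambda>i. i) q = mdet (\<lambda>i j. c i * A i j * 1) k (\<lambda>i. i) q"
      by (subst mdet_scale) simp
    also have "\<dots> = mdet (mprod ?n L N) k (\<lambda>i. i) q"
      by (rule mdet_cong) (use cA k in auto)
    also have "\<dots> = mdet L k (\<lambda>i. i) (\<lambda>i. i) * mdet N k (\<lambda>i. i) q"
      by (rule mdet_mprod_lower_tri_initial[OF _ k]) (use L in \<open>simp add: tp_lower_def\<close>)
    finally show ?thesis .
  qed
  have Lpos: "0 < mdet L k (\<lambda>i. i) (\<lambda>i. i)" if "k \<le> ?n" for k
    by (rule tp_lower_pos[OF L incr_initial[OF that] incr_initial[OF that]]) simp
  have Apos: "0 < mdet A k (\<lambda>i. i) q" if "incr k ?n q" for k q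
    using A incr_initial[OF incr_le[OF that]] that unfolding tp_def by blast
  have sgnN: "0 < c k * N k (?n - 1)" if k: "k < ?n" for k
  proof -
    \<comment> \<open>Replacing the last of the first \<open>k + 1\<close> columns by the final column isolates the entry
       \<open>N k (?n - 1)\<close>.\<close>
    define q where "q = (\<lambda>i. if i = k then ?n - 1 else i)"
    have q: "incr (Suc k) ?n q" using k by (auto simp: incr_def q_def)
    have "(\<Prod>i<k. c i) * mdet A k (\<lambda>i. i) (\<lambda>i. i) = mdet L k (\<lambda>i. i) (\<lambda>i. i) * (\<Prod>i<k. N i i)"
      using minors[of k "\<lambda>i. i"] mdet_upper_tri_initial[OF N, of k] k by simp
    then obtain \<alpha> where \<alpha>: "0 < \<alpha>" "(\<Prod>i<k. N i i) = \<alpha> * (\<Prod>i<k. c i)"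
      using Lpos[of k] Apos[OF incr_initial, of k] k
      by (intro that[of "mdet A k (\<lambda>i. i) (\<lambda>i. i) / mdet L k (\<lambda>i. i) (\<lambda>i. i)"])
        (auto simp: field_simps)
    have "mdet N (Suc k) (\<lambda>i. i) q = (\<Prod>i<Suc k. N i (q i))"
      by (rule mdet_upper_triangular) (use N k in \<open>auto simp: upper_tri_def q_def\<close>)
    also have "\<dots> = (\<Prod>i<k. N i i) * N k (?n - 1)" by (simp add: q_def)
    finally have "(\<Prod>i<k. c i) * c k * mdet A (Suc k) (\<lambda>i. i) q =
      mdet L (Suc k) (\<lambda>i. i) (\<lambda>i. i) * (\<alpha> * (\<Prod>i<k. c i) * N k (?n - 1))"
      using minors[of "Suc k" q] \<alpha>(2) k by simp
    moreover have "(\<Prod>i<k. c i) \<noteq> 0" using c(2) k by simp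
    ultimately have "c k * mdet A (Suc k) (\<lambda>i. i) q =
      mdet L (Suc k) (\<lambda>i. i) (\<lambda>i. i) * \<alpha> * N k (?n - 1)" by simp
    then have eq: "c k * c k * mdet A (Suc k) (\<lambda>i. i) q =
      mdet L (Suc k) (\<lambda>i. i) (\<lambda>i. i) * \<alpha> * (c k * N k (?n - 1))" by (simp add: ac_simps)
    have "0 < c k * c k * mdet A (Suc k) (\<lambda>i. i) q"
      using Apos[OF q] c(2)[OF k] by (simp add: zero_less_mult_iff) force
    moreover have "0 < mdet L (Suc k) (\<lambda>i. i) (\<lambda>i. i) * \<alpha>" using Lpos[of "Suc k"] \<alpha>(1) k by simp
    ultimately show ?thesis unfolding eq by (rule zero_less_mult_pos)
  qed
  have sgnc: "0 < c i * N 0 0" if i: "i < ?n" for i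
  proof -
    have "c i * A i 0 = (\<Sum>k<?n. L i k * N k 0)" using cA[OF i, of 0] by (simp add: mprod_def)
    also have "\<dots> = (\<Sum>k\<in>{0}. L i k * N k 0)"
      by (rule sum.mono_neutral_right) (use N n in \<open>auto simp: upper_tri_def\<close>)
    finally have eq: "c i * A i 0 = L i 0 * N 0 0" by simp
    have "0 < mdet A (Suc 0) (\<lambda>_. i) (\<lambda>_. 0)"
      using A i n unfolding tp_def by (auto simp: incr_def)
    then have "0 < A i 0" by (simp add: mdet_1)
    moreover have "0 < mdet L (Suc 0) (\<lambda>_. i) (\<lambda>_. 0)"
      by (rule tp_lower_pos[OF L]) (use i n in \<open>auto simp: incr_def\<close>)
    then have "0 < L i 0" by (simp add: mdet_1)
    ultimately show ?thesis using eq c(2)[OF i]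
      by (metis mult.commute mult_less_0_iff mult_pos_pos mult_zero_left not_less_iff_gr_or_eq zero_less_mult_iff)
  qed
  have sgn: "0 < N 0 0 * N i (?n - 1)" if "i < ?n" for i
    using sgnc[OF that] sgnN[OF that] by (auto simp: zero_less_mult_iff)
  have "{?n - 1..<?n} = {?n - 1}" using n by auto
  then have "v \<in> span {?a (?n - 1)}" using v(1) unfolding a(2) final_flag_def by simp
  then obtain \<gamma> where \<gamma>: "v = \<gamma> *\<^sub>R ?a (?n - 1)" by (auto simp: span_singleton)
  have \<gamma>0: "\<gamma> \<noteq> 0" using v(2) \<gamma> by auto
  have co: "coord g v i = \<gamma> * N i (?n - 1)" if "i < ?n" for i
    unfolding \<gamma> N_def using linear_cmul[OF coord_linear[OF g that]] by simp
  have "0 < \<gamma> * N 0 0 * coord g v i" if "i < ?n" for i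
  proof -
    have eq: "\<gamma> * N 0 0 * coord g v i = (\<gamma> * \<gamma>) * (N 0 0 * N i (?n - 1))"
      unfolding co[OF that] by (simp add: ac_simps)
    have "0 < \<gamma> * \<gamma>" using \<gamma>0 by (simp add: zero_less_mult_iff) force
    then show ?thesis unfolding eq using sgn[OF that] by (rule mult_pos_pos)
  qed
  then show ?thesis by (cases "0 < \<gamma> * N 0 0") (auto simp: zero_less_mult_iff)
qed

lemma positive_interval_frame:
  fixes F H K :: "'v::euclidean_space flag"
  assumes "positive_tuple [F, H, K]"
  obtains g where "frame g" "F = final_flag g" "H = initial_flag g"
    "\<forall>x. (\<forall>i<DIM('v). 0 < x i) \<longrightarrow> (\<exists>G\<in>flag_interval F H K. (\<Sum>i<DIM('v). x i *\<^sub>R g i) \<in> G 1)"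
    "\<forall>G\<in>flag_interval F H K. \<forall>v\<in>G 1. v \<noteq> 0 \<longrightarrow>
       (\<forall>i<DIM('v). 0 < coord g v i) \<or> (\<forall>i<DIM('v). coord g v i < 0)"
proof -
  obtain e U where e: "frame e" and U: "tp_unipotent DIM('v) U" and fl: "F = final_flag e" "K = initial_flag e" "H = final_flag (comb e U)"
    by (rule positive_triple_final_flag[OF assms])
  have "tp_upper DIM('v) U" using U by (simp add: tp_unipotent_def)
  then obtain L where L: "tp_lower DIM('v) L" "frame (comb e L)" "final_flag (comb e L) = final_flag e"
    "initial_flag (comb e L) = final_flag (comb e U)"
    by (metis lower_factor_flags[OF e])
  show ?thesis
  proof (rule that[OF L(2)])
    show "F = final_flag (comb e L)" "H = initial_flag (comb e L)" using fl L by auto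
    show "\<forall>x. (\<forall>i<DIM('v). 0 < x i) \<longrightarrow>
        (\<exists>G\<in>flag_interval F H K. (\<Sum>i<DIM('v). x i *\<^sub>R comb e L i) \<in> G 1)"
      using interval_reaches_cone[OF e L(1) U] unfolding fl L(4) by blast
    show "\<forall>G\<in>flag_interval F H K. \<forall>v\<in>G 1. v \<noteq> 0 \<longrightarrow>
        (\<forall>i<DIM('v). 0 < coord (comb e L) v i) \<or> (\<forall>i<DIM('v). coord (comb e L) v i < 0)"
      using interval_inside_cone[OF e L(1)] unfolding fl L(4) by blast
  qed
qed

section \<open>Contraction by positive kernels\<close>

text \<open>
  For fixed rows \<open>s\<close> and \<open>s'\<close> consider the quotients \<open>P i s t / P i s' t\<close> as a function of the column
  \<open>t\<close>. Multiplication by \<open>N (i + 1)\<close> replaces them by weighted means, and since the entries of \<open>N\<close> lie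
  between \<open>a\<close> and \<open>b\<close>, all these weights are at least \<open>a / b\<close> times the weights \<open>P i s' r\<close>, normalized
  to sum one, which do not depend on the column. So all quotients move towards a common mean, and the
  oscillation shrinks by the factor \<open>1 - a / b\<close>.
\<close>

lemma doeblin_contraction:
  fixes N :: "nat \<Rightarrow> 'i \<Rightarrow> 'i \<Rightarrow> real"
  assumes fin: "finite I" and ne: "I \<noteq> {}" and a: "0 < a"
    and N: "\<And>j s t. s \<in> I \<Longrightarrow> t \<in> I \<Longrightarrow> a \<le> N j s t \<and> N j s t \<le> b"
    and P0: "\<And>s t. s \<in> I \<Longrightarrow> t \<in> I \<Longrightarrow> P 0 s t = N 0 s t"
    and PS: "\<And>i s t. s \<in> I \<Longrightarrow> t \<in> I \<Longrightarrow> P (Suc i) s t = (\<Sum>r\<in>I. P i s r * N (Suc i) r t)"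
    and s: "s \<in> I" "s' \<in> I" and t: "t \<in> I" "t' \<in> I"
  shows "\<bar>P i s t * P i s' t' - P i s t' * P i s' t\<bar> \<le> (b / a) * (1 - a / b) ^ i * (P i s' t * P i s' t')"
proof -
  have b: "0 < b" using N[OF s(1) t(1), of 0] a by linarith
  have Npos: "0 < N j s t" if "s \<in> I" "t \<in> I" for j s t using N[OF that, of j] a by linarith
  have Ppos: "0 < P i s t" if "s \<in> I" "t \<in> I" for i s t
    using that
  proof (induction i arbitrary: s t)
    case 0 then show ?case using P0 Npos by simp
  next
    case (Suc i)
    then show ?case using PS Npos fin ne by (auto intro!: sum_pos mult_pos_pos)
  qed
  have "\<exists>lo hi. (\<forall>t\<in>I. lo * P i s' t \<le> P i s t \<and> P i s t \<le> hi * P i s' t) \<and>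
     hi - lo \<le> (b / a) * (1 - a / b) ^ i"
  proof (induction i)
    case 0
    have "P 0 s t \<le> (b / a) * P 0 s' t" if "t \<in> I" for t
    proof -
      have "a * N 0 s t \<le> b * N 0 s' t"
        using N[OF s(1) that, of 0] N[OF s(2) that, of 0] a b
        by (smt (verit) mult.commute mult_mono)
      then show ?thesis using a P0 s that by (simp add: field_simps)
    qed
    then show ?case
      using Ppos[of s _ 0] s by (intro exI[of _ 0] exI[of _ "b / a"]) (auto intro: less_imp_le)
  next
    case (Suc i)
    then obtain lo hi where lh: "\<And>t. t \<in> I \<Longrightarrow> lo * P i s' t \<le> P i s t \<and> P i s t \<le> hi * P i s' t"
      and diff: "hi - lo \<le> (b / a) * (1 - a / b) ^ i" by blast
    let ?W = "\<Sum>r\<in>I. P i s' r"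
    let ?V = "\<Sum>r\<in>I. P i s r"
    have W: "0 < ?W" using Ppos s fin ne by (intro sum_pos) auto
    \<comment> \<open>The mean is \<open>?V / ?W\<close>; both bounds move towards it by the fraction \<open>a / b\<close>.\<close>
    define lo' where "lo' = lo + a * (?V - lo * ?W) / (b * ?W)"
    define hi' where "hi' = hi - a * (hi * ?W - ?V) / (b * ?W)"
    have lV: "0 \<le> ?V - lo * ?W" "0 \<le> hi * ?W - ?V"
      unfolding sum_distrib_left sum_subtractf[symmetric] using lh by (auto intro!: sum_nonneg)
    have bounds: "lo' * P (Suc i) s' t \<le> P (Suc i) s t \<and> P (Suc i) s t \<le> hi' * P (Suc i) s' t"
      if t: "t \<in> I" for t
    proof -
      let ?N = "\<lambda>r. N (Suc i) r t"
      have P': "P (Suc i) s t = (\<Sum>r\<in>I. P i s r * ?N r)" "P (Suc i) s' t = (\<Sum>r\<in>I. P i s' r * ?N r)"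
        using PS s t by auto
      have le: "P (Suc i) s' t \<le> b * ?W"
        unfolding P' sum_distrib_left
        using N[OF _ t] Ppos[OF s(2)] by (intro sum_mono) (auto simp: mult.commute intro!: mult_right_mono less_imp_le)
      have "a * (?V - lo * ?W) = (\<Sum>r\<in>I. (P i s r - lo * P i s' r) * a)"
        by (simp add: sum_subtractf sum_distrib_left sum_distrib_right algebra_simps)
      also have "\<dots> \<le> (\<Sum>r\<in>I. (P i s r - lo * P i s' r) * ?N r)"
        using N[OF _ t] lh by (intro sum_mono mult_left_mono) auto
      also have "\<dots> = P (Suc i) s t - lo * P (Suc i) s' t"
        unfolding P' by (simp add: sum_subtractf sum_distrib_left algebra_simps)
      finally have 1: "a * (?V - lo * ?W) \<le> P (Suc i) s t - lo * P (Suc i) s' t" .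
      have "a * (hi * ?W - ?V) = (\<Sum>r\<in>I. (hi * P i s' r - P i s r) * a)"
        by (simp add: sum_subtractf sum_distrib_left sum_distrib_right algebra_simps)
      also have "\<dots> \<le> (\<Sum>r\<in>I. (hi * P i s' r - P i s r) * ?N r)"
        using N[OF _ t] lh by (intro sum_mono mult_left_mono) auto
      also have "\<dots> = hi * P (Suc i) s' t - P (Suc i) s t"
        unfolding P' by (simp add: sum_subtractf sum_distrib_left algebra_simps)
      finally have 2: "a * (hi * ?W - ?V) \<le> hi * P (Suc i) s' t - P (Suc i) s t" .
      have sc: "x / (b * ?W) * P (Suc i) s' t \<le> x" if "0 \<le> x" for x
      proof -
        have "x * P (Suc i) s' t \<le> x * (b * ?W)" by (rule mult_left_mono[OF le that])
        then show ?thesis using b W by (simp add: divide_le_eq)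
      qed
      have "a * (?V - lo * ?W) / (b * ?W) * P (Suc i) s' t \<le> P (Suc i) s t - lo * P (Suc i) s' t"
        using sc[of "a * (?V - lo * ?W)"] lV a 1 by (meson mult_nonneg_nonneg less_imp_le order_trans)
      moreover have "a * (hi * ?W - ?V) / (b * ?W) * P (Suc i) s' t \<le> hi * P (Suc i) s' t - P (Suc i) s t"
        using sc[of "a * (hi * ?W - ?V)"] lV a 2 by (meson mult_nonneg_nonneg less_imp_le order_trans)
      ultimately show ?thesis unfolding lo'_def hi'_def by (simp add: distrib_right left_diff_distrib)
    qed
    have "hi' - lo' = (hi - lo) * (1 - a / b)"
    proof -
      have "a * (hi * ?W - ?V) / (b * ?W) + a * (?V - lo * ?W) / (b * ?W) = (hi - lo) * (a / b)"
        using W b by (simp add: add_divide_distrib[symmetric] field_simps)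
      then show ?thesis unfolding hi'_def lo'_def by (simp add: algebra_simps)
    qed
    also have "\<dots> \<le> (b / a) * (1 - a / b) ^ i * (1 - a / b)"
      using N[OF s(1) t(1), of 0] a b by (intro mult_right_mono diff) (simp add: divide_le_eq)
    finally have "hi' - lo' \<le> (b / a) * (1 - a / b) ^ Suc i" unfolding power_Suc2 mult.assoc .
    then show ?case using bounds by blast
  qed
  then obtain lo hi where lh: "\<And>t. t \<in> I \<Longrightarrow> lo * P i s' t \<le> P i s t \<and> P i s t \<le> hi * P i s' t"
    and diff: "hi - lo \<le> (b / a) * (1 - a / b) ^ i" by blast
  let ?x = "P i s' t" let ?y = "P i s' t'"
  have pos: "0 < ?x" "0 < ?y" using Ppos s t by auto
  have "lo * ?x * ?y \<le> P i s t * ?y" "P i s t * ?y \<le> hi * ?x * ?y"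
    "lo * ?y * ?x \<le> P i s t' * ?x" "P i s t' * ?x \<le> hi * ?y * ?x"
    using lh[OF t(1)] lh[OF t(2)] pos by (auto intro!: mult_right_mono less_imp_le)
  then have "\<bar>P i s t * ?y - P i s t' * ?x\<bar> \<le> (hi - lo) * (?x * ?y)"
    by (simp add: algebra_simps abs_le_iff)
  also have "\<dots> \<le> (b / a) * (1 - a / b) ^ i * (?x * ?y)"
    using pos diff by (intro mult_right_mono) auto
  finally show ?thesis .
qed

lemma two_by_two_minor_bound:
  fixes q :: "'i \<Rightarrow> 'i \<Rightarrow> real" and x :: "'r \<Rightarrow> 'i \<Rightarrow> real" and y :: "'i \<Rightarrow> 'c \<Rightarrow> real"
  assumes fin: "finite I" and B: "0 \<le> B"
    and x: "\<And>k. k \<in> I \<Longrightarrow> \<bar>x r k\<bar> \<le> B \<and> \<bar>x r' k\<bar> \<le> B"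
    and y: "\<And>k. k \<in> I \<Longrightarrow> \<bar>y k c\<bar> \<le> B \<and> \<bar>y k c'\<bar> \<le> B"
    and q: "\<And>k l k' l'. k \<in> I \<Longrightarrow> l \<in> I \<Longrightarrow> k' \<in> I \<Longrightarrow> l' \<in> I \<Longrightarrow>
      \<bar>q k l * q k' l' - q k l' * q k' l\<bar> \<le> e"
  defines "S \<equiv> \<lambda>r c. \<Sum>k\<in>I. \<Sum>l\<in>I. x r k * q k l * y l c"
  shows "\<bar>S r c * S r' c' - S r c' * S r' c\<bar> \<le> real (card I) ^ 4 * (B ^ 4 * e)"
proof -
  let ?t = "\<lambda>k k' l l'. x r k * x r' k' * y l c * y l' c' * (q k l * q k' l' - q k l' * q k' l)"
  have 1: "S r c * S r' c' = (\<Sum>k\<in>I. \<Sum>k'\<in>I. \<Sum>l\<in>I. \<Sum>l'\<in>I. x r k * q k l * y l c * (x r' k' * q k' l' * y l' c'))"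
    unfolding S_def sum_product ..
  have "S r c' * S r' c = (\<Sum>k\<in>I. \<Sum>k'\<in>I. \<Sum>l'\<in>I. \<Sum>l\<in>I. x r k * q k l' * y l' c' * (x r' k' * q k' l * y l c))"
    unfolding S_def sum_product ..
  also have "\<dots> = (\<Sum>k\<in>I. \<Sum>k'\<in>I. \<Sum>l\<in>I. \<Sum>l'\<in>I. x r k * q k l' * y l' c' * (x r' k' * q k' l * y l c))"
    by (intro sum.cong refl sum.swap)
  finally have 2: "S r c' * S r' c = (\<Sum>k\<in>I. \<Sum>k'\<in>I. \<Sum>l\<in>I. \<Sum>l'\<in>I. x r k * q k l' * y l' c' * (x r' k' * q k' l * y l c))" .
  have "S r c * S r' c' - S r c' * S r' c = (\<Sum>k\<in>I. \<Sum>k'\<in>I. \<Sum>l\<in>I. \<Sum>l'\<in>I. ?t k k' l l')"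
    unfolding 1 2 sum_subtractf[symmetric] by (intro sum.cong refl) (simp add: algebra_simps)
  also have "\<bar>\<dots>\<bar> \<le> (\<Sum>k\<in>I. \<Sum>k'\<in>I. \<Sum>l\<in>I. \<Sum>l'\<in>I. B ^ 4 * e)"
  proof (rule order_trans[OF sum_abs sum_mono] order_trans[OF sum_abs sum_mono])+
    fix k k' l l' assume I: "k \<in> I" "k' \<in> I" "l \<in> I" "l' \<in> I"
    have "\<bar>x r k * x r' k' * y l c * y l' c'\<bar> \<le> B * B * B * B"
      unfolding abs_mult using x y I B by (intro mult_mono) auto
    then have "\<bar>?t k k' l l'\<bar> \<le> (B * B * B * B) * e"
      unfolding abs_mult[of "x r k * x r' k' * y l c * y l' c'"]
      using q[OF I(1,3,2,4)] B by (intro mult_mono) auto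
    then show "\<bar>?t k k' l l'\<bar> \<le> B ^ 4 * e" by (simp add: power4_eq_xxxx)
  qed
  also have "\<dots> = real (card I) ^ 4 * (B ^ 4 * e)" by (simp add: power4_eq_xxxx)
  finally show ?thesis .
qed

section \<open>Singular value decomposition\<close>

text \<open>
  From here on the bullet denotes only the inner product of the Euclidean space.
\<close>

no_notation scalar_prod (infix "\<bullet>" 70)

text \<open>
  The vector \<open>w = T x - (x \<bullet> T x) x\<close> is orthogonal to \<open>x\<close>, and the derivative of the quadratic form in
  direction \<open>w\<close> at the maximizer \<open>x\<close> is \<open>2 (w \<bullet> w)\<close>; so \<open>w\<close> vanishes.
\<close>

lemma maximizer_eigenvector:
  fixes T :: "'v::euclidean_space \<Rightarrow> 'v"
  assumes T: "linear T" and sa: "\<And>x y. T x \<bullet> y = x \<bullet> T y" and S: "subspace S" "\<And>x. x \<in> S \<Longrightarrow> T x \<in> S"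
    and x: "x \<in> S" "norm x = 1" and max: "\<And>y. y \<in> S \<Longrightarrow> norm y = 1 \<Longrightarrow> y \<bullet> T y \<le> x \<bullet> T x"
  shows "T x = (x \<bullet> T x) *\<^sub>R x"
proof -
  define m where "m = x \<bullet> T x"
  have xx: "x \<bullet> x = 1" using x by (simp add: dot_square_norm)
  have q: "y \<bullet> T y \<le> m * (y \<bullet> y)" if y: "y \<in> S" for y
  proof (cases "y = 0")
    case False
    let ?z = "(1 / norm y) *\<^sub>R y"
    have "?z \<bullet> T ?z \<le> m"
      unfolding m_def by (rule max) (use y S subspace_scale False in auto)
    then have "(y \<bullet> T y) / (norm y * norm y) \<le> m" by (simp add: linear_cmul[OF T])
    then show ?thesis using False by (simp add: divide_le_eq dot_square_norm power2_eq_square)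
  qed (simp add: linear_0[OF T])
  define w where "w = T x - m *\<^sub>R x"
  have w: "w \<in> S" unfolding w_def using S x by (intro subspace_diff subspace_scale) auto
  have xw: "x \<bullet> w = 0" by (simp add: w_def inner_diff_right m_def[symmetric] xx)
  have Txw: "T x \<bullet> w = w \<bullet> w"
  proof -
    have "T x = w + m *\<^sub>R x" by (simp add: w_def)
    then show ?thesis using xw by (simp add: inner_add_left)
  qed
  have "w \<bullet> w = 0"
  proof (rule ccontr)
    assume "w \<bullet> w \<noteq> 0"
    then have pos: "0 < w \<bullet> w" by (simp add: order_less_le)
    have main: "2 * t * (w \<bullet> w) + t * t * (w \<bullet> T w) \<le> m * t * t * (w \<bullet> w)" for t
    proof -
      have "x + t *\<^sub>R w \<in> S" using S x w by (intro subspace_add subspace_scale) auto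
      from q[OF this] have "(x + t *\<^sub>R w) \<bullet> T (x + t *\<^sub>R w) \<le> m * ((x + t *\<^sub>R w) \<bullet> (x + t *\<^sub>R w))" .
      moreover have "T (x + t *\<^sub>R w) = T x + t *\<^sub>R T w" by (simp add: linear_add[OF T] linear_cmul[OF T])
      moreover have "x \<bullet> T w = w \<bullet> w" using sa[of x w] Txw by simp
      moreover have "w \<bullet> T x = w \<bullet> w" using Txw by (simp add: inner_commute)
      moreover have "w \<bullet> x = 0" using xw by (simp add: inner_commute)
      ultimately show ?thesis using xw xx
        by (simp add: inner_add_left inner_add_right m_def[symmetric] algebra_simps)
    qed
    \<comment> \<open>A step so small that the linear term of the quadratic form outweighs the quadratic one.\<close>
    let ?c = "m * (w \<bullet> w) - w \<bullet> T w"
    define t where "t = (w \<bullet> w) / (\<bar>?c\<bar> + 1)"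
    have t: "0 < t" unfolding t_def using pos by (simp add: add_nonneg_pos)
    have "t * (2 * (w \<bullet> w)) \<le> t * (t * ?c)" using main[of t] by (simp add: algebra_simps)
    then have "2 * (w \<bullet> w) \<le> t * ?c" using t by simp
    also have "\<dots> \<le> t * (\<bar>?c\<bar> + 1)" using t by (intro mult_left_mono) auto
    also have "\<dots> = w \<bullet> w" unfolding t_def by simp
    finally show False using pos by simp
  qed
  then show ?thesis by (simp add: w_def m_def)
qed

text \<open>
  Split off a maximizer of the quadratic form on the unit sphere and continue in its orthogonal
  complement. The eigenvalues appear in decreasing order, because each one is a maximum over a set that
  contains the later eigenvectors.
\<close>

lemma spectral_on_subspace:
  fixes T :: "'v::euclidean_space \<Rightarrow> 'v"
  assumes T: "linear T" and sa: "\<And>x y. T x \<bullet> y = x \<bullet> T y"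
    and "subspace S" "\<And>x. x \<in> S \<Longrightarrow> T x \<in> S" "dim S = d"
  shows "\<exists>v \<mu>. (\<forall>i<d. v i \<in> S \<and> T (v i) = \<mu> i *\<^sub>R v i) \<and>
     (\<forall>i<d. \<forall>j<d. v i \<bullet> v j = (if i = j then 1 else 0)) \<and> (\<forall>i j. i \<le> j \<longrightarrow> j < d \<longrightarrow> \<mu> j \<le> \<mu> (i::nat))"
  using assms(3-5)
proof (induction d arbitrary: S)
  case 0
  then show ?case by auto
next
  case (Suc d)
  note S = Suc.prems
  let ?K = "S \<inter> sphere 0 1"
  have "compact ?K" using closed_subspace[OF S(1)] by (intro closed_Int_compact) auto
  moreover have "?K \<noteq> {}"
  proof -
    have "S \<noteq> {0}" using S(3) by auto
    then obtain y where y: "y \<in> S" "y \<noteq> 0" using subspace_0[OF S(1)] by auto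
    then have "(1 / norm y) *\<^sub>R y \<in> ?K" using subspace_scale[OF S(1)] by auto
    then show ?thesis by blast
  qed
  moreover have "continuous_on ?K (\<lambda>y. y \<bullet> T y)"
    using linear_continuous_on[of T] T linear_conv_bounded_linear[of T] by (intro continuous_intros) blast
  ultimately obtain x where x: "x \<in> ?K" and max: "\<forall>y\<in>?K. y \<bullet> T y \<le> x \<bullet> T x"
    using continuous_attains_sup[of ?K "\<lambda>y. y \<bullet> T y"] by blast
  have xS: "x \<in> S" "norm x = 1" and xx: "x \<bullet> x = 1" using x by (auto simp: dot_square_norm)
  have ev: "T x = (x \<bullet> T x) *\<^sub>R x"
    by (rule maximizer_eigenvector[OF T sa S(1,2) xS]) (use max in auto)
  let ?P = "{y \<in> S. \<forall>z\<in>span {x}. real_inner_class.orthogonal z y}"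
  have P: "?P = {y \<in> S. x \<bullet> y = 0}"
    by (auto simp: span_singleton real_inner_class.orthogonal_def)
  have "dim ?P + dim (span {x}) = dim S"
  proof (rule dim_subspace_orthogonal_to_vectors)
    show "span {x} \<subseteq> S" by (rule span_minimal) (use S xS in auto)
  qed (use S in auto)
  moreover have "x \<noteq> 0" using xx by auto
  ultimately have dimP: "dim ?P = d" using S(3) by (simp add: dim_singleton)
  have subP: "subspace ?P"
    unfolding P using S(1) by (auto simp: subspace_def inner_add_right)
  have TP: "T y \<in> ?P" if "y \<in> ?P" for y
  proof -
    have y: "y \<in> S" "x \<bullet> y = 0" using that unfolding P by auto
    have "x \<bullet> T y = T x \<bullet> y" using sa[of x y] by simp
    also have "\<dots> = 0" by (subst ev) (simp add: y)
    finally show ?thesis using S(2)[OF y(1)] unfolding P by simp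
  qed
  have "\<exists>v \<mu>. (\<forall>i<d. v i \<in> ?P \<and> T (v i) = \<mu> i *\<^sub>R v i) \<and>
     (\<forall>i<d. \<forall>j<d. v i \<bullet> v j = (if i = j then 1 else 0)) \<and> (\<forall>i j. i \<le> j \<longrightarrow> j < d \<longrightarrow> \<mu> j \<le> \<mu> (i::nat))"
    by (rule Suc.IH[OF subP _ dimP]) (rule TP)
  then obtain v \<mu> where IH: "(\<forall>i<d. v i \<in> ?P \<and> T (v i) = \<mu> i *\<^sub>R v i) \<and>
     (\<forall>i<d. \<forall>j<d. v i \<bullet> v j = (if i = j then 1 else 0)) \<and> (\<forall>i j. i \<le> j \<longrightarrow> j < d \<longrightarrow> \<mu> j \<le> \<mu> (i::nat))"
    by (elim exE) (rule that)
  have v: "v i \<in> ?P" "T (v i) = \<mu> i *\<^sub>R v i" if "i < d" for i using IH that by simp_all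
  have on: "v i \<bullet> v j = (if i = j then 1 else 0)" if "i < d" "j < d" for i j using IH that by simp
  have dec: "\<mu> j \<le> \<mu> i" if "i \<le> j" "j < d" for i j using IH that by simp
  define v' where "v' = (\<lambda>i. case i of 0 \<Rightarrow> x | Suc k \<Rightarrow> v k)"
  define \<mu>' where "\<mu>' = (\<lambda>i. case i of 0 \<Rightarrow> x \<bullet> T x | Suc k \<Rightarrow> \<mu> k)"
  have vx: "v i \<in> S" "x \<bullet> v i = 0" "v i \<bullet> x = 0" if "i < d" for i
    using v(1)[OF that] unfolding P by (auto simp: inner_commute)
  have \<mu>0: "\<mu> i \<le> x \<bullet> T x" if "i < d" for i
  proof -
    have "norm (v i) = 1" using on[OF that that] by (simp add: norm_eq_sqrt_inner)
    then have "v i \<bullet> T (v i) \<le> x \<bullet> T x" using max vx(1)[OF that] by auto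
    then show ?thesis using v[OF that] on[OF that that] by simp
  qed
  have "v' i \<in> S \<and> T (v' i) = \<mu>' i *\<^sub>R v' i" if "i < Suc d" for i
    using that xS ev v vx(1) by (cases i) (auto simp: v'_def \<mu>'_def)
  moreover have "v' i \<bullet> v' j = (if i = j then 1 else 0)" if "i < Suc d" "j < Suc d" for i j
    using that on vx xx by (cases i; cases j) (auto simp: v'_def)
  moreover have "\<mu>' j \<le> \<mu>' i" if "i \<le> j" "j < Suc d" for i j
    using that dec \<mu>0 by (cases i; cases j) (auto simp: \<mu>'_def)
  ultimately show ?case by blast
qed

definition orthoframe :: "(nat \<Rightarrow> 'v::euclidean_space) \<Rightarrow> bool" where
  "orthoframe v \<longleftrightarrow> (\<forall>i<DIM('v). \<forall>j<DIM('v). v i \<bullet> v j = (if i = j then 1 else 0))"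

lemma orthoframe_inner:
  fixes v :: "nat \<Rightarrow> 'v::euclidean_space"
  assumes "orthoframe v" "j < DIM('v)"
  shows "v j \<bullet> (\<Sum>i<DIM('v). x i *\<^sub>R v i) = x j"
proof -
  have "v j \<bullet> (\<Sum>i<DIM('v). x i *\<^sub>R v i) = (\<Sum>i<DIM('v). if i = j then x i else 0)"
    unfolding inner_sum_right by (rule sum.cong) (use assms in \<open>auto simp: orthoframe_def\<close>)
  then show ?thesis using assms(2) by simp
qed

lemma orthoframe_frame:
  fixes v :: "nat \<Rightarrow> 'v::euclidean_space"
  assumes "orthoframe v" shows "frame v"
proof (rule frameI)
  fix x i assume "(\<Sum>i<DIM('v). x i *\<^sub>R v i) = 0" "i < DIM('v)"
  then show "x i = 0" using orthoframe_inner[OF assms, of i x] by simp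
qed

lemma orthoframe_coord:
  fixes v :: "nat \<Rightarrow> 'v::euclidean_space"
  assumes "orthoframe v" "i < DIM('v)" shows "coord v x i = v i \<bullet> x"
  using orthoframe_inner[OF assms, of "coord v x"] frame_expand[OF orthoframe_frame[OF assms(1)], of x]
  by simp

lemma orthoframe_norm:
  fixes v :: "nat \<Rightarrow> 'v::euclidean_space"
  assumes "orthoframe v" "i < DIM('v)" shows "norm (v i) = 1"
  using assms by (simp add: orthoframe_def norm_eq_sqrt_inner)

lemma sorted_concat_replicate:
  "sorted ys \<Longrightarrow> sorted (concat (map (\<lambda>s. replicate (k s) s) (ys :: real list)))"
  by (induction ys) (auto simp: sorted_append)

lemma count_concat_replicate:
  "distinct ys \<Longrightarrow> count (mset (concat (map (\<lambda>s. replicate (k s) s) ys))) x = (if x \<in> set ys then k x else 0)"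
  by (induction ys) auto

text \<open>
  Both sides are decreasing, and they contain every value with the same multiplicity.
\<close>

lemma concat_replicate_sorted:
  fixes \<sigma> :: "nat \<Rightarrow> real"
  assumes dec: "\<And>i j. i \<le> j \<Longrightarrow> j < n \<Longrightarrow> \<sigma> j \<le> \<sigma> i"
  shows "concat (map (\<lambda>s. replicate (card {i. i < n \<and> \<sigma> i = s}) s)
     (rev (sorted_list_of_set (\<sigma> ` {..<n})))) = map \<sigma> [0..<n]" (is "concat (map ?f (rev ?ys)) = _")
proof -
  have "concat (map ?f (rev ?ys)) = rev (concat (map ?f ?ys))"
    by (simp add: rev_concat rev_map comp_def)
  also have "concat (map ?f ?ys) = rev (map \<sigma> [0..<n])"
  proof -
    have ms: "mset (concat (map ?f ?ys)) = mset (rev (map \<sigma> [0..<n]))"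
    proof (rule multiset_eqI)
      fix x
      have "count (mset (rev (map \<sigma> [0..<n]))) x = length (filter ((=) x) (map \<sigma> [0..<n]))"
        unfolding mset_rev count_mset by (rule count_list_eq_length_filter)
      also have "\<dots> = card {i. i < n \<and> \<sigma> i = x}"
        unfolding length_filter_conv_card by (rule arg_cong[where f = card]) auto
      finally have "count (mset (rev (map \<sigma> [0..<n]))) x = card {i. i < n \<and> \<sigma> i = x}" .
      moreover have "card {i. i < n \<and> \<sigma> i = x} = 0" if "x \<notin> \<sigma> ` {..<n}"
        using that by (auto intro: card_eq_0_iff[THEN iffD2])
      moreover have "distinct ?ys" "set ?ys = \<sigma> ` {..<n}" by auto
      ultimately show "count (mset (concat (map ?f ?ys))) x = count (mset (rev (map \<sigma> [0..<n]))) x"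
        by (subst count_concat_replicate) auto
    qed
    have sorted: "sorted (concat (map ?f ?ys))" by (rule sorted_concat_replicate) simp
    have "sorted (rev (map \<sigma> [0..<n]))"
      using dec by (auto simp: sorted_iff_nth_mono rev_nth)
    then have "sort (concat (map ?f ?ys)) = rev (map \<sigma> [0..<n])"
      by (rule properties_for_sort[OF ms[THEN sym]])
    then show ?thesis unfolding sorted_sort_id[OF sorted] .
  qed
  finally show ?thesis by simp
qed

text \<open>
  The spectral theorem for \<open>adjoint f \<circ> f\<close>. The list of singular values counts each one with the
  dimension of its eigenspace, which is the number of \<open>v i\<close> with this singular value.
\<close>

theorem singular_value_decomposition:
  fixes f :: "'v::euclidean_space \<Rightarrow> 'v"
  assumes f: "linear f" and inj: "inj f"
  obtains v w \<sigma> where "orthoframe v" "orthoframe w" "\<forall>i<DIM('v). f (v i) = \<sigma> i *\<^sub>R w i"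
    "\<forall>i<DIM('v). 0 < \<sigma> i" "\<forall>i j. i \<le> j \<longrightarrow> j < DIM('v) \<longrightarrow> \<sigma> j \<le> \<sigma> i"
    "singular_values f = map \<sigma> [0..<DIM('v)]"
proof -
  let ?n = "DIM('v)"
  define T where "T = (\<lambda>x. adjoint f (f x))"
  have T: "linear T" unfolding T_def using linear_compose[OF f adjoint_linear[OF f]] by (simp add: o_def)
  have Tin: "x \<bullet> T y = f x \<bullet> f y" for x y unfolding T_def by (rule adjoint_works[OF f])
  have sa: "T x \<bullet> y = x \<bullet> T y" for x y using Tin[of x y] Tin[of y x] by (simp add: inner_commute)
  obtain v \<mu> where v: "\<And>i. i < ?n \<Longrightarrow> T (v i) = \<mu> i *\<^sub>R v i"
    and on: "orthoframe v" and dec: "\<And>i j. i \<le> j \<Longrightarrow> j < ?n \<Longrightarrow> \<mu> j \<le> \<mu> (i::nat)"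
    using spectral_on_subspace[OF T sa subspace_UNIV, of ?n] unfolding orthoframe_def by auto
  have fv: "f (v i) \<bullet> f (v j) = (if i = j then \<mu> i else 0)" if "i < ?n" "j < ?n" for i j
    using Tin[of "v i" "v j"] v[OF that(2)] on that by (auto simp: orthoframe_def)
  have \<mu>: "0 < \<mu> i" if i: "i < ?n" for i
  proof -
    have "v i \<noteq> 0" using orthoframe_norm[OF on i] by auto
    then have "f (v i) \<noteq> 0" using inj linear_0[OF f] by (metis injD)
    then show ?thesis using fv[OF i i] by (metis inner_gt_zero_iff)
  qed
  define \<sigma> where "\<sigma> = (\<lambda>i. sqrt (\<mu> i))"
  have \<sigma>: "0 < \<sigma> i" "(\<sigma> i)\<^sup>2 = \<mu> i" if "i < ?n" for i using \<mu>[OF that] by (auto simp: \<sigma>_def)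
  define w where "w = (\<lambda>i. (1 / \<sigma> i) *\<^sub>R f (v i))"
  have ow: "orthoframe w"
    unfolding orthoframe_def
  proof (intro allI impI)
    fix i j assume "i < ?n" "j < ?n"
    then show "w i \<bullet> w j = (if i = j then 1 else 0)"
      using fv[of i j] \<sigma>[of i] \<sigma>[of j] by (auto simp: w_def power2_eq_square)
  qed
  have fw: "\<forall>i<?n. f (v i) = \<sigma> i *\<^sub>R w i" using \<sigma>(1) by (force simp: w_def)
  have dec\<sigma>: "\<sigma> j \<le> \<sigma> i" if "i \<le> j" "j < ?n" for i j
    using dec[OF that] by (simp add: \<sigma>_def)
  have sv: "singular_values f = map \<sigma> [0..<?n]"
  proof -
    have fr: "frame v" by (rule orthoframe_frame[OF on])
    have sp: "singular_space f s = span (v ` {i. i < ?n \<and> \<sigma> i = s})" if s: "0 \<le> s" for s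
    proof (rule Set.set_eqI)
      fix x
      have sub: "{i. i < ?n \<and> \<sigma> i = s} \<subseteq> {..<?n}" by auto
      have co: "coord v (T x) i = \<mu> i * coord v x i" if "i < ?n" for i
        using sa[of "v i" x] v[OF that] by (simp add: orthoframe_coord[OF on that])
      have co': "coord v (s\<^sup>2 *\<^sub>R x) i = s\<^sup>2 * coord v x i" if "i < ?n" for i
        by (simp add: orthoframe_coord[OF on that])
      have "x \<in> singular_space f s \<longleftrightarrow> T x = s\<^sup>2 *\<^sub>R x" by (simp add: singular_space_def T_def)
      also have "\<dots> \<longleftrightarrow> (\<forall>i<?n. coord v (T x) i = coord v (s\<^sup>2 *\<^sub>R x) i)"
      proof
        assume eq: "\<forall>i<?n. coord v (T x) i = coord v (s\<^sup>2 *\<^sub>R x) i"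
        have "T x = (\<Sum>i<?n. coord v (T x) i *\<^sub>R v i)" by (rule frame_expand[OF fr])
        also have "\<dots> = (\<Sum>i<?n. coord v (s\<^sup>2 *\<^sub>R x) i *\<^sub>R v i)" using eq by simp
        also have "\<dots> = s\<^sup>2 *\<^sub>R x" by (rule frame_expand[OF fr, symmetric])
        finally show "T x = s\<^sup>2 *\<^sub>R x" .
      qed simp
      also have "\<dots> \<longleftrightarrow> (\<forall>i<?n. \<sigma> i \<noteq> s \<longrightarrow> coord v x i = 0)"
      proof -
        have "\<mu> i = s\<^sup>2 \<longleftrightarrow> \<sigma> i = s" if "i < ?n" for i
          using \<sigma>[OF that] s by (metis less_imp_le power2_eq_iff_nonneg)
        then show ?thesis using co co' by auto
      qed
      also have "\<dots> \<longleftrightarrow> x \<in> span (v ` {i. i < ?n \<and> \<sigma> i = s})"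
        unfolding span_coord[OF fr sub] by auto
      finally show "x \<in> singular_space f s \<longleftrightarrow> x \<in> span (v ` {i. i < ?n \<and> \<sigma> i = s})" .
    qed
    have dims: "dim (singular_space f s) = card {i. i < ?n \<and> \<sigma> i = s}" if "0 \<le> s" for s
      unfolding sp[OF that] by (rule dim_frame_span[OF fr]) auto
    have "{s. s \<ge> 0 \<and> singular_space f s \<noteq> {0}} = \<sigma> ` {..<?n}"
    proof (intro equalityI subsetI)
      fix s assume "s \<in> {s. s \<ge> 0 \<and> singular_space f s \<noteq> {0}}"
      then have s: "0 \<le> s" "singular_space f s \<noteq> {0}" by auto
      have "{i. i < ?n \<and> \<sigma> i = s} \<noteq> {}"
      proof
        assume "{i. i < ?n \<and> \<sigma> i = s} = {}"
        then have "singular_space f s = span (v ` {})" using sp[OF s(1)] by (simp only:)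
        then show False using s(2) by simp
      qed
      then show "s \<in> \<sigma> ` {..<?n}" by auto
    next
      fix s assume "s \<in> \<sigma> ` {..<?n}"
      then obtain i where i: "i < ?n" "s = \<sigma> i" by auto
      then have s: "0 \<le> s" using \<sigma>(1) by (simp add: less_imp_le)
      have "v i \<in> singular_space f s" unfolding sp[OF s] by (rule span_base) (use i in auto)
      moreover have "v i \<noteq> 0" using orthoframe_norm[OF on i(1)] by auto
      ultimately show "s \<in> {s. s \<ge> 0 \<and> singular_space f s \<noteq> {0}}" using s by auto
    qed
    then have "singular_values f = concat (map (\<lambda>s. replicate (dim (singular_space f s)) s)
        (rev (sorted_list_of_set (\<sigma> ` {..<?n}))))" by (simp add: singular_values_def)
    also have "map (\<lambda>s. replicate (dim (singular_space f s)) s) (rev (sorted_list_of_set (\<sigma> ` {..<?n}))) =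
       map (\<lambda>s. replicate (card {i. i < ?n \<and> \<sigma> i = s}) s) (rev (sorted_list_of_set (\<sigma> ` {..<?n})))"
    proof (rule map_cong[OF refl])
      fix s assume "s \<in> set (rev (sorted_list_of_set (\<sigma> ` {..<?n})))"
      then have "0 \<le> s" using \<sigma>(1) by (auto intro: less_imp_le)
      then show "replicate (dim (singular_space f s)) s = replicate (card {i. i < ?n \<and> \<sigma> i = s}) s"
        by (simp add: dims)
    qed
    also have "concat \<dots> = map \<sigma> [0..<?n]" by (rule concat_replicate_sorted) (rule dec\<sigma>)
    finally show ?thesis .
  qed
  show ?thesis by (rule that[OF on ow fw _ _ sv]) (use \<sigma>(1) dec\<sigma> in simp_all)
qed

section \<open>Singular value gaps from minors\<close>

lemma mdet_bound:
  assumes "\<And>i j. i < m \<Longrightarrow> j < m \<Longrightarrow> \<bar>A (r i) (c j)\<bar> \<le> d i" "\<And>i. i < m \<Longrightarrow> 0 \<le> d i"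
  shows "\<bar>mdet A m r c\<bar> \<le> fact m * (\<Prod>i<m. d i)"
proof -
  have "\<bar>mdet A m r c\<bar> \<le> (\<Sum>p | p permutes {0..<m}. \<bar>signof p * (\<Prod>i = 0..<m. A (r i) (c (p i)))\<bar>)"
    unfolding mdet_leibniz by (rule sum_abs)
  also have "\<dots> \<le> (\<Sum>p | p permutes {0..<m}. \<Prod>i<m. d i)"
  proof (rule sum_mono)
    fix p assume "p \<in> {p. p permutes {0..<m}}"
    then have p: "p i < m" if "i < m" for i using permutes_in_image[of p "{0..<m}" i] that by auto
    have "\<bar>signof p * (\<Prod>i = 0..<m. A (r i) (c (p i)))\<bar> = (\<Prod>i<m. \<bar>A (r i) (c (p i))\<bar>)"
      by (simp add: abs_mult abs_prod sign_def lessThan_atLeast0)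
    also have "\<dots> \<le> (\<Prod>i<m. d i)" by (rule prod_mono) (use assms(1) p in auto)
    finally show "\<bar>signof p * (\<Prod>i = 0..<m. A (r i) (c (p i)))\<bar> \<le> (\<Prod>i<m. d i)" .
  qed
  also have "\<dots> = fact m * (\<Prod>i<m. d i)"
    using card_permutations[of "{0..<m}" m] by simp
  finally show ?thesis .
qed

lemma coord_bound:
  fixes g :: "nat \<Rightarrow> 'v::euclidean_space"
  assumes g: "frame g"
  shows "\<exists>C>0. \<forall>x. \<forall>i<DIM('v). \<bar>coord g x i\<bar> \<le> C * norm x"
proof -
  have "\<exists>B. \<forall>x :: 'v. \<bar>coord g x i\<bar> \<le> B * norm x" if "i < DIM('v)" for i
    using linear_bounded[OF coord_linear[OF g that]] by simp
  then obtain B where B: "\<And>i x. i < DIM('v) \<Longrightarrow> \<bar>coord g x i\<bar> \<le> B i * norm x" by metis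
  show ?thesis
  proof (intro exI[of _ "(\<Sum>i<DIM('v). \<bar>B i\<bar>) + 1"] conjI allI impI)
    show "0 < (\<Sum>i<DIM('v). \<bar>B i\<bar>) + 1" by (simp add: add_nonneg_pos sum_nonneg)
    fix x :: 'v and i assume i: "i < DIM('v)"
    have "B i \<le> (\<Sum>i<DIM('v). \<bar>B i\<bar>) + 1"
      using member_le_sum[of i "{..<DIM('v)}" "\<lambda>i. \<bar>B i\<bar>"] i by auto
    then have "B i * norm x \<le> ((\<Sum>i<DIM('v). \<bar>B i\<bar>) + 1) * norm x" by (rule mult_right_mono) simp
    then show "\<bar>coord g x i\<bar> \<le> ((\<Sum>i<DIM('v). \<bar>B i\<bar>) + 1) * norm x" using B[OF i, of x] by linarith
  qed
qed

lemma orthoframe_coord_bound: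
  fixes v :: "nat \<Rightarrow> 'v::euclidean_space"
  assumes "orthoframe v" "i < DIM('v)" shows "\<bar>coord v x i\<bar> \<le> norm x"
  using Cauchy_Schwarz_ineq2[of "v i" x] orthoframe_norm[OF assms] orthoframe_coord[OF assms] by simp

lemma cauchy_binet_triple:
  "mdet (mprod n A (mprod n B C)) m r c =
     (\<Sum>K\<in>index_sets m n. \<Sum>L\<in>index_sets m n. mdet A m r (pick K) * mdet B m (pick K) (pick L) * mdet C m (pick L) c)"
  unfolding cauchy_binet sum_distrib_left by (simp add: mult.assoc)

text \<open>
  The \<open>2 \<times> 2\<close> minors of the \<open>m\<close>-th compound matrix of \<open>Q\<close> are small relative to its size. The condition
  is homogeneous, and hence does not depend on the representative of a projective class.
\<close>

definition near_rank_one :: "nat \<Rightarrow> nat \<Rightarrow> real \<Rightarrow> (nat \<Rightarrow> nat \<Rightarrow> real) \<Rightarrow> bool" where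
  "near_rank_one n m \<epsilon> Q \<longleftrightarrow>
     (\<forall>K\<in>index_sets m n. \<forall>L\<in>index_sets m n. \<forall>K'\<in>index_sets m n. \<forall>L'\<in>index_sets m n.
       \<bar>mdet Q m (pick K) (pick L) * mdet Q m (pick K') (pick L') -
        mdet Q m (pick K) (pick L') * mdet Q m (pick K') (pick L)\<bar> \<le>
       \<epsilon> * (\<Sum>K\<in>index_sets m n. \<Sum>L\<in>index_sets m n. (mdet Q m (pick K) (pick L))\<^sup>2))"

text \<open>
  In the singular bases the compound matrix of \<open>h\<close> is diagonal, with largest entry
  \<open>s = \<sigma> 0 \<cdots> \<sigma> (m - 1)\<close>. The \<open>2 \<times> 2\<close> minor formed by this entry and the one where \<open>\<sigma> m\<close> replaces
  \<open>\<sigma> (m - 1)\<close> is \<open>s\<^sup>2 \<sigma> m / \<sigma> (m - 1)\<close>. The changes of basis between the singular bases, which are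
  orthonormal, and the fixed frames \<open>g\<close> and \<open>g'\<close> have bounded entries, so this minor is bounded by a
  constant times the \<open>2 \<times> 2\<close> minors for \<open>Q\<close>, whereas the minors of \<open>Q\<close> are bounded by a constant times
  \<open>s\<close>.
\<close>

lemma singular_gap_from_minors:
  fixes g g' :: "nat \<Rightarrow> 'v::euclidean_space"
  assumes g: "frame g" and g': "frame g'" and m: "0 < m" "m < DIM('v)"
  shows "\<exists>C>0. \<forall>h Q \<epsilon>. linear h \<longrightarrow> inj h \<longrightarrow> (\<forall>j<DIM('v). h (g j) = comb g' Q j) \<longrightarrow> 0 \<le> \<epsilon> \<longrightarrow>
     near_rank_one DIM('v) m \<epsilon> Q \<longrightarrow>
     singular_values h ! m \<le> C * \<epsilon> * singular_values h ! (m - 1)"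
proof -
  let ?n = "DIM('v)" let ?I = "index_sets m DIM('v)"
  obtain c1 where c1: "0 < c1" "\<forall>x. \<forall>i<?n. \<bar>coord g x i\<bar> \<le> c1 * norm x" using coord_bound[OF g] by blast
  obtain c2 where c2: "0 < c2" "\<forall>x. \<forall>i<?n. \<bar>coord g' x i\<bar> \<le> c2 * norm x" using coord_bound[OF g'] by blast
  define D where "D = c1 + c2 + (\<Sum>i<?n. norm (g i)) + (\<Sum>i<?n. norm (g' i))"
  have ng: "norm (g j) \<le> (\<Sum>i<?n. norm (g i))" "norm (g' j) \<le> (\<Sum>i<?n. norm (g' i))" if "j < ?n" for j
    using that member_le_sum[of j "{..<?n}" "\<lambda>i. norm (g i)"] member_le_sum[of j "{..<?n}" "\<lambda>i. norm (g' i)"]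
    by auto
  have sn: "0 \<le> (\<Sum>i<?n. norm (g i))" "0 \<le> (\<Sum>i<?n. norm (g' i))" by (auto intro: sum_nonneg)
  have D: "0 < D" "c1 \<le> D" "c2 \<le> D" "norm (g j) \<le> D" "norm (g' j) \<le> D" if "j < ?n" for j
    using ng[OF that] sn c1(1) c2(1) unfolding D_def by linarith+
  have D0: "0 < D" using D(1)[OF m(2)] .
  define B where "B = fact m * D ^ m"
  have B: "0 < B" unfolding B_def using D0 by simp
  define N where "N = real (card ?I)"
  have id: "incr m ?n (\<lambda>i. i)" by (rule incr_initial) (use m in simp)
  have "0 < card ?I"
    using incr_eq_pick(1)[OF id] finite_index_sets card_gt_0_iff by blast
  then have N: "0 < N" by (simp add: N_def)
  define C where "C = N ^ 4 * B ^ 4 * (N\<^sup>2 * (N\<^sup>2 * B\<^sup>2 * fact m)\<^sup>2)"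
  have C: "0 < C" unfolding C_def using N B by simp
  have minor_B: "\<bar>mdet A m r c\<bar> \<le> B"
    if "\<And>i j. i < ?n \<Longrightarrow> j < ?n \<Longrightarrow> \<bar>A i j\<bar> \<le> D" "incr m ?n r" "incr m ?n c" for A r c
    using mdet_bound[of m A r c "\<lambda>_. D"] that incr_less D0 by (auto simp: B_def)
  show ?thesis
  proof (intro exI[of _ C] conjI allI impI)
    show "0 < C" by (rule C)
    fix h :: "'v \<Rightarrow> 'v" and Q and \<epsilon> :: real
    assume lin: "linear h" and inj: "inj h" and hg: "\<forall>j<?n. h (g j) = comb g' Q j" and \<epsilon>: "0 \<le> \<epsilon>"
    let ?q = "\<lambda>K L. mdet Q m (pick K) (pick L)"
    define Z where "Z = (\<Sum>K\<in>?I. \<Sum>L\<in>?I. (?q K L)\<^sup>2)"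
    assume "near_rank_one ?n m \<epsilon> Q"
    then have two: "\<bar>?q K L * ?q K' L' - ?q K L' * ?q K' L\<bar> \<le> \<epsilon> * Z"
      if "K \<in> ?I" "L \<in> ?I" "K' \<in> ?I" "L' \<in> ?I" for K L K' L'
      using that unfolding Z_def near_rank_one_def by blast
    obtain v w \<sigma> where v: "orthoframe v" and w: "orthoframe w" and hv: "\<forall>i<?n. h (v i) = \<sigma> i *\<^sub>R w i"
      and \<sigma>: "\<forall>i<?n. 0 < \<sigma> i" and dec: "\<forall>i j. i \<le> j \<longrightarrow> j < ?n \<longrightarrow> \<sigma> j \<le> \<sigma> i"
      and sv: "singular_values h = map \<sigma> [0..<?n]"
      by (rule singular_value_decomposition[OF lin inj])
    note fv = orthoframe_frame[OF v] and fw = orthoframe_frame[OF w]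
    define x where "x = (\<lambda>i j. coord w (g' j) i)"
    define y where "y = (\<lambda>i j. coord g (v j) i)"
    define x' where "x' = (\<lambda>i j. coord g' (w j) i)"
    define y' where "y' = (\<lambda>i j. coord v (g j) i)"
    have xD: "\<bar>x i j\<bar> \<le> D" if "i < ?n" "j < ?n" for i j
      unfolding x_def using orthoframe_coord_bound[OF w that(1), of "g' j"] D(5)[OF that(2)] by linarith
    have y'D: "\<bar>y' i j\<bar> \<le> D" if "i < ?n" "j < ?n" for i j
      unfolding y'_def using orthoframe_coord_bound[OF v that(1), of "g j"] D(4)[OF that(2)] by linarith
    have yD: "\<bar>y i j\<bar> \<le> D" if "i < ?n" "j < ?n" for i j
      unfolding y_def using c1(2)[rule_format, OF that(1), of "v j"] D(2)[OF m(2)] orthoframe_norm[OF v that(2)] by simp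
    have x'D: "\<bar>x' i j\<bar> \<le> D" if "i < ?n" "j < ?n" for i j
      unfolding x'_def using c2(2)[rule_format, OF that(1), of "w j"] D(3)[OF m(2)] orthoframe_norm[OF w that(2)] by simp
    define S where "S = (\<lambda>i j. if i = j then \<sigma> i else 0)"
    have hv': "h (v j) = comb w S j" if "j < ?n" for j
    proof -
      have "comb w S j = (\<Sum>i<?n. if i = j then \<sigma> i *\<^sub>R w i else 0)"
        unfolding comb_def S_def by (rule sum.cong) auto
      then show ?thesis using hv that by simp
    qed
    have eq1: "mprod ?n x (mprod ?n Q y) i j = S i j" if "i < ?n" "j < ?n" for i j
    proof (rule comb_eqD[OF fw _ that(1)])
      have "comb w (mprod ?n x (mprod ?n Q y)) j = comb (comb (comb w x) Q) y j"
        by (simp only: comb_comb[symmetric])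
      also have "comb w x = g'" unfolding x_def by (rule comb_coord[OF fw])
      also have "comb (comb g' Q) y = comb (h \<circ> g) y"
        by (rule comb_cong_frame) (use hg in simp)
      also have "comb (h \<circ> g) y j = h (comb g y j)" by (rule linear_comb[OF lin, symmetric])
      also have "comb g y = v" unfolding y_def by (rule comb_coord[OF g])
      also have "h (v j) = comb w S j" by (rule hv'[OF that(2)])
      finally show "comb w (mprod ?n x (mprod ?n Q y)) j = comb w S j" .
    qed
    have eq2: "Q i j = mprod ?n x' (mprod ?n S y') i j" if "i < ?n" "j < ?n" for i j
    proof (rule comb_eqD[OF g' _ that(1)])
      have "comb g' (mprod ?n x' (mprod ?n S y')) j = comb (comb (comb g' x') S) y' j"
        by (simp only: comb_comb[symmetric])
      also have "comb g' x' = w" unfolding x'_def by (rule comb_coord[OF g'])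
      also have "comb (comb w S) y' = comb (h \<circ> v) y'"
        by (rule comb_cong_frame) (use hv' in simp)
      also have "comb (h \<circ> v) y' j = h (comb v y' j)" by (rule linear_comb[OF lin, symmetric])
      also have "comb v y' = g" unfolding y'_def by (rule comb_coord[OF fv])
      also have "h (g j) = comb g' Q j" using hg that by simp
      finally show "comb g' Q j = comb g' (mprod ?n x' (mprod ?n S y')) j" by simp
    qed
    define s where "s = (\<Prod>i<m. \<sigma> i)"
    have s: "0 < s" unfolding s_def by (rule prod_pos) (use \<sigma> m in auto)
    have minor_S: "\<bar>mdet S m r c\<bar> \<le> fact m * s" if r: "incr m ?n r" for r c
      unfolding s_def
    proof (rule mdet_bound)
      fix i j assume i: "i < m"
      have "i \<le> r i" "r i < ?n" using incr_ge[OF r i] incr_less[OF r i] by auto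
      then have "0 < \<sigma> (r i)" "\<sigma> (r i) \<le> \<sigma> i" using \<sigma> dec by auto
      then show "\<bar>S (r i) (c j)\<bar> \<le> \<sigma> i" unfolding S_def by auto
    qed (use \<sigma> m in \<open>auto intro: less_imp_le\<close>)
    have qb: "\<bar>?q K L\<bar> \<le> N\<^sup>2 * B\<^sup>2 * fact m * s" if KL: "K \<in> ?I" "L \<in> ?I" for K L
    proof -
      note iK = incr_pick[OF KL(1)] and iL = incr_pick[OF KL(2)]
      have "?q K L = mdet (mprod ?n x' (mprod ?n S y')) m (pick K) (pick L)"
        by (rule mdet_cong, rule eq2) (use incr_less[OF iK] incr_less[OF iL] in auto)
      also have "\<bar>\<dots>\<bar> \<le> (\<Sum>J\<in>?I. \<Sum>J'\<in>?I. B * (fact m * s) * B)"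
        unfolding cauchy_binet_triple
      proof (rule order_trans[OF sum_abs sum_mono] order_trans[OF sum_abs sum_mono])+
        fix J J' assume J: "J \<in> ?I" "J' \<in> ?I"
        note iJ = incr_pick[OF J(1)] and iJ' = incr_pick[OF J(2)]
        show "\<bar>mdet x' m (pick K) (pick J) * mdet S m (pick J) (pick J') * mdet y' m (pick J') (pick L)\<bar>
          \<le> B * (fact m * s) * B"
          unfolding abs_mult using minor_B[OF x'D iK iJ] minor_S[OF iJ] minor_B[OF y'D iJ' iL] B s
          by (intro mult_mono) auto
      qed
      also have "\<dots> = N\<^sup>2 * B\<^sup>2 * fact m * s" by (simp add: N_def power2_eq_square)
      finally show ?thesis .
    qed
    have Zb: "Z \<le> N\<^sup>2 * (N\<^sup>2 * B\<^sup>2 * fact m * s)\<^sup>2"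
    proof -
      have "Z \<le> (\<Sum>K\<in>?I. \<Sum>L\<in>?I. (N\<^sup>2 * B\<^sup>2 * fact m * s)\<^sup>2)"
        unfolding Z_def
      proof (intro sum_mono)
        fix K L assume KL: "K \<in> ?I" "L \<in> ?I"
        have "0 \<le> N\<^sup>2 * B\<^sup>2 * fact m * s" using s by simp
        then have "\<bar>?q K L\<bar> \<le> \<bar>N\<^sup>2 * B\<^sup>2 * fact m * s\<bar>" using qb[OF KL] by linarith
        then show "(?q K L)\<^sup>2 \<le> (N\<^sup>2 * B\<^sup>2 * fact m * s)\<^sup>2" by (rule abs_le_square_iff[THEN iffD1])
      qed
      also have "\<dots> = N\<^sup>2 * (N\<^sup>2 * B\<^sup>2 * fact m * s)\<^sup>2" by (simp add: N_def power2_eq_square)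
      finally show ?thesis .
    qed
    let ?i = "\<lambda>i. i :: nat"
    \<comment> \<open>Index sequence of the second largest entry of the diagonal compound matrix.\<close>
    define t where "t = (\<lambda>i. if i = m - 1 then m else i)"
    have t: "incr m ?n t" using m by (auto simp: incr_def t_def)
    have minors: "(\<Sum>K\<in>?I. \<Sum>L\<in>?I. mdet x m r (pick K) * ?q K L * mdet y m (pick L) c) = mdet S m r c"
      if "incr m ?n r" "incr m ?n c" for r c
      unfolding cauchy_binet_triple[symmetric]
      by (rule mdet_cong, rule eq1) (use incr_less that in auto)
    have ineq: "\<bar>mdet S m ?i ?i * mdet S m t t - mdet S m ?i t * mdet S m t ?i\<bar> \<le>
       real (card ?I) ^ 4 * (B ^ 4 * (\<epsilon> * Z))"
      unfolding minors[OF id id, symmetric] minors[OF t t, symmetric]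
        minors[OF id t, symmetric] minors[OF t id, symmetric]
      by (intro two_by_two_minor_bound[OF finite_index_sets less_imp_le[OF B],
            where x = "\<lambda>r K. mdet x m r (pick K)" and y = "\<lambda>K c. mdet y m (pick K) c" and q = ?q])
        (use minor_B[OF xD id incr_pick] minor_B[OF xD t incr_pick] minor_B[OF yD incr_pick id]
          minor_B[OF yD incr_pick t] two in auto)
    have Sii: "mdet S m ?i ?i = s"
      unfolding s_def by (subst mdet_lower_triangular) (auto simp: S_def)
    have Stt: "mdet S m t t = (\<Prod>i<m. \<sigma> (t i))"
      by (subst mdet_lower_triangular) (use m in \<open>auto simp: S_def t_def\<close>)
    have Sit: "mdet S m ?i t = 0"
      by (rule mdet_row_zero[of "m - 1"]) (use m in \<open>auto simp: S_def t_def\<close>)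
    obtain k where k: "m = Suc k" using m by (cases m) auto
    have "(\<Prod>i<m. \<sigma> (t i)) = (\<Prod>i<k. \<sigma> i) * \<sigma> m" by (simp add: k t_def)
    moreover have "s = (\<Prod>i<k. \<sigma> i) * \<sigma> (m - 1)" by (simp add: s_def k)
    ultimately have Stt': "mdet S m t t * \<sigma> (m - 1) = s * \<sigma> m" unfolding Stt by simp
    have \<sigma>1: "0 < \<sigma> (m - 1)" using \<sigma> m by simp
    have "s * mdet S m t t \<le> real (card ?I) ^ 4 * (B ^ 4 * (\<epsilon> * Z))"
      using ineq unfolding Sii Sit by simp
    also have "\<dots> \<le> N ^ 4 * (B ^ 4 * (\<epsilon> * (N\<^sup>2 * (N\<^sup>2 * B\<^sup>2 * fact m * s)\<^sup>2)))"
      unfolding N_def[symmetric] using Zb N B \<epsilon> by (intro mult_left_mono) auto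
    also have "\<dots> = s * (C * \<epsilon> * s)" by (simp add: C_def power2_eq_square)
    finally have "mdet S m t t \<le> C * \<epsilon> * s" using s by simp
    then have "mdet S m t t * \<sigma> (m - 1) \<le> C * \<epsilon> * s * \<sigma> (m - 1)"
      using \<sigma>1 by (intro mult_right_mono) auto
    then have "s * \<sigma> m \<le> s * (C * \<epsilon> * \<sigma> (m - 1))" unfolding Stt' by (simp add: ac_simps)
    then have "\<sigma> m \<le> C * \<epsilon> * \<sigma> (m - 1)" using s by simp
    then show "singular_values h ! m \<le> C * \<epsilon> * singular_values h ! (m - 1)"
      unfolding sv using m by simp
  qed
qed

section \<open>Matrices along the edges of the graph\<close>

text \<open>
  If \<open>d\<close> took both signs, then the first coordinate of the image could be made zero by weighting the
  two groups of columns suitably. If \<open>d\<close> has a constant sign, then the image of \<open>(1, \<dots>, 1)\<close> has the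
  signs of \<open>t\<close>, up to a global sign.
\<close>

lemma cone_map_signs:
  fixes M N :: "nat \<Rightarrow> nat \<Rightarrow> real"
  assumes n: "0 < n" and M: "\<And>i j. i < n \<Longrightarrow> j < n \<Longrightarrow> 0 < M i j"
    and N: "\<And>i j. i < n \<Longrightarrow> j < n \<Longrightarrow> N i j = t i * M i j * d j"
    and d: "\<And>j. j < n \<Longrightarrow> d j \<noteq> 0"
    and cone: "\<And>x. (\<forall>j<n. 0 < x j) \<Longrightarrow>
      (\<forall>i<n. 0 < (\<Sum>j<n. N i j * x j)) \<or> (\<forall>i<n. (\<Sum>j<n. N i j * x j) < 0)"
  obtains \<tau> \<delta> :: real where "\<And>i. i < n \<Longrightarrow> 0 < \<tau> * t i" "\<And>j. j < n \<Longrightarrow> 0 < \<delta> * d j"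
proof -
  have "(\<forall>j<n. 0 < d j) \<or> (\<forall>j<n. d j < 0)"
  proof (rule ccontr)
    assume no: "\<not> ?thesis"
    define p where "p = (\<Sum>j\<in>{j. j < n \<and> 0 < d j}. M 0 j * d j)"
    define q where "q = (\<Sum>j\<in>{j. j < n \<and> \<not> 0 < d j}. M 0 j * d j)"
    obtain j k where jk: "j < n" "0 < d j" "k < n" "d k < 0"
      using no d by (metis linorder_neqE_linordered_idom)
    have p: "0 < p" unfolding p_def
      by (rule sum_pos2[of _ j]) (use jk M[OF n] in \<open>auto intro: less_imp_le\<close>)
    have "0 < (\<Sum>j\<in>{j. j < n \<and> \<not> 0 < d j}. - (M 0 j * d j))"
      by (rule sum_pos2[of _ k])
        (use jk M[OF n] in \<open>auto simp: mult_le_0_iff mult_less_0_iff not_less intro: less_imp_le\<close>)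
    then have q: "q < 0" unfolding q_def by (simp add: sum_negf)
    \<comment> \<open>The columns with \<open>d j > 0\<close> contribute 1 to the first coordinate, the others \<open>-1\<close>.\<close>
    define x where "x = (\<lambda>j. if 0 < d j then 1 / p else - 1 / q)"
    have "(\<Sum>j<n. N 0 j * x j) = t 0 * (\<Sum>j<n. M 0 j * d j * x j)"
      unfolding sum_distrib_left by (rule sum.cong) (use N n in auto)
    also have "(\<Sum>j<n. M 0 j * d j * x j) =
       (\<Sum>j<n. if 0 < d j then M 0 j * d j / p else - (M 0 j * d j) / q)"
      by (rule sum.cong) (auto simp: x_def)
    also have "\<dots> = (\<Sum>j\<in>{..<n} \<inter> {j. 0 < d j}. M 0 j * d j / p) +
        (\<Sum>j\<in>{..<n} \<inter> - {j. 0 < d j}. - (M 0 j * d j) / q)"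
      by (rule sum.If_cases) simp
    also have "{..<n} \<inter> {j. 0 < d j} = {j. j < n \<and> 0 < d j}" by auto
    also have "{..<n} \<inter> - {j. 0 < d j} = {j. j < n \<and> \<not> 0 < d j}" by auto
    also have "(\<Sum>j\<in>{j. j < n \<and> 0 < d j}. M 0 j * d j / p) = 1"
      unfolding sum_divide_distrib[symmetric] p_def[symmetric] using p by simp
    also have "(\<Sum>j\<in>{j. j < n \<and> \<not> 0 < d j}. - (M 0 j * d j) / q) = - 1"
      unfolding sum_divide_distrib[symmetric] sum_negf q_def[symmetric] using q by simp
    finally have "(\<Sum>j<n. N 0 j * x j) = 0" by simp
    moreover have "\<forall>j<n. 0 < x j" using p q by (simp add: x_def)
    ultimately show False using cone[of x] n by force
  qed
  then obtain \<delta> :: real where \<delta>: "\<And>j. j < n \<Longrightarrow> 0 < \<delta> * d j"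
    by (metis mult.left_neutral mult_minus_left neg_0_less_iff_less)
  have sum_pos: "0 < (\<Sum>j<n. M i j * (\<delta> * d j))" if "i < n" for i
    by (rule sum_pos) (use M[OF that] \<delta> n in auto)
  have row: "\<delta> * (\<Sum>j<n. N i j * 1) = t i * (\<Sum>j<n. M i j * (\<delta> * d j))" if "i < n" for i
    unfolding sum_distrib_left by (rule sum.cong) (use N[OF that] in auto)
  have "(\<forall>i<n. 0 < (\<Sum>j<n. N i j * 1)) \<or> (\<forall>i<n. (\<Sum>j<n. N i j * 1) < 0)" by (rule cone) simp
  then obtain \<epsilon> :: real where \<epsilon>: "\<And>i. i < n \<Longrightarrow> 0 < \<epsilon> * (\<Sum>j<n. N i j * 1)"
    by (metis mult.left_neutral mult_minus_left neg_0_less_iff_less)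
  have "0 < \<epsilon> * \<delta> * t i" if "i < n" for i
  proof -
    have "\<delta> \<noteq> 0" using \<delta>[OF n] by auto
    then have "0 < \<delta> * \<delta>" by (simp add: zero_less_mult_iff) force
    then have "0 < (\<epsilon> * (\<Sum>j<n. N i j * 1)) * (\<delta> * \<delta>)" by (rule mult_pos_pos[OF \<epsilon>[OF that]])
    also have "\<dots> = \<epsilon> * \<delta> * (\<delta> * (\<Sum>j<n. N i j * 1))" by (simp only: ac_simps)
    also have "\<dots> = \<epsilon> * \<delta> * t i * (\<Sum>j<n. M i j * (\<delta> * d j))" unfolding row[OF that] by (simp only: ac_simps)
    finally show ?thesis using sum_pos[OF that] by (simp add: zero_less_mult_iff)
  qed
  then show ?thesis using that \<delta> by blast
qed

text \<open>
  The sign may depend on the order of the minor: reversing the columns multiplies all minors of order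
  \<open>m\<close> by \<open>rev_sign m\<close>.
\<close>

definition minor_sign_consistent :: "nat \<Rightarrow> (nat \<Rightarrow> nat \<Rightarrow> real) \<Rightarrow> bool" where
  "minor_sign_consistent n A \<longleftrightarrow>
     (\<forall>m. \<exists>s. \<forall>r c. incr m n r \<longrightarrow> incr m n c \<longrightarrow> 0 < s * mdet A m r c)"

lemma minor_sign_consistent_tp: "tp n A \<Longrightarrow> minor_sign_consistent n A"
  unfolding minor_sign_consistent_def tp_def by (metis mult.left_neutral)

lemma minor_sign_consistent_rev:
  assumes "tp n A" shows "minor_sign_consistent n (\<lambda>i j. A i (n - 1 - j))"
  unfolding minor_sign_consistent_def
proof (intro allI exI impI)
  fix m r c assume r: "incr m n r" and c: "incr m n c"
  have "mdet (\<lambda>i j. A i (n - 1 - j)) m r c = mdet A m r (\<lambda>i. opp n m c (m - 1 - i))"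
    by (rule mdet_cong) (auto simp: opp_def)
  also have "\<dots> = rev_sign m * mdet A m r (opp n m c)" by (rule mdet_rev_cols)
  finally have "rev_sign m * mdet (\<lambda>i j. A i (n - 1 - j)) m r c =
     (rev_sign m * rev_sign m) * mdet A m r (opp n m c)" by (simp add: mult.assoc)
  also have "\<dots> > 0"
    unfolding rev_sign_square using assms r incr_opp[OF c] by (simp add: tp_def)
  finally show "0 < rev_sign m * mdet (\<lambda>i j. A i (n - 1 - j)) m r c" .
qed

lemma minor_sign_consistent_scale:
  assumes A: "minor_sign_consistent n A"
    and t: "\<And>i. i < n \<Longrightarrow> 0 < \<tau> * t i" and d: "\<And>j. j < n \<Longrightarrow> 0 < \<delta> * d j"
    and N: "\<And>i j. i < n \<Longrightarrow> j < n \<Longrightarrow> N i j = t i * A i j * d j"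
  shows "minor_sign_consistent n N"
  unfolding minor_sign_consistent_def
proof
  fix m
  obtain s where s: "\<And>r c. incr m n r \<Longrightarrow> incr m n c \<Longrightarrow> 0 < s * mdet A m r c"
    using A unfolding minor_sign_consistent_def by blast
  have "0 < (\<tau> ^ m * s * \<delta> ^ m) * mdet N m r c" if r: "incr m n r" and c: "incr m n c" for r c
  proof -
    have "mdet N m r c = mdet (\<lambda>i j. t i * A i j * d j) m r c"
      by (rule mdet_cong) (use N incr_less[OF r] incr_less[OF c] in auto)
    also have "\<dots> = (\<Prod>i<m. t (r i)) * mdet A m r c * (\<Prod>j<m. d (c j))" by (rule mdet_scale)
    finally have "(\<tau> ^ m * s * \<delta> ^ m) * mdet N m r c =
       (\<Prod>i<m. \<tau> * t (r i)) * (s * mdet A m r c) * (\<Prod>j<m. \<delta> * d (c j))"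
      by (simp add: prod.distrib)
    moreover have "0 < (\<Prod>i<m. \<tau> * t (r i))" by (rule prod_pos) (use t incr_less[OF r] in auto)
    moreover have "0 < (\<Prod>j<m. \<delta> * d (c j))" by (rule prod_pos) (use d incr_less[OF c] in auto)
    ultimately show ?thesis using mult_pos_pos[OF mult_pos_pos[OF _ s[OF r c]]] by presburger
  qed
  then show "\<exists>s. \<forall>r c. incr m n r \<longrightarrow> incr m n c \<longrightarrow> 0 < s * mdet N m r c" by blast
qed

lemma frame_reverse:
  fixes p :: "nat \<Rightarrow> 'v::euclidean_space"
  assumes p: "frame p"
  defines "p' \<equiv> \<lambda>j. p (DIM('v) - 1 - j)"
  shows "frame p'" "final_flag p' = initial_flag p" "initial_flag p' = final_flag p"
proof -
  show p': "frame p'"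
  proof (rule frameI)
    fix x i assume s: "(\<Sum>i<DIM('v). x i *\<^sub>R p' i) = 0" and i: "i < DIM('v)"
    have "(\<Sum>i<DIM('v). x i *\<^sub>R p' i) = (\<Sum>i<DIM('v). x (DIM('v) - 1 - i) *\<^sub>R p i)"
      unfolding p'_def
      by (rule sum.reindex_bij_witness[where i = "\<lambda>k. DIM('v) - 1 - k" and j = "\<lambda>k. DIM('v) - 1 - k"]) auto
    then have "x (DIM('v) - 1 - (DIM('v) - 1 - i)) = 0"
      using frame_zero[OF p, of "\<lambda>i. x (DIM('v) - 1 - i)" "DIM('v) - 1 - i"] s i by simp
    then show "x i = 0" using i by simp
  qed
  show "final_flag p' = initial_flag p"
    by (rule flag_eq_final_flag[OF is_flag_initial_flag[OF p] p', symmetric])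
      (auto simp: p'_def intro!: frame_in_initial_flag)
  show "initial_flag p' = final_flag p"
    by (rule flag_eq_initial_flag[OF is_flag_final_flag[OF p] p', symmetric])
      (auto simp: p'_def intro!: frame_in_final_flag)
qed

text \<open>
  The two alternatives for \<open>pos\<close> correspond to the two orders in which \<open>\<phi>\<close> may place the images of
  \<open>F'\<close> and \<open>H'\<close>; the second one is reduced to the first by reversing a frame. Then \<open>positive_quadruple_tp\<close>
  provides the totally positive matrix up to the diagonal factors \<open>t\<close> and \<open>d\<close> by which adapted frames
  differ, and the action on lines of the intervals controls their signs.
\<close>

lemma admissible_edge_matrix:
  fixes \<phi> :: "'v::euclidean_space \<Rightarrow> 'v"
  assumes \<phi>: "linear \<phi>" "inj \<phi>" and a: "frame a" "F = final_flag a" "H = initial_flag a"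
    and b: "frame b" "F' = final_flag b" "H' = initial_flag b"
    and into: "\<forall>x. (\<forall>i<DIM('v). 0 < x i) \<longrightarrow> (\<exists>G\<in>U'. is_flag G \<and> (\<Sum>i<DIM('v). x i *\<^sub>R b i) \<in> G 1)"
    and cone: "\<forall>G\<in>U. \<forall>v\<in>G 1. v \<noteq> 0 \<longrightarrow>
       (\<forall>i<DIM('v). 0 < coord a v i) \<or> (\<forall>i<DIM('v). coord a v i < 0)"
    and maps: "flag_act (pgl_class \<phi>) ` U' \<subseteq> U"
    and pos: "positive_tuple [F, flag_act (pgl_class \<phi>) F', flag_act (pgl_class \<phi>) H', H] \<or>
       positive_tuple [F, flag_act (pgl_class \<phi>) H', flag_act (pgl_class \<phi>) F', H]"
  shows "minor_sign_consistent DIM('v) (\<lambda>i j. coord a (\<phi> (b j)) i)"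
proof -
  let ?n = "DIM('v)"
  let ?N = "\<lambda>i j. coord a (\<phi> (b j)) i"
  have n: "0 < ?n" by simp
  have \<phi>b: "frame (\<phi> \<circ> b)" by (rule frame_linear_image[OF b(1) \<phi>])
  have actF: "flag_act (pgl_class \<phi>) F' = final_flag (\<phi> \<circ> b)"
    unfolding b(2) by (rule flag_act_final_flag[OF \<phi>(1) b(1)]) simp
  have actH: "flag_act (pgl_class \<phi>) H' = initial_flag (\<phi> \<circ> b)"
    unfolding b(3) flag_act_pgl_class[OF \<phi>(1) is_flag_initial_flag[OF b(1)]] initial_flag_image[OF \<phi>(1)] ..
  obtain e M where e: "frame e" "final_flag a = final_flag e" "initial_flag a = initial_flag e"
    and M: "minor_sign_consistent ?n M" "\<And>i j. i < ?n \<Longrightarrow> j < ?n \<Longrightarrow> 0 < M i j"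
    and p: "frame (comb e M)" "final_flag (\<phi> \<circ> b) = final_flag (comb e M)" "initial_flag (\<phi> \<circ> b) = initial_flag (comb e M)"
  proof -
    have entry: "0 < A i j" if "tp ?n A" "i < ?n" "j < ?n" for A i j
    proof -
      have "0 < mdet A (Suc 0) (\<lambda>_. i) (\<lambda>_. j)" using that unfolding tp_def by (auto simp: incr_def)
      then show ?thesis by (simp add: mdet_1)
    qed
    show ?thesis
      using pos
    proof
      assume "positive_tuple [F, flag_act (pgl_class \<phi>) F', flag_act (pgl_class \<phi>) H', H]"
      then obtain e A where *: "frame e" "F = final_flag e" "H = initial_flag e" "tp ?n A" "frame (comb e A)"
        "flag_act (pgl_class \<phi>) F' = final_flag (comb e A)" "flag_act (pgl_class \<phi>) H' = initial_flag (comb e A)"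
        by (rule positive_quadruple_tp)
      show ?thesis
        by (rule that[of e A]) (use * a actF actH entry minor_sign_consistent_tp in auto)
    next
      assume "positive_tuple [F, flag_act (pgl_class \<phi>) H', flag_act (pgl_class \<phi>) F', H]"
      then obtain e A where *: "frame e" "F = final_flag e" "H = initial_flag e" "tp ?n A" "frame (comb e A)"
        "flag_act (pgl_class \<phi>) H' = final_flag (comb e A)" "flag_act (pgl_class \<phi>) F' = initial_flag (comb e A)"
        by (rule positive_quadruple_tp)
      let ?A = "\<lambda>i j. A i (?n - 1 - j)"
      have eq: "comb e ?A = (\<lambda>j. comb e A (?n - 1 - j))" by (simp add: comb_def fun_eq_iff)
      note rv = frame_reverse[OF *(5), folded eq]
      show ?thesis
        by (rule that[of e ?A]) (use * a actF actH entry minor_sign_consistent_rev rv in auto)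
    qed
  qed
  obtain t where t: "\<And>j. j < ?n \<Longrightarrow> e j = t j *\<^sub>R a j" "\<And>j. j < ?n \<Longrightarrow> t j \<noteq> 0"
    by (rule adapted_frames[OF a(1) e(1)]) (use e in auto)
  obtain d where d: "\<And>j. j < ?n \<Longrightarrow> (\<phi> \<circ> b) j = d j *\<^sub>R comb e M j" "\<And>j. j < ?n \<Longrightarrow> d j \<noteq> 0"
    by (rule adapted_frames[OF p(1) \<phi>b p(2,3)]) auto
  have N: "?N i j = t i * M i j * d j" if "i < ?n" "j < ?n" for i j
  proof (rule coord_eqI[OF a(1) _ that(1)])
    have "\<phi> (b j) = d j *\<^sub>R comb e M j" using d(1)[OF that(2)] by simp
    also have "\<dots> = (\<Sum>i<?n. (t i * M i j * d j) *\<^sub>R a i)"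
      unfolding comb_def scaleR_sum_right by (rule sum.cong) (use t(1) in \<open>auto simp: ac_simps\<close>)
    finally show "\<phi> (b j) = (\<Sum>i<?n. (t i * M i j * d j) *\<^sub>R a i)" .
  qed
  have coneN: "(\<forall>i<?n. 0 < (\<Sum>j<?n. ?N i j * x j)) \<or> (\<forall>i<?n. (\<Sum>j<?n. ?N i j * x j) < 0)"
    if x: "\<forall>j<?n. 0 < x j" for x
  proof -
    let ?v = "\<Sum>i<?n. x i *\<^sub>R b i"
    obtain G where G: "G \<in> U'" "is_flag G" "?v \<in> G 1" using into x by blast
    have "?v \<noteq> 0" using frame_zero[OF b(1), of x 0] x n by force
    then have nz: "\<phi> ?v \<noteq> 0" using \<phi> linear_injective_0 by blast
    have "\<phi> ?v \<in> flag_act (pgl_class \<phi>) G 1" unfolding flag_act_pgl_class[OF \<phi>(1) G(2)] using G(3) by blast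
    then have c: "(\<forall>i<?n. 0 < coord a (\<phi> ?v) i) \<or> (\<forall>i<?n. coord a (\<phi> ?v) i < 0)"
      using cone maps G(1) nz by blast
    have "coord a (\<phi> ?v) i = (\<Sum>j<?n. ?N i j * x j)" if "i < ?n" for i
    proof -
      have "coord a (\<phi> ?v) i = coord a (\<Sum>j<?n. x j *\<^sub>R \<phi> (b j)) i"
        by (simp add: linear_sum[OF \<phi>(1)] linear_cmul[OF \<phi>(1)])
      also have "\<dots> = (\<Sum>j<?n. x j * ?N i j)"
        using linear_sum[OF coord_linear[OF a(1) that], of "\<lambda>j. x j *\<^sub>R \<phi> (b j)"]
          linear_cmul[OF coord_linear[OF a(1) that]] by simp
      finally show ?thesis by (simp add: mult.commute)
    qed
    then show ?thesis using c by simp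
  qed
  obtain \<tau> \<delta> where "\<And>i. i < ?n \<Longrightarrow> 0 < \<tau> * t i" "\<And>j. j < ?n \<Longrightarrow> 0 < \<delta> * d j"
    by (rule cone_map_signs[OF n M(2) N d(2) coneN]) auto
  then show ?thesis by (rule minor_sign_consistent_scale[OF M(1) _ _ N])
qed

lemma ex_ordered_basis: "\<exists>es :: 'v::euclidean_space list. ordered_basis es"
proof -
  obtain es :: "'v list" where es: "set es = Basis" "distinct es"
    using finite_distinct_list[OF finite_Basis] by blast
  have "length es = DIM('v)" using distinct_card[OF es(2)] es(1) by simp
  then have "ordered_basis es"
    unfolding ordered_basis_def using es independent_Basis span_Basis by auto
  then show ?thesis by blast
qed

text \<open>
  A representative of determinant \<open>\<plusminus>1\<close> exists because rescaling \<open>f\<close> by \<open>c\<close> multiplies its determinant,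
  which is nonzero, by the power \<open>c ^ DIM('v)\<close>.
\<close>

lemma unimodular_rep_pgl_class:
  fixes f :: "'v::euclidean_space \<Rightarrow> 'v"
  assumes f: "linear f" "inj f"
  obtains c where "c \<noteq> 0" "unimodular_rep (pgl_class f) = (\<lambda>v. c *\<^sub>R f v)"
proof -
  let ?n = "DIM('v)"
  define es :: "'v list" where "es = (SOME es. ordered_basis es)"
  have es: "ordered_basis es" unfolding es_def by (rule someI_ex[OF ex_ordered_basis])
  have e: "frame ((!) es)" by (rule ordered_basis_frame[OF es])
  have fe: "frame (f \<circ> (!) es)" by (rule frame_linear_image[OF e f])
  have M: "matrix_of es h \<in> carrier_mat ?n ?n" for h by (simp add: matrix_of_def)
  have nz: "lin_det f \<noteq> 0"
  proof
    assume "lin_det f = 0"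
    then have "det (matrix_of es f) = 0" by (simp add: lin_det_def es_def)
    then obtain u where u: "u \<in> carrier_vec ?n" "u \<noteq> 0\<^sub>v ?n" "matrix_of es f *\<^sub>v u = 0\<^sub>v ?n"
      using det_0_iff_vec_prod_zero_field[OF M] by blast
    have "(\<Sum>j<?n. matrix_of es f $$ (i, j) * u $ j) = 0" if "i < ?n" for i
    proof -
      have "(matrix_of es f *\<^sub>v u) $ i = 0" using u(3) that by simp
      then show ?thesis using u(1) M[of f] that by (simp add: scalar_prod_def lessThan_atLeast0)
    qed
    moreover have "(\<Sum>j<?n. matrix_of es f $$ (i, j) * u $ j) =
        (\<Sum>j<?n. coord ((!) es) (f (es ! j)) i * u $ j)" if "i < ?n" for i
      by (rule sum.cong) (use matrix_of_coord[OF es that] in auto)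
    ultimately have z: "(\<Sum>j<?n. coord ((!) es) (f (es ! j)) i * u $ j) = 0" if "i < ?n" for i
      using that by metis
    have "(\<Sum>j<?n. u $ j *\<^sub>R (f \<circ> (!) es) j) = comb (comb ((!) es) (\<lambda>i j. coord ((!) es) (f (es ! j)) i)) (\<lambda>j _. u $ j) 0"
      using comb_coord[OF e, of "f \<circ> (!) es"] by (simp add: comb_def[of "f \<circ> (!) es"])
    also have "\<dots> = 0"
      unfolding comb_comb by (simp add: comb_def mprod_def z)
    finally have "u $ j = 0" if "j < ?n" for j using frame_zero[OF fe, of "\<lambda>j. u $ j"] that by blast
    then have "u = 0\<^sub>v ?n" using u(1) by (intro eq_vecI) auto
    then show False using u(2) by blast
  qed
  have scale: "lin_det (\<lambda>v. c *\<^sub>R f v) = c ^ ?n * lin_det f" for c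
  proof -
    have "matrix_of es (\<lambda>v. c *\<^sub>R f v) = c \<cdot>\<^sub>m matrix_of es f"
    proof (rule eq_matI)
      fix i j assume "i < dim_row (c \<cdot>\<^sub>m matrix_of es f)" "j < dim_col (c \<cdot>\<^sub>m matrix_of es f)"
      then have ij: "i < ?n" "j < ?n" by (auto simp: matrix_of_def)
      have "matrix_of es (\<lambda>v. c *\<^sub>R f v) $$ (i, j) = c * coord ((!) es) (f (es ! j)) i"
        using matrix_of_coord[OF es ij] linear_cmul[OF coord_linear[OF e ij(1)]] by simp
      also have "\<dots> = (c \<cdot>\<^sub>m matrix_of es f) $$ (i, j)"
        using ij matrix_of_coord[OF es ij] M[of f] by simp
      finally show "matrix_of es (\<lambda>v. c *\<^sub>R f v) $$ (i, j) = (c \<cdot>\<^sub>m matrix_of es f) $$ (i, j)" .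
    qed (auto simp: matrix_of_def)
    then show ?thesis using M[of f] by (simp add: lin_det_def es_def[symmetric])
  qed
  define c where "c = root ?n (1 / \<bar>lin_det f\<bar>)"
  have n0: "0 < ?n" by simp
  have c: "0 < c" unfolding c_def using nz by (simp add: real_root_gt_zero)
  have "c ^ ?n = 1 / \<bar>lin_det f\<bar>" unfolding c_def using nz by (intro real_root_pow_pos2) auto
  then have "\<bar>lin_det (\<lambda>v. c *\<^sub>R f v)\<bar> = 1" unfolding scale abs_mult using nz by simp
  moreover have "(\<lambda>v. c *\<^sub>R f v) \<in> pgl_class f" using c unfolding pgl_class_def by blast
  ultimately have "\<exists>h. h \<in> pgl_class f \<and> \<bar>lin_det h\<bar> = 1" by blast
  then have "unimodular_rep (pgl_class f) \<in> pgl_class f"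
    unfolding unimodular_rep_def by (rule someI2_ex) blast
  then show ?thesis using that unfolding pgl_class_def by blast
qed

section \<open>Products along directed paths\<close>

text \<open>
  Paths are indexed from 0, so that \<open>path_comp \<phi> p i\<close> has \<open>i + 1\<close> factors.
\<close>

primrec path_comp :: "('a \<Rightarrow> 'v \<Rightarrow> 'v) \<Rightarrow> (nat \<Rightarrow> 'a) \<Rightarrow> nat \<Rightarrow> 'v \<Rightarrow> 'v" where
  "path_comp \<phi> p 0 = \<phi> (p 0)"
| "path_comp \<phi> p (Suc i) = path_comp \<phi> p i \<circ> \<phi> (p (Suc i))"

lemma path_comp_linear_inj:
  fixes \<phi> :: "'a \<Rightarrow> 'v::euclidean_space \<Rightarrow> 'v"
  assumes "\<And>i. linear (\<phi> (p i))" "\<And>i. inj (\<phi> (p i))"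
  shows "linear (path_comp \<phi> p i)" "inj (path_comp \<phi> p i)"
proof -
  have "linear (path_comp \<phi> p i) \<and> inj (path_comp \<phi> p i)"
  proof (induction i)
    case 0 then show ?case using assms by simp
  next
    case (Suc i)
    then have "linear (path_comp \<phi> p i \<circ> \<phi> (p (Suc i)))" "inj (path_comp \<phi> p i \<circ> \<phi> (p (Suc i)))"
      using assms by (blast intro: linear_compose inj_compose)+
    then show ?case unfolding path_comp.simps by blast
  qed
  then show "linear (path_comp \<phi> p i)" "inj (path_comp \<phi> p i)" by auto
qed

lemma abs_sum_same_sign:
  fixes f :: "'b \<Rightarrow> real"
  assumes "\<And>x. x \<in> T \<Longrightarrow> 0 < u * f x" shows "\<bar>sum f T\<bar> = (\<Sum>x\<in>T. \<bar>f x\<bar>)"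
proof (cases "0 < u")
  case True
  then have pos: "0 < f x" if "x \<in> T" for x using assms[OF that] by (simp add: zero_less_mult_iff)
  have "(\<Sum>x\<in>T. \<bar>f x\<bar>) = sum f T" by (intro sum.cong refl abs_of_pos pos)
  moreover have "0 \<le> sum f T" by (rule sum_nonneg) (use pos in \<open>auto intro: less_imp_le\<close>)
  ultimately show ?thesis by simp
next
  case False
  have neg: "f x < 0" if "x \<in> T" for x using assms[OF that] False by (simp add: zero_less_mult_iff)
  have "(\<Sum>x\<in>T. \<bar>f x\<bar>) = (\<Sum>x\<in>T. - f x)" by (intro sum.cong refl abs_of_neg neg)
  moreover have "sum f T \<le> 0" by (rule sum_nonpos) (use neg in \<open>auto intro: less_imp_le\<close>)
  ultimately show ?thesis by (simp add: sum_negf)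
qed

text \<open>
  Along a path the matrices of the edges multiply, and by the Cauchy-Binet formula so do their
  compound matrices. By \<open>edge\<close> the entries of each compound matrix have a common sign, so the absolute
  values multiply as well and form products of positive kernels, to which \<open>doeblin_contraction\<close>
  applies.
\<close>

theorem path_singular_gap:
  fixes g :: "'a \<Rightarrow> nat \<Rightarrow> 'v::euclidean_space"
  assumes fin: "finite A" and BA: "B \<subseteq> A \<times> A"
    and g: "\<And>a. a \<in> A \<Longrightarrow> frame (g a)"
    and \<phi>: "\<And>a. a \<in> A \<Longrightarrow> linear (\<phi> a)" "\<And>a. a \<in> A \<Longrightarrow> inj (\<phi> a)"
    and edge: "\<And>a b. (a, b) \<in> B \<Longrightarrow> minor_sign_consistent DIM('v) (\<lambda>i j. coord (g a) (\<phi> a (g b j)) i)"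
    and m: "0 < m" "m < DIM('v)"
  shows "\<exists>C>0. \<exists>\<theta>>0. \<theta> < 1 \<and> (\<forall>p i c. (\<forall>k. (p k, p (Suc k)) \<in> B) \<longrightarrow> c \<noteq> 0 \<longrightarrow>
    singular_values (\<lambda>v. c *\<^sub>R path_comp \<phi> p i v) ! m \<le>
      C * \<theta> ^ i * singular_values (\<lambda>v. c *\<^sub>R path_comp \<phi> p i v) ! (m - 1))"
proof -
  let ?n = "DIM('v)" let ?I = "index_sets m DIM('v)"
  define N where "N = (\<lambda>a b i j. coord (g a) (\<phi> a (g b j)) i)"
  define ker where "ker = (\<lambda>a b K L. \<bar>mdet (N a b) m (pick K) (pick L)\<bar>)"
  have sgnN: "\<exists>s. \<forall>K\<in>?I. \<forall>L\<in>?I. 0 < s * mdet (N a b) m (pick K) (pick L)" if "(a, b) \<in> B" for a b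
    using edge[OF that] incr_pick unfolding minor_sign_consistent_def N_def by meson
  have ker_pos: "0 < ker a b K L" if "(a, b) \<in> B" "K \<in> ?I" "L \<in> ?I" for a b K L
    using sgnN[OF that(1)] that(2,3) unfolding ker_def by force
  \<comment> \<open>The element 1 keeps the set nonempty if the graph has no edges.\<close>
  define vals where "vals = insert 1 ((\<lambda>((a, b), K, L). ker a b K L) ` (B \<times> (?I \<times> ?I)))"
  have finB: "finite B" using fin BA finite_subset by blast
  have fv: "finite vals" unfolding vals_def using finB finite_index_sets by blast
  define \<alpha> where "\<alpha> = Min vals"
  define \<beta> where "\<beta> = Max vals"
  have \<alpha>: "0 < \<alpha>" "\<alpha> \<le> 1" and \<beta>: "1 \<le> \<beta>"
    unfolding \<alpha>_def \<beta>_def using fv ker_pos by (auto simp: vals_def)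
  have ker_bounds: "\<alpha> \<le> ker a b K L \<and> ker a b K L \<le> \<beta>" if "(a, b) \<in> B" "K \<in> ?I" "L \<in> ?I" for a b K L
  proof -
    have "ker a b K L \<in> vals" unfolding vals_def using that by force
    then show ?thesis unfolding \<alpha>_def \<beta>_def using fv by simp
  qed
  let ?gap = "\<lambda>a b C. \<forall>h Q \<epsilon>. linear h \<longrightarrow> inj h \<longrightarrow> (\<forall>j<?n. h (g b j) = comb (g a) Q j) \<longrightarrow> 0 \<le> \<epsilon> \<longrightarrow>
     near_rank_one ?n m \<epsilon> Q \<longrightarrow> singular_values h ! m \<le> C * \<epsilon> * singular_values h ! (m - 1)"
  have "\<exists>C>0. ?gap a b C" if "a \<in> A" "b \<in> A" for a b
    by (rule singular_gap_from_minors[OF g[OF that(2)] g[OF that(1)] m])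
  then obtain C where C: "\<And>a b. a \<in> A \<Longrightarrow> b \<in> A \<Longrightarrow> 0 < C a b" "\<And>a b. a \<in> A \<Longrightarrow> b \<in> A \<Longrightarrow> ?gap a b (C a b)"
    by metis
  define D where "D = 1 + (\<Sum>(a, b)\<in>A \<times> A. C a b)"
  have CD: "C a b \<le> D" if "a \<in> A" "b \<in> A" for a b
  proof -
    have "(case (a, b) of (a, b) \<Rightarrow> C a b) \<le> (\<Sum>(a, b)\<in>A \<times> A. C a b)"
      by (rule member_le_sum) (use that fin C(1) in \<open>auto intro: less_imp_le\<close>)
    then show ?thesis by (simp add: D_def)
  qed
  have D: "0 < D" unfolding D_def using C(1) by (intro add_pos_nonneg sum_nonneg) (auto intro: less_imp_le)
  define \<delta> where "\<delta> = 1 - \<alpha> / \<beta>"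
  have \<delta>: "0 \<le> \<delta>" "\<delta> < 1" unfolding \<delta>_def using \<alpha> \<beta> by (auto simp: field_simps)
  \<comment> \<open>Strictly between \<open>\<delta>\<close> and 1, since \<open>\<delta>\<close> itself may be 0 and \<open>ln \<theta>\<close> is needed.\<close>
  define \<theta> where "\<theta> = (1 + \<delta>) / 2"
  have \<theta>: "0 < \<theta>" "\<theta> < 1" "\<delta> \<le> \<theta>" unfolding \<theta>_def using \<delta> by auto
  have pos: "0 < D * (\<beta> / \<alpha>)" using D \<alpha> \<beta> by simp
  have "\<forall>p i c. (\<forall>k. (p k, p (Suc k)) \<in> B) \<longrightarrow> c \<noteq> 0 \<longrightarrow>
    singular_values (\<lambda>v. c *\<^sub>R path_comp \<phi> p i v) ! m \<le>
      D * (\<beta> / \<alpha>) * \<theta> ^ i * singular_values (\<lambda>v. c *\<^sub>R path_comp \<phi> p i v) ! (m - 1)"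
  proof (intro allI impI)
    fix p :: "nat \<Rightarrow> 'a" and i :: nat and c :: real
    assume p: "\<forall>k. (p k, p (Suc k)) \<in> B" and c: "c \<noteq> 0"
    have pA: "p k \<in> A" for k using p BA by blast
    let ?h = "path_comp \<phi> p"
    define M where "M = (\<lambda>k. N (p k) (p (Suc k)))"
    define Q where "Q = rec_nat (M 0) (\<lambda>k q. mprod ?n q (M (Suc k)))"
    have Q: "Q 0 = M 0" "Q (Suc k) = mprod ?n (Q k) (M (Suc k))" for k by (simp_all add: Q_def)
    have step: "\<phi> (p k) (g (p (Suc k)) j) = comb (g (p k)) (M k) j" for k j
    proof -
      have "comb (g (p k)) (M k) = (\<lambda>j. \<phi> (p k) (g (p (Suc k)) j))"
        unfolding M_def N_def by (rule comb_coord[OF g[OF pA]])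
      then show ?thesis by simp
    qed
    have lin: "linear (?h k)" and inj: "inj (?h k)" for k
      using path_comp_linear_inj[of \<phi> p] \<phi>[OF pA] by auto
    have hQ: "?h k (g (p (Suc k)) j) = comb (g (p 0)) (Q k) j" for k j
    proof (induction k arbitrary: j)
      case 0 then show ?case using step[of 0] by (simp add: Q)
    next
      case (Suc k)
      have "?h (Suc k) (g (p (Suc (Suc k))) j) = ?h k (comb (g (p (Suc k))) (M (Suc k)) j)"
        by (simp add: step)
      also have "\<dots> = comb (?h k \<circ> g (p (Suc k))) (M (Suc k)) j" by (rule linear_comb[OF lin])
      also have "?h k \<circ> g (p (Suc k)) = comb (g (p 0)) (Q k)" using Suc.IH by auto
      finally show ?case by (simp add: comb_comb Q)
    qed
    let ?q = "\<lambda>k K L. mdet (Q k) m (pick K) (pick L)"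
    have sgnM: "\<exists>s. \<forall>K\<in>?I. \<forall>L\<in>?I. 0 < s * mdet (M k) m (pick K) (pick L)" for k
      unfolding M_def using sgnN p by blast
    have qS: "?q (Suc k) K L = (\<Sum>J\<in>?I. ?q k K J * mdet (M (Suc k)) m (pick J) (pick L))" for k K L
      unfolding Q by (rule cauchy_binet)
    have sgnQ: "\<exists>s. \<forall>K\<in>?I. \<forall>L\<in>?I. 0 < s * ?q k K L" for k
    proof (induction k)
      case 0 then show ?case using sgnM[of 0] by (simp add: Q)
    next
      case (Suc k)
      then obtain s where s: "\<forall>K\<in>?I. \<forall>L\<in>?I. 0 < s * ?q k K L" by blast
      obtain t where t: "\<forall>K\<in>?I. \<forall>L\<in>?I. 0 < t * mdet (M (Suc k)) m (pick K) (pick L)" using sgnM by blast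
      have "0 < (s * t) * ?q (Suc k) K L" if KL: "K \<in> ?I" "L \<in> ?I" for K L
      proof -
        have "(s * t) * ?q (Suc k) K L =
            (\<Sum>J\<in>?I. (s * ?q k K J) * (t * mdet (M (Suc k)) m (pick J) (pick L)))"
          unfolding qS sum_distrib_left by (simp add: ac_simps)
        also have "\<dots> > 0" by (rule sum_pos[OF finite_index_sets]) (use KL s t in auto)
        finally show ?thesis .
      qed
      then show ?case by blast
    qed
    define P where "P = (\<lambda>k K L. \<bar>?q k K L\<bar>)"
    have PS: "P (Suc k) K L = (\<Sum>J\<in>?I. P k K J * ker (p (Suc k)) (p (Suc (Suc k))) J L)"
      if KL: "K \<in> ?I" "L \<in> ?I" for k K L
    proof -
      obtain s where s: "\<forall>K\<in>?I. \<forall>L\<in>?I. 0 < s * ?q k K L" using sgnQ by blast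
      obtain t where t: "\<forall>K\<in>?I. \<forall>L\<in>?I. 0 < t * mdet (M (Suc k)) m (pick K) (pick L)" using sgnM by blast
      have "P (Suc k) K L = (\<Sum>J\<in>?I. \<bar>?q k K J * mdet (M (Suc k)) m (pick J) (pick L)\<bar>)"
        unfolding P_def qS
      proof (rule abs_sum_same_sign[of _ "s * t"])
        fix J assume J: "J \<in> ?I"
        have "0 < (s * ?q k K J) * (t * mdet (M (Suc k)) m (pick J) (pick L))"
          by (rule mult_pos_pos) (use s t J KL in auto)
        then show "0 < s * t * (?q k K J * mdet (M (Suc k)) m (pick J) (pick L))" by (simp add: ac_simps)
      qed
      then show ?thesis unfolding P_def ker_def M_def abs_mult .
    qed
    have ne: "?I \<noteq> {}" using incr_eq_pick(1)[OF incr_initial[of m ?n]] m by auto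
    have two: "\<bar>?q i K L * ?q i K' L' - ?q i K L' * ?q i K' L\<bar> \<le>
        ((\<beta> / \<alpha>) * \<theta> ^ i) * (\<Sum>K\<in>?I. \<Sum>L\<in>?I. (?q i K L)\<^sup>2)"
      if I: "K \<in> ?I" "L \<in> ?I" "K' \<in> ?I" "L' \<in> ?I" for K L K' L'
    proof -
      obtain s where s: "\<forall>K\<in>?I. \<forall>L\<in>?I. 0 < s * ?q i K L" using sgnQ by blast
      have prodP: "?q i J J' * ?q i H H' = P i J J' * P i H H'" if "J \<in> ?I" "J' \<in> ?I" "H \<in> ?I" "H' \<in> ?I" for J J' H H'
      proof -
        have "0 < s * ?q i J J'" "0 < s * ?q i H H'" using s that by auto
        then have "0 < ?q i J J' * ?q i H H'" by (auto simp: zero_less_mult_iff)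
        then show ?thesis unfolding P_def abs_mult[symmetric] by simp
      qed
      have sq: "(?q i J J')\<^sup>2 \<le> (\<Sum>K\<in>?I. \<Sum>L\<in>?I. (?q i K L)\<^sup>2)" if "J \<in> ?I" "J' \<in> ?I" for J J'
      proof -
        have "(?q i J J')\<^sup>2 \<le> (\<Sum>L\<in>?I. (?q i J L)\<^sup>2)"
          by (rule member_le_sum[OF that(2)]) (auto simp: finite_index_sets)
        also have "\<dots> \<le> (\<Sum>K\<in>?I. \<Sum>L\<in>?I. (?q i K L)\<^sup>2)"
          by (rule member_le_sum[OF that(1)]) (auto simp: finite_index_sets intro: sum_nonneg)
        finally show ?thesis .
      qed
      have "\<bar>P i K L * P i K' L' - P i K L' * P i K' L\<bar> \<le>
          (\<beta> / \<alpha>) * (1 - \<alpha> / \<beta>) ^ i * (P i K' L * P i K' L')"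
      proof (rule doeblin_contraction[where N = "\<lambda>k. ker (p k) (p (Suc k))" and I = ?I])
        show "\<And>j s t. s \<in> ?I \<Longrightarrow> t \<in> ?I \<Longrightarrow> \<alpha> \<le> ker (p j) (p (Suc j)) s t \<and> ker (p j) (p (Suc j)) s t \<le> \<beta>"
          using ker_bounds p by blast
        show "\<And>s t. s \<in> ?I \<Longrightarrow> t \<in> ?I \<Longrightarrow> P 0 s t = ker (p 0) (p (Suc 0)) s t"
          by (simp add: P_def Q ker_def M_def)
      qed (use finite_index_sets ne \<alpha> PS I in auto)
      also have "\<dots> \<le> ((\<beta> / \<alpha>) * \<theta> ^ i) * (\<Sum>K\<in>?I. \<Sum>L\<in>?I. (?q i K L)\<^sup>2)"
      proof (rule mult_mono)
        show "\<beta> / \<alpha> * (1 - \<alpha> / \<beta>) ^ i \<le> \<beta> / \<alpha> * \<theta> ^ i"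
          using \<theta>(3) \<delta>(1) \<alpha> \<beta> unfolding \<delta>_def by (intro mult_left_mono power_mono) auto
        have "2 * (P i K' L * P i K' L') \<le> (?q i K' L)\<^sup>2 + (?q i K' L')\<^sup>2"
          using sum_squares_bound[of "P i K' L" "P i K' L'"] by (simp add: P_def)
        then show "P i K' L * P i K' L' \<le> (\<Sum>K\<in>?I. \<Sum>L\<in>?I. (?q i K L)\<^sup>2)"
          using sq[OF I(3,2)] sq[OF I(3,4)] by linarith
      qed (use \<alpha> \<beta> \<theta> in \<open>auto simp: P_def\<close>)
      finally show ?thesis unfolding prodP[OF I(1,2,3,4)] prodP[OF I(1,4,3,2)] .
    qed
    define h' where "h' = (\<lambda>v. c *\<^sub>R ?h i v)"
    define Q' where "Q' = (\<lambda>a b. c * Q i a b * 1)"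
    have q': "mdet Q' m (pick K) (pick L) = c ^ m * ?q i K L" for K L
      unfolding Q'_def by (subst mdet_scale) simp
    have lin': "linear h'" unfolding h'_def by (rule linear_compose_scale_right[OF lin])
    have inj': "inj h'" using inj[of i] c unfolding h'_def inj_def by simp
    have hQ': "\<forall>j<?n. h' (g (p (Suc i)) j) = comb (g (p 0)) Q' j"
      unfolding h'_def hQ Q'_def comb_def by (simp add: scaleR_sum_right)
    have "singular_values h' ! m \<le> C (p 0) (p (Suc i)) * ((\<beta> / \<alpha>) * \<theta> ^ i) * singular_values h' ! (m - 1)"
    proof (rule C(2)[OF pA pA, rule_format, OF lin' inj' hQ'[rule_format]])
      show "0 \<le> \<beta> / \<alpha> * \<theta> ^ i" using \<alpha> \<beta> \<theta> by simp
      show "near_rank_one ?n m (\<beta> / \<alpha> * \<theta> ^ i) Q'"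
        unfolding near_rank_one_def
      proof (intro ballI)
        fix K L K' L' assume I: "K \<in> ?I" "L \<in> ?I" "K' \<in> ?I" "L' \<in> ?I"
        have "\<bar>(c ^ m * ?q i K L) * (c ^ m * ?q i K' L') - (c ^ m * ?q i K L') * (c ^ m * ?q i K' L)\<bar> =
           \<bar>(c ^ m)\<^sup>2 * (?q i K L * ?q i K' L' - ?q i K L' * ?q i K' L)\<bar>"
          by (simp add: algebra_simps power2_eq_square)
        also have "\<dots> = (c ^ m)\<^sup>2 * \<bar>?q i K L * ?q i K' L' - ?q i K L' * ?q i K' L\<bar>"
          by (simp add: abs_mult)
        also have "\<dots> \<le> (c ^ m)\<^sup>2 * (((\<beta> / \<alpha>) * \<theta> ^ i) * (\<Sum>K\<in>?I. \<Sum>L\<in>?I. (?q i K L)\<^sup>2))"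
          by (rule mult_left_mono[OF two[OF I]]) simp
        also have "\<dots> = ((\<beta> / \<alpha>) * \<theta> ^ i) * (\<Sum>K\<in>?I. \<Sum>L\<in>?I. (c ^ m * ?q i K L)\<^sup>2)"
          by (simp add: sum_distrib_left power_mult_distrib ac_simps)
        finally show "\<bar>mdet Q' m (pick K) (pick L) * mdet Q' m (pick K') (pick L') -
            mdet Q' m (pick K) (pick L') * mdet Q' m (pick K') (pick L)\<bar> \<le>
           (\<beta> / \<alpha>) * \<theta> ^ i * (\<Sum>K\<in>?I. \<Sum>L\<in>?I. (mdet Q' m (pick K) (pick L))\<^sup>2)"
          unfolding q' .
      qed
    qed
    also have "\<dots> \<le> D * ((\<beta> / \<alpha>) * \<theta> ^ i) * singular_values h' ! (m - 1)"
    proof (intro mult_right_mono CD pA)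
      obtain v w \<sigma> where "\<forall>i<?n. 0 < \<sigma> i" "singular_values h' = map \<sigma> [0..<?n]"
        by (rule singular_value_decomposition[OF lin' inj'])
      then show "0 \<le> singular_values h' ! (m - 1)" using m by (simp add: less_imp_le)
      show "0 \<le> \<beta> / \<alpha> * \<theta> ^ i" using \<alpha> \<beta> \<theta> by simp
    qed
    finally show "singular_values (\<lambda>v. c *\<^sub>R path_comp \<phi> p i v) ! m \<le>
      D * (\<beta> / \<alpha>) * \<theta> ^ i * singular_values (\<lambda>v. c *\<^sub>R path_comp \<phi> p i v) ! (m - 1)"
      unfolding h'_def by (simp add: mult.assoc)
  qed
  then show ?thesis using pos \<theta>(1,2) by blast
qed

section \<open>Directed Anosov representations\<close>

lemma list_prod_closed:
  assumes "group \<Gamma>" "set xs \<subseteq> carrier \<Gamma>" shows "list_prod \<Gamma> xs \<in> carrier \<Gamma>"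
proof -
  interpret group \<Gamma> by fact
  show ?thesis using assms(2) by (induction xs) (auto simp: list_prod_def)
qed

lemma list_prod_snoc:
  assumes "group \<Gamma>" "set xs \<subseteq> carrier \<Gamma>" "x \<in> carrier \<Gamma>"
  shows "list_prod \<Gamma> (xs @ [x]) = list_prod \<Gamma> xs \<otimes>\<^bsub>\<Gamma>\<^esub> x"
proof -
  interpret group \<Gamma> by fact
  show ?thesis using assms(2)
  proof (induction xs)
    case Nil
    then show ?case using assms(3) by (simp add: list_prod_def)
  next
    case (Cons y ys)
    then have "y \<in> carrier \<Gamma>" "list_prod \<Gamma> ys \<in> carrier \<Gamma>"
      using list_prod_closed[OF assms(1)] by auto
    then show ?case using Cons assms(3) by (simp add: list_prod_def m_assoc)
  qed
qed

lemma simple_root_cartan: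
  fixes f :: "'v::euclidean_space \<Rightarrow> 'v"
  assumes f: "linear f" "inj f" and m: "m \<in> {1..DIM('v) - 1}"
  obtains c \<sigma> where "c \<noteq> 0" "singular_values (\<lambda>v. c *\<^sub>R f v) = map \<sigma> [0..<DIM('v)]"
    "0 < \<sigma> m" "\<sigma> m \<le> \<sigma> (m - 1)" "simple_root m (cartan (pgl_class f)) = ln (\<sigma> (m - 1)) - ln (\<sigma> m)"
proof -
  obtain c where c: "c \<noteq> 0" "unimodular_rep (pgl_class f) = (\<lambda>v. c *\<^sub>R f v)"
    by (rule unimodular_rep_pgl_class[OF f])
  have "linear (\<lambda>v. c *\<^sub>R f v)" by (rule linear_compose_scale_right[OF f(1)])
  moreover have "inj (\<lambda>v. c *\<^sub>R f v)" using f(2) c(1) unfolding inj_def by simp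
  ultimately obtain v w \<sigma> where s: "\<forall>i<DIM('v). 0 < \<sigma> i"
      "\<forall>i j. i \<le> j \<longrightarrow> j < DIM('v) \<longrightarrow> \<sigma> j \<le> \<sigma> i"
      "singular_values (\<lambda>v. c *\<^sub>R f v) = map \<sigma> [0..<DIM('v)]"
    by (rule singular_value_decomposition)
  have mn: "m - 1 < DIM('v)" "m < DIM('v)" using m by auto
  then have root: "simple_root m (cartan (pgl_class f)) = ln (\<sigma> (m - 1)) - ln (\<sigma> m)"
    unfolding simple_root_def cartan_def c(2) s(3) by simp
  show ?thesis by (rule that[OF c(1) s(3) _ _ root]) (use s(1,2) mn in auto)
qed

theorem theorem1p3:
  fixes \<Gamma> :: "('g, 'r) monoid_scheme"
    and S :: "'g set"
    and A :: "'a set"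
    and B :: "('a \<times> 'a) set"
    and R :: "'a \<Rightarrow> 'g"
    and \<rho> :: "'g \<Rightarrow> ('v::euclidean_space \<Rightarrow> 'v) set"
  assumes "DIM('v) \<ge> 2"
    and "group \<Gamma>"
    and "finite S" and "S \<subseteq> carrier \<Gamma>" and "generate \<Gamma> S = carrier \<Gamma>"
    and "finite_digraph A B" and "path_symmetric A B"
    and "R \<in> A \<rightarrow> carrier \<Gamma>" and "inj_on R A"
    and "\<rho> \<in> hom \<Gamma> PGL"
    and "weakly_positive A B R \<rho>"
  shows "directed_anosov \<Gamma> S A B R \<rho>"
proof -
  let ?n = "DIM('v)"
  interpret group \<Gamma> by fact
  have finA: "finite A" and BA: "B \<subseteq> A \<times> A" using assms(6) by (auto simp: finite_digraph_def)
  obtain F H K where fd: "forward_domains A B (\<rho> \<circ> R) F H K"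
    using assms(11) unfolding weakly_positive_def admissible_def by blast
  let ?U = "\<lambda>a. flag_interval (F a) (H a) (K a)"
  define adapted where "adapted = (\<lambda>a g. frame g \<and> F a = final_flag g \<and> H a = initial_flag g \<and>
      (\<forall>x. (\<forall>i<?n. 0 < x i) \<longrightarrow> (\<exists>G\<in>?U a. (\<Sum>i<?n. x i *\<^sub>R g i) \<in> G 1)) \<and>
      (\<forall>G\<in>?U a. \<forall>v\<in>G 1. v \<noteq> 0 \<longrightarrow> (\<forall>i<?n. 0 < coord g v i) \<or> (\<forall>i<?n. coord g v i < 0)))"
  have "\<exists>g. adapted a g" if "a \<in> A" for a
  proof -
    have "positive_tuple [F a, H a, K a]" using fd that by (simp add: forward_domains_def)
    then show ?thesis unfolding adapted_def by (rule positive_interval_frame) blast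
  qed
  then obtain g where "\<And>a. a \<in> A \<Longrightarrow> adapted a (g a)" by metis
  then have g: "\<And>a. a \<in> A \<Longrightarrow> frame (g a) \<and> F a = final_flag (g a) \<and> H a = initial_flag (g a) \<and>
      (\<forall>x. (\<forall>i<?n. 0 < x i) \<longrightarrow> (\<exists>G\<in>?U a. (\<Sum>i<?n. x i *\<^sub>R g a i) \<in> G 1)) \<and>
      (\<forall>G\<in>?U a. \<forall>v\<in>G 1. v \<noteq> 0 \<longrightarrow> (\<forall>i<?n. 0 < coord (g a) v i) \<or> (\<forall>i<?n. coord (g a) v i < 0))"
    unfolding adapted_def .
  have RA: "R a \<in> carrier \<Gamma>" if "a \<in> A" for a using assms(8) that by blast
  have "\<exists>\<phi>. \<rho> (R a) = pgl_class \<phi> \<and> linear \<phi> \<and> inj \<phi>" if "a \<in> A" for a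
  proof -
    have "\<rho> (R a) \<in> carrier PGL" using assms(10) RA[OF that] by (auto simp: hom_def)
    then show ?thesis unfolding carrier_PGL by (auto simp: bij_def)
  qed
  then obtain \<phi> where \<phi>: "\<And>a. a \<in> A \<Longrightarrow> \<rho> (R a) = pgl_class (\<phi> a)"
      "\<And>a. a \<in> A \<Longrightarrow> linear (\<phi> a)" "\<And>a. a \<in> A \<Longrightarrow> inj (\<phi> a)"
    by metis
  have edge: "minor_sign_consistent ?n (\<lambda>i j. coord (g a) (\<phi> a (g b j)) i)" if ab: "(a, b) \<in> B" for a b
  proof -
    have a: "a \<in> A" and b: "b \<in> A" using ab BA by auto
    have maps: "flag_act (pgl_class (\<phi> a)) ` ?U b \<subseteq> ?U a"
      and pos: "positive_tuple [F a, flag_act (pgl_class (\<phi> a)) (F b), flag_act (pgl_class (\<phi> a)) (H b), H a] \<or>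
        positive_tuple [F a, flag_act (pgl_class (\<phi> a)) (H b), flag_act (pgl_class (\<phi> a)) (F b), H a]"
      using fd ab \<phi>(1)[OF a] unfolding forward_domains_def by force+
    have into: "\<forall>x. (\<forall>i<?n. 0 < x i) \<longrightarrow> (\<exists>G\<in>?U b. is_flag G \<and> (\<Sum>i<?n. x i *\<^sub>R g b i) \<in> G 1)"
      using g[OF b] unfolding flag_interval_def by blast
    have ga: "frame (g a)" "F a = final_flag (g a)" "H a = initial_flag (g a)"
      and gb: "frame (g b)" "F b = final_flag (g b)" "H b = initial_flag (g b)"
      and cone: "\<forall>G\<in>?U a. \<forall>v\<in>G 1. v \<noteq> 0 \<longrightarrow> (\<forall>i<?n. 0 < coord (g a) v i) \<or> (\<forall>i<?n. coord (g a) v i < 0)"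
      using g[OF a] g[OF b] by simp_all
    show ?thesis
      by (rule admissible_edge_matrix[OF \<phi>(2)[OF a] \<phi>(3)[OF a] ga gb into cone maps pos])
  qed
  define gapped where "gapped = (\<lambda>m C \<theta>. \<forall>p i c. (\<forall>k. (p k, p (Suc k)) \<in> B) \<longrightarrow> c \<noteq> 0 \<longrightarrow>
    singular_values (\<lambda>v. c *\<^sub>R path_comp \<phi> p i v) ! m \<le>
      C * \<theta> ^ i * singular_values (\<lambda>v. c *\<^sub>R path_comp \<phi> p i v) ! (m - 1))"
  have "\<exists>C>0. \<exists>\<theta>>0. \<theta> < 1 \<and> gapped m C \<theta>" if "m \<in> {1..?n - 1}" for m
    unfolding gapped_def
    by (rule path_singular_gap[OF finA BA _ \<phi>(2,3) edge]) (use g that in auto)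
  then obtain C \<theta> where C: "\<And>m. m \<in> {1..?n - 1} \<Longrightarrow> 0 < C m"
    and \<theta>: "\<And>m. m \<in> {1..?n - 1} \<Longrightarrow> 0 < \<theta> m" "\<And>m. m \<in> {1..?n - 1} \<Longrightarrow> \<theta> m < 1"
    and gap: "\<And>m. m \<in> {1..?n - 1} \<Longrightarrow> gapped m (C m) (\<theta> m)"
    by metis
  define \<kappa> where "\<kappa> = Min ((\<lambda>m. - ln (\<theta> m)) ` {1..?n - 1})"
  have ne: "{1..?n - 1} \<noteq> {}" using assms(1) by simp
  have \<kappa>: "0 < \<kappa>" "\<And>m. m \<in> {1..?n - 1} \<Longrightarrow> \<kappa> \<le> - ln (\<theta> m)"
    unfolding \<kappa>_def using ne \<theta> by (auto simp: Min_gr_iff ln_less_zero_iff)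
  \<comment> \<open>The first summand accounts for the shift by one between the element with index \<open>i + 1\<close> and the
     factor \<open>\<theta> ^ i\<close>.\<close>
  define \<kappa>' where "\<kappa>' = \<kappa> + 1 + (\<Sum>m\<in>{1..?n - 1}. \<bar>ln (C m)\<bar>)"
  have \<kappa>': "0 < \<kappa>'" "\<And>m. m \<in> {1..?n - 1} \<Longrightarrow> ln (C m) \<le> \<kappa>' - \<kappa>"
  proof -
    have "0 \<le> (\<Sum>m\<in>{1..?n - 1}. \<bar>ln (C m)\<bar>)" by (rule sum_nonneg) simp
    then show "0 < \<kappa>'" unfolding \<kappa>'_def using \<kappa>(1) by linarith
    fix m assume "m \<in> {1..?n - 1}"
    then have "\<bar>ln (C m)\<bar> \<le> (\<Sum>m\<in>{1..?n - 1}. \<bar>ln (C m)\<bar>)" by (intro member_le_sum) auto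
    then show "ln (C m) \<le> \<kappa>' - \<kappa>" unfolding \<kappa>'_def by linarith
  qed
  have main: "\<kappa> * real i - \<kappa>' \<le> simple_root m (cartan (\<rho> (\<eta> i)))"
    if \<eta>: "directed_seq \<Gamma> A B R \<eta>" and m: "m \<in> {1..?n - 1}" for \<eta> i m
  proof -
    obtain p where ray: "directed_ray A B p"
      and \<eta>0: "\<eta> 0 = \<one>\<^bsub>\<Gamma>\<^esub>" and \<eta>p: "\<And>i. 0 < i \<Longrightarrow> \<eta> i = list_prod \<Gamma> (map (\<lambda>j. R (p j)) [1..<i + 1])"
      using \<eta> unfolding directed_seq_def by blast
    show ?thesis
    proof (cases i)
      case 0
      have "\<rho> (\<eta> 0) \<in> carrier PGL" using assms(10) unfolding \<eta>0 by (auto simp: hom_def)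
      then obtain f where f: "\<rho> (\<eta> 0) = pgl_class f" "linear f" "inj f" unfolding carrier_PGL by (auto simp: bij_def)
      obtain c \<sigma> where "0 < \<sigma> m" "\<sigma> m \<le> \<sigma> (m - 1)"
        "simple_root m (cartan (pgl_class f)) = ln (\<sigma> (m - 1)) - ln (\<sigma> m)"
        by (rule simple_root_cartan[OF f(2,3) m])
      then have "0 \<le> simple_root m (cartan (\<rho> (\<eta> 0)))" unfolding f(1) by simp
      then show ?thesis using \<kappa>'(1) 0 by simp
    next
      case (Suc k)
      let ?p = "\<lambda>k. p (Suc k)"
      have pB: "\<forall>k. (?p k, ?p (Suc k)) \<in> B" and pA: "?p k \<in> A" for k
        using ray unfolding directed_ray_def by auto
      have rep: "\<rho> (\<eta> (Suc k)) = pgl_class (path_comp \<phi> ?p k)" for k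
      proof (induction k)
        case 0
        have "\<eta> (Suc 0) = R (?p 0)" using \<eta>p[of "Suc 0"] RA[OF pA] by (simp add: list_prod_def)
        then show ?case using \<phi>(1)[OF pA] by simp
      next
        case (Suc k)
        let ?xs = "map (\<lambda>j. R (p j)) [1..<Suc k + 1]"
        have xs: "set ?xs \<subseteq> carrier \<Gamma>"
        proof
          fix x assume "x \<in> set ?xs"
          then obtain j where "1 \<le> j" "x = R (p j)" by auto
          then show "x \<in> carrier \<Gamma>" using RA[OF pA[of "j - 1"]] by simp
        qed
        have "\<eta> (Suc (Suc k)) = list_prod \<Gamma> (?xs @ [R (?p (Suc k))])"
          using \<eta>p[of "Suc (Suc k)"] by simp
        also have "\<dots> = \<eta> (Suc k) \<otimes>\<^bsub>\<Gamma>\<^esub> R (?p (Suc k))"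
          using list_prod_snoc[OF assms(2) xs RA[OF pA]] \<eta>p[of "Suc k"] by simp
        finally have "\<rho> (\<eta> (Suc (Suc k))) = \<rho> (\<eta> (Suc k)) \<otimes>\<^bsub>PGL\<^esub> \<rho> (R (?p (Suc k)))"
          using assms(10) RA[OF pA] list_prod_closed[OF assms(2) xs] \<eta>p[of "Suc k"] by (simp add: hom_def)
        also have "\<dots> = pgl_class (path_comp \<phi> ?p k \<circ> \<phi> (?p (Suc k)))"
          unfolding Suc.IH \<phi>(1)[OF pA]
          by (rule mult_PGL) (use path_comp_linear_inj(1)[of \<phi> ?p] \<phi>(2,3)[OF pA] in blast)
        finally show ?case unfolding path_comp.simps .
      qed
      have lin: "linear (path_comp \<phi> ?p k)" "inj (path_comp \<phi> ?p k)"
        using path_comp_linear_inj[of \<phi> ?p] \<phi>(2,3)[OF pA] by blast+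
      obtain c \<sigma> where c: "c \<noteq> 0" "singular_values (\<lambda>v. c *\<^sub>R path_comp \<phi> ?p k v) = map \<sigma> [0..<?n]"
        and \<sigma>: "0 < \<sigma> m" "\<sigma> m \<le> \<sigma> (m - 1)"
        and root: "simple_root m (cartan (pgl_class (path_comp \<phi> ?p k))) = ln (\<sigma> (m - 1)) - ln (\<sigma> m)"
        by (rule simple_root_cartan[OF lin m])
      have mn: "m < ?n" "m - 1 < ?n" using m by auto
      define q where "q = ?p"
      have "\<forall>k. (q k, q (Suc k)) \<in> B" using pB by (simp add: q_def)
      then have "singular_values (\<lambda>v. c *\<^sub>R path_comp \<phi> q k v) ! m \<le>
          C m * \<theta> m ^ k * singular_values (\<lambda>v. c *\<^sub>R path_comp \<phi> q k v) ! (m - 1)"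
        using gap[OF m] c(1) unfolding gapped_def by blast
      then have "\<sigma> m \<le> C m * \<theta> m ^ k * \<sigma> (m - 1)"
        using mn unfolding q_def c(2) by simp
      then have "ln (\<sigma> m) \<le> ln (C m * \<theta> m ^ k * \<sigma> (m - 1))"
        using \<sigma> by (subst ln_le_cancel_iff) (use \<sigma> in linarith)+
      also have "\<dots> = ln (C m) + real k * ln (\<theta> m) + ln (\<sigma> (m - 1))"
        using C[OF m] \<theta>(1)[OF m] \<sigma> by (simp add: ln_mult ln_realpow)
      also have "\<dots> \<le> (\<kappa>' - \<kappa>) + real k * (- \<kappa>) + ln (\<sigma> (m - 1))"
        using \<kappa>'(2)[OF m] \<kappa>(2)[OF m] by (intro add_mono mult_left_mono) auto
      finally have "\<kappa> * real (Suc k) - \<kappa>' \<le> ln (\<sigma> (m - 1)) - ln (\<sigma> m)" by (simp add: algebra_simps)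
      then show ?thesis unfolding Suc rep root .
    qed
  qed
  show ?thesis
    unfolding directed_anosov_def
  proof (intro allI impI)
    show "\<exists>\<kappa>>0. \<exists>\<kappa>'>0. \<forall>\<eta>. directed_seq \<Gamma> A B R \<eta> \<and> quasi_geodesic \<Gamma> S k k' \<eta> \<longrightarrow>
        (\<forall>i. \<forall>m\<in>{1..?n - 1}. \<kappa> * real i - \<kappa>' \<le> simple_root m (cartan (\<rho> (\<eta> i))))" for k k'
      using \<kappa>(1) \<kappa>'(1) main by blast
  qed
qed

end
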